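(* Let $X\subset\mathbb{A}^N$ be a fat point with ideal $I\subset\mathbb{C}[x_1,\ldots,x_N]$, with normal cone $C=C_{X/\mathbb{A}^N}=\operatorname{Spec}S$, $S=\bigoplus_{d\geq0}I^d/I^{d+1}$, and associated projective cone $P(C)=\operatorname{Proj}S$. Then the association $D\mapsto P(D)$ is a bijective correspondence between irreducible components of $C$ and irreducible components of $P(C)$, and there is an identity $$\nu_X=\sum_{D\subset C}\operatorname{length}_{\mathcal{O}_{P(C),P(D)}}\bigl(\mathcal{O}_{P(C),P(D)}\bigr),$$ the sum being over the irreducible components $D$ of $C$. Equivalently, $$\nu_X=\sum_{D\subset C}\operatorname{mult}_{P(D)}E_X\mathbb{A}^N,$$ where $E_X\mathbb{A}^N$ is the exceptional divisor of the blowup $\operatorname{Bl}_X\mathbb{A}^N$.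
   Context: A fat point is a scheme $X=\operatorname{Spec}R$ of finite type over $\mathbb{C}$ with $R$ a local artinian $\mathbb{C}$-algebra. The Behrend number $\nu_X$ of a fat point $X\subset\mathbb{A}^N$ (the value of Behrend's constructible function at the unique point of $X$) is given by $$\nu_X=\sum_{D\subset C}\operatorname{length}_{\mathcal{O}_{C,D}}(\mathcal{O}_{C,D}),$$ the sum being over all irreducible components $D$ of the normal cone $C$, where $\mathcal{O}_{C,D}$ denotes the local ring at the generic point of $D$. An irreducible component $D$ of $C=\operatorname{Spec}S$ has the form $D=V(\mathfrak{p})=\operatorname{Spec}(S/\mathfrak{p})$ for a homogeneous minimal prime $\mathfrak{p}\subset S$, and $P(D)=\operatorname{Proj}(S/\mathfrak{p})$. The exceptional divisor $E_X\mathbb{A}^N$ is the scheme-theoretic preimage of $X$ in $\operatorname{Bl}_X\mathbb{A}^N$; it coincides with $P(C)$. For an irreducible component $V$ of a scheme $Y$, $\operatorname{mult}_VY$ denotes the length of the artinian local ring $\mathcal{O}_{Y,V}$ as a module over itself. *)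

theory Defs
  imports
    "HOL-Algebra.QuotRing"
    "HOL-Algebra.Ideal_Product"
    "HOL-Analysis.Abstract_Topology"
    "HOL-Library.Poly_Mapping"
    "HOL-Library.Extended_Nat"
    "HOL-Decision_Procs.Algebra_Aux"
begin

text \<open>
  The coordinate ring of affine \<open>N\<close>-space, with the variables indexed by a finite type
  of cardinality \<open>N\<close> (so \<open>N \<ge> 1\<close>): a polynomial is a finitely supported family of
  complex coefficients indexed by exponent vectors.
\<close>

type_synonym 'n cpoly = "('n \<Rightarrow>\<^sub>0 nat) \<Rightarrow>\<^sub>0 complex"

abbreviation poly_ring :: "'n cpoly ring"
  where "poly_ring \<equiv> cring_class_ops"

definition is_local :: "('a, 'b) ring_scheme \<Rightarrow> bool"
  where "is_local R \<longleftrightarrow> cring R \<and> (\<exists>!m. maximalideal m R)"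

definition artinian :: "('a, 'b) ring_scheme \<Rightarrow> bool"
  where "artinian R \<longleftrightarrow>
    (\<forall>J :: nat \<Rightarrow> 'a set. (\<forall>n. ideal (J n) R \<and> J (Suc n) \<subseteq> J n) \<longrightarrow> (\<exists>n. \<forall>m\<ge>n. J m = J n))"

text \<open>
  A closed subscheme of affine space is given by its ideal \<open>I\<close>. The quotient
  by \<open>I\<close> is automatically of finite type over the complex numbers.
\<close>

definition fat_point :: "'n::finite cpoly set \<Rightarrow> bool"
  where "fat_point I \<longleftrightarrow>
    ideal I poly_ring \<and> is_local (poly_ring Quot I) \<and> artinian (poly_ring Quot I)"

definition fraction :: "('a, 'b) ring_scheme \<Rightarrow> 'a set \<Rightarrow> 'a \<Rightarrow> 'a \<Rightarrow> ('a \<times> 'a) set"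
  where "fraction R T a s =
    {(b, t). b \<in> carrier R \<and> t \<in> T \<and>
      (\<exists>u\<in>T. u \<otimes>\<^bsub>R\<^esub> (a \<otimes>\<^bsub>R\<^esub> t \<ominus>\<^bsub>R\<^esub> b \<otimes>\<^bsub>R\<^esub> s) = \<zero>\<^bsub>R\<^esub>)}"

definition localization :: "('a, 'b) ring_scheme \<Rightarrow> 'a set \<Rightarrow> ('a \<times> 'a) set ring"
  where "localization R T =
    \<lparr>carrier = {fraction R T a s | a s. a \<in> carrier R \<and> s \<in> T},
     mult = (\<lambda>A B. \<Union>x\<in>A. \<Union>y\<in>B. fraction R T (fst x \<otimes>\<^bsub>R\<^esub> fst y) (snd x \<otimes>\<^bsub>R\<^esub> snd y)),
     one = fraction R T \<one>\<^bsub>R\<^esub> \<one>\<^bsub>R\<^esub>,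
     zero = fraction R T \<zero>\<^bsub>R\<^esub> \<one>\<^bsub>R\<^esub>,
     add = (\<lambda>A B. \<Union>x\<in>A. \<Union>y\<in>B.
       fraction R T (fst x \<otimes>\<^bsub>R\<^esub> snd y \<oplus>\<^bsub>R\<^esub> fst y \<otimes>\<^bsub>R\<^esub> snd x) (snd x \<otimes>\<^bsub>R\<^esub> snd y))\<rparr>"

text \<open>
  The length of a ring as a module over itself: the supremum of the lengths of strictly
  increasing chains of ideals.
\<close>

definition ring_length :: "('a, 'b) ring_scheme \<Rightarrow> enat"
  where "ring_length R =
    Sup {enat n | n. \<exists>J :: nat \<Rightarrow> 'a set. (\<forall>i\<le>n. ideal (J i) R) \<and> (\<forall>i<n. J i \<subset> J (Suc i))}"

text \<open>
  The underlying space of a scheme together with its local rings. Irreducible components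
  and multiplicities depend on nothing else.
\<close>

record ('p, 'a) stalk_space =
  top_space :: "'p topology"
  stalk :: "'p \<Rightarrow> 'a ring"

definition irreducible_in :: "'p topology \<Rightarrow> 'p set \<Rightarrow> bool"
  where "irreducible_in T V \<longleftrightarrow> V \<subseteq> topspace T \<and> V \<noteq> {} \<and>
    (\<forall>F G. closedin T F \<longrightarrow> closedin T G \<longrightarrow> V \<subseteq> F \<union> G \<longrightarrow> V \<subseteq> F \<or> V \<subseteq> G)"

definition irred_components :: "('p, 'a) stalk_space \<Rightarrow> 'p set set"
  where "irred_components Y = {V. irreducible_in (top_space Y) V \<and>
    (\<forall>W. irreducible_in (top_space Y) W \<longrightarrow> V \<subseteq> W \<longrightarrow> W = V)}"

definition generic_point :: "('p, 'a) stalk_space \<Rightarrow> 'p set \<Rightarrow> 'p"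
  where "generic_point Y V =
    (THE x. x \<in> topspace (top_space Y) \<and> top_space Y closure_of {x} = V)"

definition multiplicity_along :: "'p set \<Rightarrow> ('p, 'a) stalk_space \<Rightarrow> enat"
  where "multiplicity_along V Y = ring_length (stalk Y (generic_point Y V))"

definition spec_topology :: "('a, 'b) ring_scheme \<Rightarrow> 'a set topology"
  where "spec_topology R =
    topology (\<lambda>U. \<exists>E\<subseteq>carrier R. U = {p. primeideal p R \<and> \<not> E \<subseteq> p})"

definition Spec :: "('a, 'b) ring_scheme \<Rightarrow> ('a set, ('a \<times> 'a) set) stalk_space"
  where "Spec R = \<lparr>top_space = spec_topology R, stalk = (\<lambda>p. localization R (carrier R - p))\<rparr>"

text \<open>
  A grading of \<open>R\<close> is given by its homogeneous pieces \<open>G d\<close>. \<open>Proj\<close> consists of the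
  homogeneous primes not containing the irrelevant ideal, with the topology induced from
  \<open>Spec\<close>; the local ring at \<open>p\<close> is the degree zero part of the localization at
  the homogeneous elements outside \<open>p\<close>.
\<close>

definition homogeneous_ideal :: "('a, 'b) ring_scheme \<Rightarrow> (nat \<Rightarrow> 'a set) \<Rightarrow> 'a set \<Rightarrow> bool"
  where "homogeneous_ideal R G J \<longleftrightarrow> ideal J R \<and> J = Idl\<^bsub>R\<^esub> (J \<inter> (\<Union>d. G d))"

definition irrelevant_ideal :: "('a, 'b) ring_scheme \<Rightarrow> (nat \<Rightarrow> 'a set) \<Rightarrow> 'a set"
  where "irrelevant_ideal R G = Idl\<^bsub>R\<^esub> (\<Union>d\<in>{1..}. G d)"

definition proj_points :: "('a, 'b) ring_scheme \<Rightarrow> (nat \<Rightarrow> 'a set) \<Rightarrow> 'a set set"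
  where "proj_points R G =
    {p. primeideal p R \<and> homogeneous_ideal R G p \<and> \<not> irrelevant_ideal R G \<subseteq> p}"

definition homogeneous_localization ::
    "('a, 'b) ring_scheme \<Rightarrow> (nat \<Rightarrow> 'a set) \<Rightarrow> 'a set \<Rightarrow> ('a \<times> 'a) set ring"
  where "homogeneous_localization R G p =
    (let T = (\<Union>d. G d) - p
     in (localization R T)
          \<lparr>carrier := {fraction R T a s | a s d. a \<in> G d \<and> s \<in> G d \<and> s \<in> T}\<rparr>)"

definition Proj ::
    "('a, 'b) ring_scheme \<Rightarrow> (nat \<Rightarrow> 'a set) \<Rightarrow> ('a set, ('a \<times> 'a) set) stalk_space"
  where "Proj R G =
    \<lparr>top_space = subtopology (spec_topology R) (proj_points R G),
     stalk = homogeneous_localization R G\<rparr>"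

primrec ideal_pow :: "('a, 'b) ring_scheme \<Rightarrow> 'a set \<Rightarrow> nat \<Rightarrow> 'a set"
  where
    "ideal_pow R I 0 = carrier R"
  | "ideal_pow R I (Suc d) = I \<cdot>\<^bsub>R\<^esub> ideal_pow R I d"

text \<open>
  The associated graded ring: an element is a finitely supported family of
  cosets, the one in degree \<open>d\<close> being a coset of \<open>I^(d+1)\<close> in \<open>I^d\<close>.
  Products of cosets are formed modulo \<open>I^(d+1)\<close>, where \<open>d\<close> is the total degree.
\<close>

definition assoc_graded :: "('a, 'b) ring_scheme \<Rightarrow> 'a set \<Rightarrow> (nat \<Rightarrow> 'a set) ring"
  where "assoc_graded R I =
    \<lparr>carrier = {f. (\<forall>d. \<exists>a\<in>ideal_pow R I d. f d = ideal_pow R I (Suc d) +>\<^bsub>R\<^esub> a) \<and>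
                   finite {d. f d \<noteq> ideal_pow R I (Suc d)}},
     mult = (\<lambda>f g d. finsum (R Quot ideal_pow R I (Suc d))
               (\<lambda>i. rcoset_mult R (ideal_pow R I (Suc d)) (f i) (g (d - i))) {..d}),
     one = (\<lambda>d. if d = 0 then ideal_pow R I 1 +>\<^bsub>R\<^esub> \<one>\<^bsub>R\<^esub> else ideal_pow R I (Suc d)),
     zero = (\<lambda>d. ideal_pow R I (Suc d)),
     add = (\<lambda>f g d. f d <+>\<^bsub>R\<^esub> g d)\<rparr>"

definition assoc_graded_piece :: "('a, 'b) ring_scheme \<Rightarrow> 'a set \<Rightarrow> nat \<Rightarrow> (nat \<Rightarrow> 'a set) set"
  where "assoc_graded_piece R I d =
    {f \<in> carrier (assoc_graded R I). \<forall>e. e \<noteq> d \<longrightarrow> f e = ideal_pow R I (Suc e)}"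

definition normal_cone ::
    "('a, 'b) ring_scheme \<Rightarrow> 'a set \<Rightarrow>
      ((nat \<Rightarrow> 'a set) set, ((nat \<Rightarrow> 'a set) \<times> (nat \<Rightarrow> 'a set)) set) stalk_space"
  where "normal_cone R I = Spec (assoc_graded R I)"

definition projective_cone ::
    "('a, 'b) ring_scheme \<Rightarrow> 'a set \<Rightarrow>
      ((nat \<Rightarrow> 'a set) set, ((nat \<Rightarrow> 'a set) \<times> (nat \<Rightarrow> 'a set)) set) stalk_space"
  where "projective_cone R I = Proj (assoc_graded R I) (assoc_graded_piece R I)"

text \<open>
  \<open>P(D)\<close> for \<open>D = V(p)\<close>: the closed subset of the projective cone underlying
  \<open>Proj (S/p)\<close>. Here \<open>p\<close> is recovered from \<open>D\<close> as the intersection of the primes in \<open>D\<close>.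
\<close>

definition projectivization ::
    "('a, 'b) ring_scheme \<Rightarrow> 'a set \<Rightarrow> (nat \<Rightarrow> 'a set) set set \<Rightarrow> (nat \<Rightarrow> 'a set) set set"
  where "projectivization R I D =
    {q \<in> proj_points (assoc_graded R I) (assoc_graded_piece R I). \<Inter>D \<subseteq> q}"

definition rees_algebra :: "('a, 'b) ring_scheme \<Rightarrow> 'a set \<Rightarrow> (nat \<Rightarrow> 'a) ring"
  where "rees_algebra R I =
    \<lparr>carrier = {f. (\<forall>d. f d \<in> ideal_pow R I d) \<and> finite {d. f d \<noteq> \<zero>\<^bsub>R\<^esub>}},
     mult = (\<lambda>f g d. finsum R (\<lambda>i. f i \<otimes>\<^bsub>R\<^esub> g (d - i)) {..d}),
     one = (\<lambda>d. if d = 0 then \<one>\<^bsub>R\<^esub> else \<zero>\<^bsub>R\<^esub>),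
     zero = (\<lambda>d. \<zero>\<^bsub>R\<^esub>),
     add = (\<lambda>f g d. f d \<oplus>\<^bsub>R\<^esub> g d)\<rparr>"

definition rees_piece :: "('a, 'b) ring_scheme \<Rightarrow> 'a set \<Rightarrow> nat \<Rightarrow> (nat \<Rightarrow> 'a) set"
  where "rees_piece R I d = {f \<in> carrier (rees_algebra R I). \<forall>e. e \<noteq> d \<longrightarrow> f e = \<zero>\<^bsub>R\<^esub>}"

definition rees_const :: "('a, 'b) ring_scheme \<Rightarrow> 'a \<Rightarrow> (nat \<Rightarrow> 'a)"
  where "rees_const R a = (\<lambda>d. if d = 0 then a else \<zero>\<^bsub>R\<^esub>)"

definition blowup ::
    "('a, 'b) ring_scheme \<Rightarrow> 'a set \<Rightarrow>
      ((nat \<Rightarrow> 'a) set, ((nat \<Rightarrow> 'a) \<times> (nat \<Rightarrow> 'a)) set) stalk_space"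
  where "blowup R I = Proj (rees_algebra R I) (rees_piece R I)"

definition blowdown :: "('a, 'b) ring_scheme \<Rightarrow> (nat \<Rightarrow> 'a) set \<Rightarrow> 'a set"
  where "blowdown R q = {a \<in> carrier R. rees_const R a \<in> q}"

text \<open>
  The scheme-theoretic preimage of \<open>V(I)\<close> under the blowdown map: its points are those of the
  blowup lying over \<open>V(I)\<close>, and its local rings are those of the blowup modulo the ideal
  generated by \<open>I\<close>.
\<close>

definition exceptional_divisor ::
    "('a, 'b) ring_scheme \<Rightarrow> 'a set \<Rightarrow>
      ((nat \<Rightarrow> 'a) set, ((nat \<Rightarrow> 'a) \<times> (nat \<Rightarrow> 'a)) set set) stalk_space"
  where "exceptional_divisor R I =
    \<lparr>top_space = subtopology (top_space (blowup R I)) {q. I \<subseteq> blowdown R q},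
     stalk = (\<lambda>q.
       let O\<^sub>q = stalk (blowup R I) q;
           T = (\<Union>d. rees_piece R I d) - q
       in O\<^sub>q Quot (Idl\<^bsub>O\<^sub>q\<^esub> {fraction (rees_algebra R I) T (rees_const R a) \<one>\<^bsub>rees_algebra R I\<^esub> | a. a \<in> I}))\<rparr>"

text \<open>
  The identification of the projective cone with the exceptional divisor, induced by
  the canonical surjection from the Rees algebra onto the associated graded ring.
\<close>

definition rees_to_graded :: "('a, 'b) ring_scheme \<Rightarrow> 'a set \<Rightarrow> (nat \<Rightarrow> 'a) \<Rightarrow> (nat \<Rightarrow> 'a set)"
  where "rees_to_graded R I f = (\<lambda>d. ideal_pow R I (Suc d) +>\<^bsub>R\<^esub> f d)"

definition cone_to_exceptional ::
    "('a, 'b) ring_scheme \<Rightarrow> 'a set \<Rightarrow> (nat \<Rightarrow> 'a set) set \<Rightarrow> (nat \<Rightarrow> 'a) set"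
  where "cone_to_exceptional R I p = {f \<in> carrier (rees_algebra R I). rees_to_graded R I f \<in> p}"

text \<open>
  The associated graded ring is Noetherian, so the sum has finitely many terms.
\<close>

definition behrend_number :: "'n::finite cpoly set \<Rightarrow> enat"
  where "behrend_number I =
    (\<Sum>D\<in>irred_components (normal_cone poly_ring I).
       multiplicity_along D (normal_cone poly_ring I))"

end

theory Submission
  imports
    Defs
    "HOL-Algebra.Subrings"
    "HOL-Analysis.Continuum_Not_Denumerable"
    "HOL-Computational_Algebra.Fundamental_Theorem_Algebra"
begin

text \<open>
  Components of the cone are the minimal primes of the associated graded ring \<open>S\<close>; these are
  homogeneous. None of them contains the irrelevant ideal: \<open>I\<close> is supported at a point, and
  restricting polynomials to a line through that point gives a valuation \<open>v\<close> that is positive on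
  \<open>I\<close>. If \<open>e\<close> is its minimum on \<open>I\<close>, the classes in \<open>I^d / I^(d+1)\<close> of elements with
  \<open>v > d e\<close> span a homogeneous prime that misses an element of degree one and lies below every
  prime containing the irrelevant ideal. So the minimal primes are also the minimal points of
  \<open>Proj S\<close>.

  For the lengths, ideals of a localization are the saturated ideals of the ring, and ideals of a
  degree zero part are the saturated homogeneous ones, as soon as there is an invertible element
  of degree one. At a minimal prime every homogeneous ideal that is saturated for homogeneous
  elements is saturated, and consecutive members of a maximal chain of such ideals admit no
  saturated ideal strictly in between, so a Jordan--Hoelder count shows that the two lengths
  agree. Ideals of the local rings of the exceptional divisor are saturated homogeneous ideals of the
  Rees algebra containing the kernel of its surjection onto \<open>S\<close>, hence again those of \<open>S\<close>.
\<close>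

text \<open>Lengths are suprema in \<open>enat\<close>, so they are compared by asking, for each
  \<open>n\<close>, whether a chain with \<open>n\<close> steps exists. The obstacle is that the two
  local rings attached to a component differ: at its generic point the cone looks like the local
  ring of the projective cone with a free unit of degree one adjoined and then localized. The
  natural map is not an isomorphism, and ideals of the larger ring need not be homogeneous; they can
  only be controlled by counting. A component inside the irrelevant ideal would have empty
  projectivization. The usual way to exclude it is that the cone is pure of dimension
  \<open>N\<close>; the valuation replaces this dimension theory by one explicit prime. It needs an
  actual point of affine space in the support of \<open>I\<close>, hence a Nullstellensatz, obtained
  from the uncountability of the complex numbers, and a line through that point, hence at least one
  variable.\<close>

section \<open>Ideals and prime ideals described by their elements\<close>

lemma (in cring) ideal_iff:
  "ideal J R \<longleftrightarrow> J \<subseteq> carrier R \<and> \<zero> \<in> J \<and> (\<forall>x\<in>J. \<forall>y\<in>J. x \<oplus> y \<in> J)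
     \<and> (\<forall>r\<in>carrier R. \<forall>x\<in>J. r \<otimes> x \<in> J)" (is "_ \<longleftrightarrow> ?rhs")
proof
  assume "ideal J R"
  then interpret ideal J R .
  show ?rhs
    using I_l_closed a_subset by auto
next
  assume *: ?rhs
  show "ideal J R"
  proof (rule idealI)
    show "ring R" by (rule ring_axioms)
    show "subgroup J (add_monoid R)"
    proof (rule add.subgroupI)
      fix x assume "x \<in> J"
      then have "(\<ominus> \<one>) \<otimes> x \<in> J" "x \<in> carrier R" using * by auto
      then show "\<ominus> x \<in> J"
        using l_minus[of \<one> x] by simp
    qed (use * in auto)
    show "x \<otimes> a \<in> J" if "a \<in> J" "x \<in> carrier R" for a x
      using * that by auto
    show "a \<otimes> x \<in> J" if "a \<in> J" "x \<in> carrier R" for a x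
      using * that m_comm[of a x] by auto
  qed
qed

lemma (in cring) primeideal_iff:
  "primeideal P R \<longleftrightarrow> ideal P R \<and> \<one> \<notin> P \<and>
     (\<forall>a\<in>carrier R. \<forall>b\<in>carrier R. a \<otimes> b \<in> P \<longrightarrow> a \<in> P \<or> b \<in> P)"
proof
  assume "primeideal P R"
  then interpret primeideal P R .
  have "\<one> \<notin> P" using one_imp_carrier I_notcarr by metis
  then show "ideal P R \<and> \<one> \<notin> P \<and>
     (\<forall>a\<in>carrier R. \<forall>b\<in>carrier R. a \<otimes> b \<in> P \<longrightarrow> a \<in> P \<or> b \<in> P)"
    using I_prime is_ideal by simp
next
  assume *: "ideal P R \<and> \<one> \<notin> P \<and>
     (\<forall>a\<in>carrier R. \<forall>b\<in>carrier R. a \<otimes> b \<in> P \<longrightarrow> a \<in> P \<or> b \<in> P)"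
  then have "carrier R \<noteq> P" using one_closed by metis
  then show "primeideal P R"
    using * by (intro primeidealI is_cring) simp_all
qed

lemma (in cring) ideal_minus:
  "ideal J R \<Longrightarrow> x \<in> J \<Longrightarrow> y \<in> J \<Longrightarrow> x \<ominus> y \<in> J"
  by (simp add: additive_subgroup.a_inv_closed additive_subgroup.a_closed ideal.axioms(1) minus_eq)

text \<open>Ring laws pass through a surjection that respects the operations. As \<open>B\<close> is
  not yet known to be a ring, \<open>ring_hom\<close> says nothing about its zero, so preservation
  of zero is assumed. This serves the Rees algebra and the associated graded ring.\<close>

lemma cring_surj_image:
  assumes "cring A" "h \<in> ring_hom A B" "h ` carrier A = carrier B" "h \<zero>\<^bsub>A\<^esub> = \<zero>\<^bsub>B\<^esub>"
  shows "cring B"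
proof -
  interpret A: cring A by fact
  have "ring (B\<lparr>carrier := h ` carrier A, zero := h \<zero>\<^bsub>A\<^esub>\<rparr>)"
    using A.ring_hom_imp_img_ring[OF assms(2)] .
  moreover have "B\<lparr>carrier := h ` carrier A, zero := h \<zero>\<^bsub>A\<^esub>\<rparr> = B"
    using assms by simp
  ultimately interpret B: ring B by simp
  show ?thesis
  proof unfold_locales
    fix x y assume "x \<in> carrier B" "y \<in> carrier B"
    then obtain a b where ab: "a \<in> carrier A" "b \<in> carrier A" "x = h a" "y = h b"
      using assms(3) by blast
    then show "x \<otimes>\<^bsub>B\<^esub> y = y \<otimes>\<^bsub>B\<^esub> x"
      using ring_hom_mult[OF assms(2)] A.m_comm by metis
  qed
qed

section \<open>Chains\<close>

text \<open>The number \<open>n\<close> counts strict steps, so \<open>n + 1\<close> sets are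
  involved. The family \<open>P\<close> will range over all ideals, saturated ideals and saturated
  homogeneous ideals.\<close>

definition has_chain :: "'a set set \<Rightarrow> nat \<Rightarrow> bool"
  where "has_chain P n \<longleftrightarrow> (\<exists>J. (\<forall>i\<le>n. J i \<in> P) \<and> (\<forall>i<n. J i \<subset> J (Suc i)))"

lemma ring_length_has_chain:
  "ring_length R = Sup {enat n | n. has_chain {J. ideal J R} n}"
  by (simp add: ring_length_def has_chain_def)

text \<open>A strictly monotone map is enough. Equality of lengths follows from one such map in each
  direction, and the two need not be inverse to each other.\<close>

lemma has_chain_image:
  assumes "\<And>A. A \<in> P \<Longrightarrow> f A \<in> Q"
    and "\<And>A B. A \<in> P \<Longrightarrow> B \<in> P \<Longrightarrow> A \<subset> B \<Longrightarrow> f A \<subset> f B"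
    and "has_chain P n"
  shows "has_chain Q n"
proof -
  obtain J where "\<forall>i\<le>n. J i \<in> P" "\<forall>i<n. J i \<subset> J (Suc i)"
    using assms(3) by (auto simp: has_chain_def)
  then have "(\<forall>i\<le>n. f (J i) \<in> Q) \<and> (\<forall>i<n. f (J i) \<subset> f (J (Suc i)))"
    using assms(1,2) by simp
  then show ?thesis
    unfolding has_chain_def by (intro exI[of _ "\<lambda>i. f (J i)"]) 
qed

section \<open>Irreducible components\<close>

context cring
begin

lemma openin_spec:
  "openin (spec_topology R) U \<longleftrightarrow> (\<exists>E\<subseteq>carrier R. U = {p. primeideal p R \<and> \<not> E \<subseteq> p})"
proof -
  let ?L = "\<lambda>U. \<exists>E\<subseteq>carrier R. U = {p. primeideal p R \<and> \<not> E \<subseteq> p}"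
  have "istopology ?L"
    unfolding istopology_def
  proof (intro conjI allI impI)
    fix U V assume "?L U" "?L V"
    then obtain E F where EF: "E \<subseteq> carrier R" "U = {p. primeideal p R \<and> \<not> E \<subseteq> p}"
        "F \<subseteq> carrier R" "V = {p. primeideal p R \<and> \<not> F \<subseteq> p}" by blast
    \<comment> \<open>A prime contains all products of elements of \<open>E\<close> and
      \<open>F\<close> exactly when it contains \<open>E\<close> or contains \<open>F\<close>, so
      the products describe the intersection of the two open sets.\<close>
    let ?E = "{a \<otimes> b | a b. a \<in> E \<and> b \<in> F}"
    have "?E \<subseteq> carrier R" using EF by blast
    moreover have "\<not> ?E \<subseteq> p \<longleftrightarrow> \<not> E \<subseteq> p \<and> \<not> F \<subseteq> p" if p: "primeideal p R" for p
    proof -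
      interpret p: primeideal p R by fact
      show ?thesis
      proof
        assume "\<not> ?E \<subseteq> p"
        then obtain a b where "a \<in> E" "b \<in> F" "a \<otimes> b \<notin> p" by blast
        then show "\<not> E \<subseteq> p \<and> \<not> F \<subseteq> p"
          using p.I_l_closed p.I_r_closed EF by blast
      next
        assume "\<not> E \<subseteq> p \<and> \<not> F \<subseteq> p"
        then obtain a b where "a \<in> E" "b \<in> F" "a \<notin> p" "b \<notin> p" by blast
        then have "a \<otimes> b \<notin> p" using p.I_prime EF by blast
        then show "\<not> ?E \<subseteq> p" using \<open>a \<in> E\<close> \<open>b \<in> F\<close> by blast
      qed
    qed
    ultimately show "?L (U \<inter> V)"
      using EF by (intro exI[of _ ?E]) blast
  next
    fix K assume "\<forall>U\<in>K. ?L U"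
    then obtain e where e: "\<And>U. U \<in> K \<Longrightarrow> e U \<subseteq> carrier R"
        "\<And>U. U \<in> K \<Longrightarrow> U = {p. primeideal p R \<and> \<not> e U \<subseteq> p}"
      by metis
    have "(\<Union>U\<in>K. U) = (\<Union>U\<in>K. {p. primeideal p R \<and> \<not> e U \<subseteq> p})"
      by (rule SUP_cong[OF refl e(2)])
    also have "\<dots> = {p. primeideal p R \<and> \<not> (\<Union>U\<in>K. e U) \<subseteq> p}" by blast
    finally show "?L (\<Union>K)" using e(1) by (intro exI[of _ "\<Union>U\<in>K. e U"]) auto
  qed
  then show ?thesis
    unfolding spec_topology_def by (simp add: topology_inverse')
qed

lemma topspace_spec: "topspace (spec_topology R) = {p. primeideal p R}"
proof -
  have "openin (spec_topology R) {p. primeideal p R}"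
    unfolding openin_spec using primeideal_iff by (intro exI[of _ "{\<one>}"]) auto
  then show ?thesis
    using openin_subset openin_spec[of "topspace (spec_topology R)"] by fastforce
qed

text \<open>An arbitrary set \<open>X\<close> of primes is allowed so that the cone, the projective
  cone and the exceptional divisor are all handled by the same topology.\<close>

lemma closedin_spec_subtopology:
  assumes "X \<subseteq> {p. primeideal p R}"
  shows "closedin (subtopology (spec_topology R) X) F \<longleftrightarrow>
    (\<exists>E\<subseteq>carrier R. F = {q \<in> X. E \<subseteq> q})"
proof -
  have closed: "closedin (spec_topology R) C \<longleftrightarrow> (\<exists>E\<subseteq>carrier R. C = {p. primeideal p R \<and> E \<subseteq> p})" for C
  proof
    assume "closedin (spec_topology R) C"
    then obtain E where E: "E \<subseteq> carrier R" "C \<subseteq> {p. primeideal p R}"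
        "{p. primeideal p R} - C = {p. primeideal p R \<and> \<not> E \<subseteq> p}"
      unfolding closedin_def topspace_spec openin_spec by (elim conjE exE)
    have "C = {p. primeideal p R} - ({p. primeideal p R} - C)" using E(2) by blast
    also have "\<dots> = {p. primeideal p R \<and> E \<subseteq> p}" unfolding E(3) by blast
    finally show "\<exists>E\<subseteq>carrier R. C = {p. primeideal p R \<and> E \<subseteq> p}" using E(1) by (intro exI conjI)
  next
    assume "\<exists>E\<subseteq>carrier R. C = {p. primeideal p R \<and> E \<subseteq> p}"
    then obtain E where E: "E \<subseteq> carrier R" "C = {p. primeideal p R \<and> E \<subseteq> p}" by (elim exE conjE)
    have "{p. primeideal p R} - C = {p. primeideal p R \<and> \<not> E \<subseteq> p}" unfolding E(2) by blast
    moreover have "C \<subseteq> {p. primeideal p R}" unfolding E(2) by blast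
    ultimately show "closedin (spec_topology R) C"
      using E(1) unfolding closedin_def topspace_spec openin_spec by (intro exI conjI)
  qed
  have restrict: "{p. primeideal p R \<and> E \<subseteq> p} \<inter> X = {q \<in> X. E \<subseteq> q}" for E
    using assms by blast
  show ?thesis
    unfolding closedin_subtopology closed
  proof (intro iffI; elim exE conjE)
    fix T E assume "E \<subseteq> carrier R" "T = {p. primeideal p R \<and> E \<subseteq> p}" "F = T \<inter> X"
    then show "\<exists>E\<subseteq>carrier R. F = {q \<in> X. E \<subseteq> q}"
      using restrict by (intro exI[of _ E]) simp
  next
    fix E assume "E \<subseteq> carrier R" "F = {q \<in> X. E \<subseteq> q}"
    then show "\<exists>T. (\<exists>E\<subseteq>carrier R. T = {p. primeideal p R \<and> E \<subseteq> p}) \<and> F = T \<inter> X"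
      using restrict by (intro exI[of _ "{p. primeideal p R \<and> E \<subseteq> p}"]) auto
  qed
qed

lemma topspace_spec_subtopology:
  "X \<subseteq> {p. primeideal p R} \<Longrightarrow> topspace (subtopology (spec_topology R) X) = X"
  by (auto simp: topspace_spec)

text \<open>If a product lies in every point of \<open>V\<close>, then \<open>V\<close> is covered
  by the two closed sets where one of the factors vanishes, and irreducibility puts \<open>V\<close>
  inside one of them.\<close>

lemma primeideal_Inter_irreducible:
  assumes "X \<subseteq> {p. primeideal p R}" "irreducible_in (subtopology (spec_topology R) X) V"
  shows "primeideal (\<Inter>V) R"
proof -
  have V: "V \<subseteq> X" "V \<noteq> {}"
    using assms topspace_spec_subtopology unfolding irreducible_in_def by auto
  have prime: "primeideal p R" if "p \<in> V" for p
    using that V(1) assms(1) by blast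
  note prime' = prime[unfolded primeideal_iff]
  have "ideal (\<Inter>V) R"
    using prime' V(2) by (intro i_Intersect) auto
  moreover have "\<one> \<notin> \<Inter>V"
    using V(2) prime' by auto
  moreover have "a \<in> \<Inter>V \<or> b \<in> \<Inter>V"
    if ab: "a \<in> carrier R" "b \<in> carrier R" "a \<otimes> b \<in> \<Inter>V" for a b
  proof -
    have closed: "closedin (subtopology (spec_topology R) X) {q \<in> X. {c} \<subseteq> q}"
      if "c \<in> carrier R" for c
      using that unfolding closedin_spec_subtopology[OF assms(1)] by (intro exI[of _ "{c}"]) simp
    have "V \<subseteq> {q \<in> X. {a} \<subseteq> q} \<union> {q \<in> X. {b} \<subseteq> q}"
    proof
      fix q assume "q \<in> V"
      then show "q \<in> {q \<in> X. {a} \<subseteq> q} \<union> {q \<in> X. {b} \<subseteq> q}"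
        using ab prime'[of q] V(1) by auto
    qed
    then have "V \<subseteq> {q \<in> X. {a} \<subseteq> q} \<or> V \<subseteq> {q \<in> X. {b} \<subseteq> q}"
      using assms(2) closed[OF ab(1)] closed[OF ab(2)] unfolding irreducible_in_def by simp
    then show ?thesis by auto
  qed
  ultimately show ?thesis
    by (simp add: primeideal_iff)
qed

text \<open>Closed sets are upward closed in \<open>X\<close>, so whichever of \<open>F\<close> and
  \<open>G\<close> contains \<open>p\<close> contains everything above it.\<close>

lemma irreducible_in_cone:
  assumes "X \<subseteq> {p. primeideal p R}" "p \<in> X"
  shows "irreducible_in (subtopology (spec_topology R) X) {q \<in> X. p \<subseteq> q}"
  unfolding irreducible_in_def
proof (intro conjI allI impI)
  show "{q \<in> X. p \<subseteq> q} \<subseteq> topspace (subtopology (spec_topology R) X)"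
    unfolding topspace_spec_subtopology[OF assms(1)] by auto
  show "{q \<in> X. p \<subseteq> q} \<noteq> {}" using assms(2) by auto
  fix F G assume "closedin (subtopology (spec_topology R) X) F"
    "closedin (subtopology (spec_topology R) X) G" "{q \<in> X. p \<subseteq> q} \<subseteq> F \<union> G"
  then obtain D E where "F = {q \<in> X. D \<subseteq> q}" "G = {q \<in> X. E \<subseteq> q}" "p \<in> F \<union> G"
    unfolding closedin_spec_subtopology[OF assms(1)] using assms(2) by auto
  then show "{q \<in> X. p \<subseteq> q} \<subseteq> F \<or> {q \<in> X. p \<subseteq> q} \<subseteq> G"
    by auto
qed

text \<open>The assumption \<open>Inter\<close> says that \<open>X\<close> contains the generic
  point of each of its irreducible subsets. Larger irreducible sets then mean smaller primes, and
  maximal ones match the minimal members of \<open>X\<close>.\<close>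

lemma irred_components_primes:
  assumes X: "X \<subseteq> {p. primeideal p R}"
    and Inter: "\<And>V. V \<subseteq> X \<Longrightarrow> V \<noteq> {} \<Longrightarrow> primeideal (\<Inter>V) R \<Longrightarrow> \<Inter>V \<in> X"
    and Y: "top_space Y = subtopology (spec_topology R) X"
  shows "irred_components Y = (\<lambda>p. {q \<in> X. p \<subseteq> q}) ` {p \<in> X. \<forall>q\<in>X. q \<subseteq> p \<longrightarrow> q = p}"
proof -
  let ?irr = "irreducible_in (subtopology (spec_topology R) X)"
  have irr: "V \<subseteq> X" "\<Inter>V \<in> X" "?irr {q \<in> X. \<Inter>V \<subseteq> q}" "V \<subseteq> {q \<in> X. \<Inter>V \<subseteq> q}"
    if "?irr V" for V
  proof -
    show "V \<subseteq> X"
      using that topspace_spec_subtopology[OF X] unfolding irreducible_in_def by auto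
    moreover have "V \<noteq> {}" using that unfolding irreducible_in_def by auto
    ultimately show "\<Inter>V \<in> X"
      using Inter primeideal_Inter_irreducible[OF X that] by blast
    then show "?irr {q \<in> X. \<Inter>V \<subseteq> q}" using irreducible_in_cone[OF X] by blast
    show "V \<subseteq> {q \<in> X. \<Inter>V \<subseteq> q}" using \<open>V \<subseteq> X\<close> by blast
  qed
  show ?thesis
  proof (rule Set.set_eqI, rule iffI)
    fix V assume "V \<in> irred_components Y"
    then have V: "?irr V" "\<And>W. ?irr W \<Longrightarrow> V \<subseteq> W \<Longrightarrow> W = V"
      unfolding irred_components_def Y by auto
    have eq: "V = {q \<in> X. \<Inter>V \<subseteq> q}"
      using V(2) irr(3,4)[OF V(1)] by blast
    have "q = \<Inter>V" if "q \<in> X" "q \<subseteq> \<Inter>V" for q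
    proof -
      have "{r \<in> X. q \<subseteq> r} = V"
        using V(2)[OF irreducible_in_cone[OF X that(1)]] irr(1)[OF V(1)] that by blast
      then show ?thesis using that by auto
    qed
    then show "V \<in> (\<lambda>p. {q \<in> X. p \<subseteq> q}) ` {p \<in> X. \<forall>q\<in>X. q \<subseteq> p \<longrightarrow> q = p}"
      using eq irr(2)[OF V(1)] by (intro image_eqI[of _ _ "\<Inter>V"]) simp_all
  next
    fix V assume "V \<in> (\<lambda>p. {q \<in> X. p \<subseteq> q}) ` {p \<in> X. \<forall>q\<in>X. q \<subseteq> p \<longrightarrow> q = p}"
    then obtain p where p: "p \<in> X" "V = {q \<in> X. p \<subseteq> q}" "\<And>q. q \<in> X \<Longrightarrow> q \<subseteq> p \<Longrightarrow> q = p"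
      by (elim imageE CollectE conjE) simp
    have "W = V" if W: "?irr W" "V \<subseteq> W" for W
    proof -
      have "p \<in> W" using p(1,2) W(2) by auto
      then have "\<Inter>W = p"
        using p(3)[OF irr(2)[OF W(1)]] by auto
      then show ?thesis using irr(4)[OF W(1)] W(2) p(2) by simp
    qed
    moreover have "?irr V" unfolding p(2) by (rule irreducible_in_cone[OF X p(1)])
    ultimately show "V \<in> irred_components Y"
      unfolding irred_components_def Y by simp
  qed
qed

text \<open>\<open>generic_point\<close> is a definite description, so uniqueness matters as well:
  the closure of a point consists of the points of \<open>X\<close> above it, and such a set
  determines its least element.\<close>

lemma generic_point_primes:
  assumes X: "X \<subseteq> {p. primeideal p R}" and Y: "top_space Y = subtopology (spec_topology R) X"
    and p: "p \<in> X"
  shows "generic_point Y {q \<in> X. p \<subseteq> q} = p"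
proof -
  have cl: "top_space Y closure_of {r} = {q \<in> X. r \<subseteq> q}" if r: "r \<in> X" for r
  proof (rule closure_of_unique)
    have "r \<subseteq> carrier R"
    proof -
      have "ideal r R" using r X primeideal.axioms(1) by blast
      then show ?thesis by (simp add: ideal_iff)
    qed
    then show "closedin (top_space Y) {q \<in> X. r \<subseteq> q}"
      unfolding Y closedin_spec_subtopology[OF X] by blast
    show "{r} \<subseteq> {q \<in> X. r \<subseteq> q}" using r by simp
    show "{q \<in> X. r \<subseteq> q} \<subseteq> T" if "{r} \<subseteq> T" "closedin (top_space Y) T" for T
      using that unfolding Y closedin_spec_subtopology[OF X] by blast
  qed
  show ?thesis
    unfolding generic_point_def
  proof (rule the_equality)
    show "p \<in> topspace (top_space Y) \<and> top_space Y closure_of {p} = {q \<in> X. p \<subseteq> q}"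
      unfolding Y topspace_spec_subtopology[OF X] using cl[OF p] p by (simp add: Y)
    show "x = p" if "x \<in> topspace (top_space Y) \<and> top_space Y closure_of {x} = {q \<in> X. p \<subseteq> q}" for x
    proof -
      have "x \<in> X" using that unfolding Y topspace_spec_subtopology[OF X] by simp
      then have "{q \<in> X. x \<subseteq> q} = {q \<in> X. p \<subseteq> q}" using that cl by simp
      then show ?thesis using \<open>x \<in> X\<close> p by blast
    qed
  qed
qed

end

section \<open>Localization and saturated ideals\<close>

text \<open>For an ideal and a multiplicative set this characterizes the contractions from the
  localization. \<open>T\<close> stays free because both the full complement of a prime and its
  homogeneous part are used.\<close>

definition saturated :: "('a, 'b) ring_scheme \<Rightarrow> 'a set \<Rightarrow> 'a set \<Rightarrow> bool"
  where "saturated R T J \<longleftrightarrow> (\<forall>x\<in>carrier R. \<forall>u\<in>T. u \<otimes>\<^bsub>R\<^esub> x \<in> J \<longrightarrow> x \<in> J)"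

locale mult_subset = cring R for R (structure) +
  fixes T
  assumes T_carrier: "T \<subseteq> carrier R"
    and one_T: "\<one> \<in> T"
    and mult_T: "s \<in> T \<Longrightarrow> t \<in> T \<Longrightarrow> s \<otimes> t \<in> T"
begin

abbreviation frac where "frac \<equiv> fraction R T"
abbreviation L where "L \<equiv> localization R T"

lemma T_closed [simp]: "s \<in> T \<Longrightarrow> s \<in> carrier R"
  using T_carrier by auto

text \<open>Trading the difference in \<open>fraction\<close> for an equation between two products
  leaves conditions that the laws of a commutative monoid can rearrange.\<close>

lemma mem_fraction:
  assumes "a \<in> carrier R" "s \<in> T"
  shows "x \<in> frac a s \<longleftrightarrow> fst x \<in> carrier R \<and> snd x \<in> T \<and>
    (\<exists>u\<in>T. u \<otimes> (a \<otimes> snd x) = u \<otimes> (fst x \<otimes> s))"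
proof -
  have "u \<otimes> (c \<ominus> d) = \<zero> \<longleftrightarrow> u \<otimes> c = u \<otimes> d"
    if "u \<in> T" "c \<in> carrier R" "d \<in> carrier R" for u c d
  proof -
    have "u \<otimes> (c \<ominus> d) = u \<otimes> c \<ominus> u \<otimes> d"
      using that by (simp add: minus_eq r_distr r_minus)
    then show ?thesis using that by simp
  qed
  then show ?thesis
    using assms unfolding fraction_def by (cases x) auto
qed

lemma fraction_rel_trans:
  assumes "a \<in> carrier R" "b \<in> carrier R" "c \<in> carrier R" "s \<in> T" "t \<in> T" "r \<in> T"
    and "u \<in> T" "u \<otimes> (a \<otimes> t) = u \<otimes> (b \<otimes> s)"
    and "v \<in> T" "v \<otimes> (b \<otimes> r) = v \<otimes> (c \<otimes> t)"
  shows "\<exists>u\<in>T. u \<otimes> (a \<otimes> r) = u \<otimes> (c \<otimes> s)"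
proof
  note [simp] = assms(1-7,9)
  \<comment> \<open>Besides the multipliers \<open>u\<close> and \<open>v\<close>, the denominator
    \<open>t\<close> of the intermediate fraction has to be multiplied in, since it cannot be
    cancelled.\<close>
  show "u \<otimes> v \<otimes> t \<in> T" by (simp add: mult_T)
  have "u \<otimes> v \<otimes> t \<otimes> (a \<otimes> r) = (v \<otimes> r) \<otimes> (u \<otimes> (a \<otimes> t))" by (simp add: m_ac)
  also have "\<dots> = (u \<otimes> s) \<otimes> (v \<otimes> (b \<otimes> r))" unfolding assms(8) by (simp add: m_ac)
  also have "\<dots> = u \<otimes> v \<otimes> t \<otimes> (c \<otimes> s)" unfolding assms(10) by (simp add: m_ac)
  finally show "u \<otimes> v \<otimes> t \<otimes> (a \<otimes> r) = u \<otimes> v \<otimes> t \<otimes> (c \<otimes> s)" .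
qed

lemma fraction_refl: "a \<in> carrier R \<Longrightarrow> s \<in> T \<Longrightarrow> (a, s) \<in> frac a s"
  using one_T by (auto simp: mem_fraction)

lemma fraction_eq_iff:
  assumes "a \<in> carrier R" "s \<in> T" "b \<in> carrier R" "t \<in> T"
  shows "frac a s = frac b t \<longleftrightarrow> (\<exists>u\<in>T. u \<otimes> (a \<otimes> t) = u \<otimes> (b \<otimes> s))"
proof
  assume "frac a s = frac b t"
  then have "(b, t) \<in> frac a s" using fraction_refl assms by simp
  then show "\<exists>u\<in>T. u \<otimes> (a \<otimes> t) = u \<otimes> (b \<otimes> s)"
    using mem_fraction assms by simp
next
  have *: "frac b t \<subseteq> frac a s"
    if H: "a \<in> carrier R" "s \<in> T" "b \<in> carrier R" "t \<in> T" "u \<in> T"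
      "u \<otimes> (a \<otimes> t) = u \<otimes> (b \<otimes> s)" for a b s t u
  proof
    fix x assume "x \<in> frac b t"
    then obtain v where v: "fst x \<in> carrier R" "snd x \<in> T" "v \<in> T"
        "v \<otimes> (b \<otimes> snd x) = v \<otimes> (fst x \<otimes> t)"
      using mem_fraction[of b t x] H by auto
    show "x \<in> frac a s"
      using fraction_rel_trans[OF H(1,3) v(1) H(2,4) v(2) H(5,6) v(3,4)] v H
      by (simp add: mem_fraction)
  qed
  assume "\<exists>u\<in>T. u \<otimes> (a \<otimes> t) = u \<otimes> (b \<otimes> s)"
  then obtain u where "u \<in> T" "u \<otimes> (a \<otimes> t) = u \<otimes> (b \<otimes> s)" by blast
  then show "frac a s = frac b t"
    using *[of a s b t u] *[of b t a s u] assms by auto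
qed

lemma fraction_eqI:
  assumes "a \<in> carrier R" "s \<in> T" "b \<in> carrier R" "t \<in> T" "a \<otimes> t = b \<otimes> s"
  shows "frac a s = frac b t"
  using assms one_T by (auto simp: fraction_eq_iff)

text \<open>The product in \<open>localization\<close> is a union over all representatives.
  Independence of the representatives makes all members of that union equal, so it collapses to a
  single class.\<close>

lemma mult_fraction:
  assumes "a \<in> carrier R" "s \<in> T" "b \<in> carrier R" "t \<in> T"
  shows "frac a s \<otimes>\<^bsub>L\<^esub> frac b t = frac (a \<otimes> b) (s \<otimes> t)"
proof -
  have "frac (fst x \<otimes> fst y) (snd x \<otimes> snd y) = frac (a \<otimes> b) (s \<otimes> t)"
    if H: "x \<in> frac a s" "y \<in> frac b t" for x y
  proof -
    obtain u v where x: "fst x \<in> carrier R" "snd x \<in> T" "u \<in> T"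
        "u \<otimes> (a \<otimes> snd x) = u \<otimes> (fst x \<otimes> s)"
      and y: "fst y \<in> carrier R" "snd y \<in> T" "v \<in> T"
        "v \<otimes> (b \<otimes> snd y) = v \<otimes> (fst y \<otimes> t)"
      using H assms mem_fraction[of a s x] mem_fraction[of b t y] by auto
    note [simp] = assms x(1-3) y(1-3)
    have "(u \<otimes> v) \<otimes> ((a \<otimes> b) \<otimes> (snd x \<otimes> snd y)) =
        (u \<otimes> (a \<otimes> snd x)) \<otimes> (v \<otimes> (b \<otimes> snd y))" by (simp add: m_ac)
    also have "\<dots> = (u \<otimes> v) \<otimes> ((fst x \<otimes> fst y) \<otimes> (s \<otimes> t))"
      unfolding x(4) y(4) by (simp add: m_ac)
    finally have "frac (a \<otimes> b) (s \<otimes> t) = frac (fst x \<otimes> fst y) (snd x \<otimes> snd y)"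
      by (subst fraction_eq_iff) (auto intro!: bexI[of _ "u \<otimes> v"] simp: mult_T)
    then show ?thesis ..
  qed
  then show ?thesis
    using fraction_refl[OF assms(1,2)] fraction_refl[OF assms(3,4)]
    by (auto simp: localization_def)
qed

lemma add_fraction:
  assumes "a \<in> carrier R" "s \<in> T" "b \<in> carrier R" "t \<in> T"
  shows "frac a s \<oplus>\<^bsub>L\<^esub> frac b t = frac (a \<otimes> t \<oplus> b \<otimes> s) (s \<otimes> t)"
proof -
  have "frac (fst x \<otimes> snd y \<oplus> fst y \<otimes> snd x) (snd x \<otimes> snd y) = frac (a \<otimes> t \<oplus> b \<otimes> s) (s \<otimes> t)"
    if H: "x \<in> frac a s" "y \<in> frac b t" for x y
  proof -
    obtain u v where x: "fst x \<in> carrier R" "snd x \<in> T" "u \<in> T"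
        "u \<otimes> (a \<otimes> snd x) = u \<otimes> (fst x \<otimes> s)"
      and y: "fst y \<in> carrier R" "snd y \<in> T" "v \<in> T"
        "v \<otimes> (b \<otimes> snd y) = v \<otimes> (fst y \<otimes> t)"
      using H assms mem_fraction[of a s x] mem_fraction[of b t y] by auto
    note [simp] = assms x(1-3) y(1-3)
    have "(u \<otimes> v) \<otimes> ((a \<otimes> t \<oplus> b \<otimes> s) \<otimes> (snd x \<otimes> snd y)) =
        (v \<otimes> t \<otimes> snd y) \<otimes> (u \<otimes> (a \<otimes> snd x)) \<oplus> (u \<otimes> s \<otimes> snd x) \<otimes> (v \<otimes> (b \<otimes> snd y))"
      by (simp add: m_ac r_distr l_distr)
    also have "\<dots> = (u \<otimes> v) \<otimes> ((fst x \<otimes> snd y \<oplus> fst y \<otimes> snd x) \<otimes> (s \<otimes> t))"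
      unfolding x(4) y(4) by (simp add: m_ac r_distr l_distr)
    finally have "frac (a \<otimes> t \<oplus> b \<otimes> s) (s \<otimes> t) =
        frac (fst x \<otimes> snd y \<oplus> fst y \<otimes> snd x) (snd x \<otimes> snd y)"
      by (subst fraction_eq_iff) (auto intro!: bexI[of _ "u \<otimes> v"] simp: mult_T)
    then show ?thesis ..
  qed
  then show ?thesis
    using fraction_refl[OF assms(1,2)] fraction_refl[OF assms(3,4)]
    by (auto simp: localization_def)
qed

lemma add_fraction_same:
  assumes "a \<in> carrier R" "b \<in> carrier R" "s \<in> T"
  shows "frac a s \<oplus>\<^bsub>L\<^esub> frac b s = frac (a \<oplus> b) s"
proof -
  have "frac (a \<otimes> s \<oplus> b \<otimes> s) (s \<otimes> s) = frac (a \<oplus> b) s"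
    using assms by (intro fraction_eqI) (simp_all add: mult_T m_ac l_distr r_distr)
  then show ?thesis using assms by (simp add: add_fraction)
qed

lemma carrier_localization: "carrier L = {frac a s | a s. a \<in> carrier R \<and> s \<in> T}"
  by (simp add: localization_def)

lemma zero_localization: "\<zero>\<^bsub>L\<^esub> = frac \<zero> \<one>"
  by (simp add: localization_def)

lemma one_localization: "\<one>\<^bsub>L\<^esub> = frac \<one> \<one>"
  by (simp add: localization_def)

lemma fraction_closed [intro, simp]: "a \<in> carrier R \<Longrightarrow> s \<in> T \<Longrightarrow> frac a s \<in> carrier L"
  unfolding carrier_localization by blast

lemma fraction_cases:
  assumes "x \<in> carrier L"
  obtains a s where "a \<in> carrier R" "s \<in> T" "x = frac a s"
  using assms unfolding carrier_localization by blast

lemma cring_localization: "cring L"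
proof (rule cringI)
  note [simp] = one_T mult_T mult_fraction add_fraction zero_localization one_localization
  show "abelian_group L"
  proof (rule abelian_groupI)
    fix x y assume "x \<in> carrier L" "y \<in> carrier L"
    then show "x \<oplus>\<^bsub>L\<^esub> y \<in> carrier L"
      by (auto elim!: fraction_cases)
    from \<open>x \<in> carrier L\<close> \<open>y \<in> carrier L\<close> show "x \<oplus>\<^bsub>L\<^esub> y = y \<oplus>\<^bsub>L\<^esub> x"
      by (auto elim!: fraction_cases simp: m_ac a_ac)
    fix z assume "z \<in> carrier L"
    with \<open>x \<in> carrier L\<close> \<open>y \<in> carrier L\<close>
    show "x \<oplus>\<^bsub>L\<^esub> y \<oplus>\<^bsub>L\<^esub> z = x \<oplus>\<^bsub>L\<^esub> (y \<oplus>\<^bsub>L\<^esub> z)"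
      by (auto elim!: fraction_cases simp: m_ac a_ac l_distr r_distr)
  next
    show "\<zero>\<^bsub>L\<^esub> \<in> carrier L" by simp
  next
    fix x assume x: "x \<in> carrier L"
    then show "\<zero>\<^bsub>L\<^esub> \<oplus>\<^bsub>L\<^esub> x = x"
      by (auto elim!: fraction_cases)
    from x obtain a s where as: "a \<in> carrier R" "s \<in> T" "x = frac a s"
      by (rule fraction_cases)
    have "frac (\<ominus> a) s \<oplus>\<^bsub>L\<^esub> x = \<zero>\<^bsub>L\<^esub>"
      using as fraction_eqI[of \<zero> s \<zero> \<one>] by (simp add: add_fraction_same l_neg del: add_fraction)
    then show "\<exists>y\<in>carrier L. y \<oplus>\<^bsub>L\<^esub> x = \<zero>\<^bsub>L\<^esub>"
      using as by blast
  qed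
  show "comm_monoid L"
    by (rule comm_monoidI) (auto elim!: fraction_cases simp: m_ac)
  fix x y z assume "x \<in> carrier L" "y \<in> carrier L" "z \<in> carrier L"
  then obtain a s b t c r where *: "a \<in> carrier R" "s \<in> T" "x = frac a s"
    "b \<in> carrier R" "t \<in> T" "y = frac b t" "c \<in> carrier R" "r \<in> T" "z = frac c r"
    by (auto elim!: fraction_cases)
  then have "frac ((a \<otimes> t \<oplus> b \<otimes> s) \<otimes> c) (s \<otimes> t \<otimes> r) =
      frac (a \<otimes> c \<otimes> (t \<otimes> r) \<oplus> b \<otimes> c \<otimes> (s \<otimes> r)) (s \<otimes> r \<otimes> (t \<otimes> r))"
    by (intro fraction_eqI) (simp_all add: m_ac l_distr r_distr)
  with * show "(x \<oplus>\<^bsub>L\<^esub> y) \<otimes>\<^bsub>L\<^esub> z = x \<otimes>\<^bsub>L\<^esub> z \<oplus>\<^bsub>L\<^esub> y \<otimes>\<^bsub>L\<^esub> z"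
    by simp
qed

lemma fraction_split:
  assumes "a \<in> carrier R" "s \<in> T" "t \<in> T"
  shows "frac a t = frac a s \<otimes>\<^bsub>L\<^esub> frac s t"
  using assms by (subst mult_fraction; (intro fraction_eqI)?) (simp_all add: mult_T m_ac)

text \<open>Contraction \<open>f\<close> is strictly monotone on all ideals of the localization,
  extension \<open>g\<close> on the saturated ideals of \<open>R\<close>; this is the reason for
  restricting to the latter.\<close>

lemma has_chain_localization:
  "has_chain {J. ideal J L} n \<longleftrightarrow> has_chain {J. ideal J R \<and> saturated R T J} n"
proof -
  interpret L: cring L by (rule cring_localization)
  show ?thesis
  proof
    define f where "f A = {x \<in> carrier R. frac x \<one> \<in> A}" for A
    \<comment> \<open>The denominator is immaterial, because \<open>s/1\<close> and
      \<open>1/s\<close> are both elements of the localization.\<close>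
    have mem: "x \<in> f A \<longleftrightarrow> frac x s \<in> A" if "ideal A L" "x \<in> carrier R" "s \<in> T" for A x s
    proof -
      interpret A: ideal A L by fact
      have "frac x \<one> = frac s \<one> \<otimes>\<^bsub>L\<^esub> frac x s" "frac x s = frac \<one> s \<otimes>\<^bsub>L\<^esub> frac x \<one>"
        using that one_T
        by (subst mult_fraction; (intro fraction_eqI)?; simp add: mult_T m_ac)+
      moreover have "frac s \<one> \<in> carrier L" "frac \<one> s \<in> carrier L" using that one_T by auto
      ultimately show ?thesis
        using A.I_l_closed that(2) unfolding f_def by (metis (no_types, lifting) mem_Collect_eq)
    qed
    show "has_chain {J. ideal J R \<and> saturated R T J} n" if "has_chain {J. ideal J L} n"
    proof (rule has_chain_image[OF _ _ that, where f = f])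
      fix A assume "A \<in> {J. ideal J L}"
      then have A: "ideal A L" by simp
      interpret A: ideal A L by fact
      have "ideal (f A) R"
        unfolding ideal_iff
      proof (intro conjI ballI)
        show "f A \<subseteq> carrier R" by (auto simp: f_def)
        show "\<zero> \<in> f A" using A.zero_closed by (simp add: f_def zero_localization)
        fix x y assume "x \<in> f A" "y \<in> f A"
        then show "x \<oplus> y \<in> f A"
          using A.a_closed[of "frac x \<one>" "frac y \<one>"] add_fraction_same[of x y \<one>] one_T by (auto simp: f_def)
      next
        fix r x assume "r \<in> carrier R" "x \<in> f A"
        then show "r \<otimes> x \<in> f A"
          using A.I_l_closed[of "frac x \<one>" "frac r \<one>"] one_T
          by (auto simp: f_def mult_fraction)
      qed
      moreover have "saturated R T (f A)"
        unfolding saturated_def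
      proof (intro ballI impI)
        fix x u assume *: "x \<in> carrier R" "u \<in> T" "u \<otimes> x \<in> f A"
        then have "frac (u \<otimes> x) u \<in> A" using mem[OF A] by simp
        moreover have "frac (u \<otimes> x) u = frac x \<one>"
          using * one_T by (intro fraction_eqI) (simp_all add: m_ac)
        ultimately show "x \<in> f A" using * by (simp add: f_def)
      qed
      ultimately show "f A \<in> {J. ideal J R \<and> saturated R T J}" by simp
    next
      fix A B assume *: "A \<in> {J. ideal J L}" "B \<in> {J. ideal J L}" "A \<subset> B"
      then obtain z where z: "z \<in> B" "z \<notin> A" by blast
      then have "z \<in> carrier L" using * L.ideal_iff[of B] by auto
      then obtain a s where "a \<in> carrier R" "s \<in> T" "z = frac a s" by (rule fraction_cases)
      then have "a \<in> f B" "a \<notin> f A" using * z mem[of B a s] mem[of A a s] by auto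
      moreover have "f A \<subseteq> f B" using * by (auto simp: f_def)
      ultimately show "f A \<subset> f B" by blast
    qed
    define g where "g A = {frac a s | a s. a \<in> A \<and> s \<in> T}" for A
    have g_I: "frac a s \<in> g A" if "a \<in> A" "s \<in> T" for a s A
      using that unfolding g_def by blast
    have g_E: "\<exists>a s. x = frac a s \<and> a \<in> A \<and> s \<in> T" if "x \<in> g A" for x A
      using that unfolding g_def by blast
    show "has_chain {J. ideal J L} n" if "has_chain {J. ideal J R \<and> saturated R T J} n"
    proof (rule has_chain_image[OF _ _ that, where f = g])
      fix A assume "A \<in> {J. ideal J R \<and> saturated R T J}"
      then have A: "ideal A R" by simp
      interpret A: ideal A R by fact
      have "ideal (g A) L"
        unfolding L.ideal_iff
      proof (intro conjI ballI)
        show "g A \<subseteq> carrier L" using g_E by force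
        show "\<zero>\<^bsub>L\<^esub> \<in> g A" using A.zero_closed one_T by (simp add: g_I zero_localization)
        fix x y assume "x \<in> g A" "y \<in> g A"
        then obtain a s b t where *: "x = frac a s" "y = frac b t" "a \<in> A" "b \<in> A" "s \<in> T" "t \<in> T"
          using g_E[of x A] g_E[of y A] by blast
        then have "x \<oplus>\<^bsub>L\<^esub> y = frac (a \<otimes> t \<oplus> b \<otimes> s) (s \<otimes> t)"
          by (simp add: add_fraction)
        moreover have "a \<otimes> t \<oplus> b \<otimes> s \<in> A" using * by (simp add: A.I_r_closed)
        ultimately show "x \<oplus>\<^bsub>L\<^esub> y \<in> g A"
          using * mult_T[of s t] by (simp add: g_I)
      next
        fix x y assume "x \<in> carrier L" "y \<in> g A"
        then obtain a s b t where *: "x = frac a s" "y = frac b t" "a \<in> carrier R" "b \<in> A" "s \<in> T" "t \<in> T"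
          using g_E[of y A] by (blast elim: fraction_cases)
        then have "x \<otimes>\<^bsub>L\<^esub> y = frac (a \<otimes> b) (s \<otimes> t)"
          by (simp add: mult_fraction)
        then show "x \<otimes>\<^bsub>L\<^esub> y \<in> g A"
          using * mult_T[of s t] A.I_l_closed[of b a] by (simp add: g_I)
      qed
      then show "g A \<in> {J. ideal J L}" by simp
    next
      fix A B assume *: "A \<in> {J. ideal J R \<and> saturated R T J}" "B \<in> {J. ideal J R \<and> saturated R T J}" "A \<subset> B"
      then obtain b where b: "b \<in> B" "b \<notin> A" by blast
      interpret A: ideal A R using * by simp
      have bc: "b \<in> carrier R" using * b ideal_iff[of B] by auto
      \<comment> \<open>Here saturation acts: an equality of \<open>b/1\<close> with a fraction
        whose numerator lies in \<open>A\<close> only puts a multiple of \<open>b\<close> by an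
        element of \<open>T\<close> into \<open>A\<close>.\<close>
      have "frac b \<one> \<notin> g A"
      proof
        assume "frac b \<one> \<in> g A"
        then obtain a s where as: "a \<in> A" "s \<in> T" "frac b \<one> = frac a s" using g_E by blast
        then obtain u where u: "u \<in> T" "u \<otimes> (b \<otimes> s) = u \<otimes> (a \<otimes> \<one>)"
          using fraction_eq_iff[of b \<one> a s] bc one_T by auto
        then have "(u \<otimes> s) \<otimes> b \<in> A"
          using as bc A.I_l_closed[of a u] by (simp add: m_ac)
        moreover have "saturated R T A" using * by simp
        ultimately have "b \<in> A"
          using mult_T[OF u(1) as(2)] bc unfolding saturated_def by blast
        then show False using b by simp
      qed
      moreover have "frac b \<one> \<in> g B" using b one_T by (simp add: g_I)
      moreover have "g A \<subseteq> g B" using *(3) unfolding g_def by blast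
      ultimately show "g A \<subset> g B" by blast
    qed
  qed
qed

end

section \<open>Minimal primes\<close>

text \<open>An ideal maximal among those disjoint from \<open>T\<close> is prime: adjoining an
  element outside it meets \<open>T\<close>, and multiplying two such meetings stays in
  \<open>T\<close>.\<close>

lemma (in mult_subset) ex_primeideal_disjoint:
  assumes "\<zero> \<notin> T"
  shows "\<exists>q. primeideal q R \<and> q \<inter> T = {}"
proof -
  let ?A = "{J. ideal J R \<and> J \<inter> T = {}}"
  have "\<exists>M\<in>?A. \<forall>X\<in>?A. M \<subseteq> X \<longrightarrow> X = M"
  proof (rule subset_Zorn_nonempty)
    show "?A \<noteq> {}" using zeroideal assms by auto
    fix C assume C: "C \<noteq> {}" "subset.chain ?A C"
    have lin: "X \<subseteq> Y \<or> Y \<subseteq> X" if "X \<in> C" "Y \<in> C" for X Y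
      using C(2) that by (auto simp: subset_chain_def)
    have id: "ideal X R" "X \<inter> T = {}" if "X \<in> C" for X
      using C(2) that by (auto simp: subset_chain_def)
    have "ideal (\<Union>C) R"
      unfolding ideal_iff
    proof (intro conjI ballI)
      show "\<Union>C \<subseteq> carrier R" using id(1) unfolding ideal_iff by blast
      show "\<zero> \<in> \<Union>C" using C(1) id(1) unfolding ideal_iff by blast
      fix x y assume "x \<in> \<Union>C" "y \<in> \<Union>C"
      then obtain X where "X \<in> C" "x \<in> X" "y \<in> X" using lin by blast
      then show "x \<oplus> y \<in> \<Union>C" using id(1) unfolding ideal_iff by blast
    next
      fix r x assume "r \<in> carrier R" "x \<in> \<Union>C"
      then show "r \<otimes> x \<in> \<Union>C" using id(1) unfolding ideal_iff by blast
    qed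
    then show "\<Union>C \<in> ?A" using id(2) by auto
  qed
  then obtain M where M: "ideal M R" "M \<inter> T = {}"
      "\<And>X. ideal X R \<Longrightarrow> X \<inter> T = {} \<Longrightarrow> M \<subseteq> X \<Longrightarrow> X = M" by auto
  interpret M: ideal M R by fact
  have meets: "\<exists>m\<in>M. \<exists>r\<in>carrier R. m \<oplus> r \<otimes> a \<in> T" if a: "a \<in> carrier R" "a \<notin> M" for a
  proof (rule ccontr)
    assume contr: "\<not> ?thesis"
    let ?X = "{m \<oplus> r \<otimes> a | m r. m \<in> M \<and> r \<in> carrier R}"
    have X1: "ideal ?X R"
      unfolding ideal_iff
    proof (intro conjI ballI)
      show "?X \<subseteq> carrier R" using a by auto
      have "\<zero> = \<zero> \<oplus> \<zero> \<otimes> a" using a by simp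
      then show "\<zero> \<in> ?X" using M.zero_closed by blast
      fix x y assume "x \<in> ?X" "y \<in> ?X"
      then obtain m r n s where *: "x = m \<oplus> r \<otimes> a" "y = n \<oplus> s \<otimes> a"
        "m \<in> M" "n \<in> M" "r \<in> carrier R" "s \<in> carrier R" by blast
      then have "x \<oplus> y = (m \<oplus> n) \<oplus> (r \<oplus> s) \<otimes> a"
        using a by (simp add: l_distr a_ac)
      then show "x \<oplus> y \<in> ?X" using * by (blast intro: M.a_closed a_closed)
    next
      fix s x assume "s \<in> carrier R" "x \<in> ?X"
      then obtain m r where *: "x = m \<oplus> r \<otimes> a" "m \<in> M" "r \<in> carrier R" "s \<in> carrier R" by blast
      then have "s \<otimes> x = (s \<otimes> m) \<oplus> (s \<otimes> r) \<otimes> a"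
        using a by (simp add: r_distr m_ac)
      then show "s \<otimes> x \<in> ?X" using * by (blast intro: M.I_l_closed m_closed)
    qed
    have X2: "?X \<inter> T = {}" using contr by auto
    have X3: "M \<subseteq> ?X"
    proof
      fix m assume m: "m \<in> M"
      then have "m = m \<oplus> \<zero> \<otimes> a" using a by simp
      then show "m \<in> ?X" using m by blast
    qed
    have "a = \<zero> \<oplus> \<one> \<otimes> a" using a by simp
    then have "a \<in> ?X" using M.zero_closed by blast
    then show False using a(2) unfolding M(3)[OF X1 X2 X3] by simp
  qed
  have "primeideal M R"
    unfolding primeideal_iff
  proof (intro conjI ballI impI)
    show "ideal M R" by fact
    show "\<one> \<notin> M" using M(2) one_T by auto
    fix a b assume ab: "a \<in> carrier R" "b \<in> carrier R" "a \<otimes> b \<in> M"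
    show "a \<in> M \<or> b \<in> M"
    proof (rule ccontr)
      assume "\<not> ?thesis"
      then obtain m r n s where *: "m \<in> M" "r \<in> carrier R" "m \<oplus> r \<otimes> a \<in> T"
          "n \<in> M" "s \<in> carrier R" "n \<oplus> s \<otimes> b \<in> T"
        using meets[of a] meets[of b] ab by blast
      have "(m \<oplus> r \<otimes> a) \<otimes> (n \<oplus> s \<otimes> b) =
          (n \<oplus> s \<otimes> b) \<otimes> m \<oplus> ((r \<otimes> a) \<otimes> n \<oplus> (r \<otimes> s) \<otimes> (a \<otimes> b))"
        using * ab by (simp add: l_distr r_distr m_ac a_ac)
      also have "\<dots> \<in> M"
        using * ab M.I_l_closed[OF ab(3), of "r \<otimes> s"] by (intro M.a_closed M.I_l_closed[of m] M.I_l_closed[of n]) auto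
      finally show False using M(2) mult_T[OF *(3,6)] by blast
    qed
  qed
  then show ?thesis using M(2) by blast
qed

definition minimal_prime :: "('a, 'b) ring_scheme \<Rightarrow> 'a set \<Rightarrow> bool"
  where "minimal_prime R p \<longleftrightarrow> primeideal p R \<and> (\<forall>q. primeideal q R \<longrightarrow> q \<subseteq> p \<longrightarrow> q = p)"

text \<open>Elements of a minimal prime become nilpotent in the localization there. If zero were not
  of the form w x^k, a prime avoiding all these products would lie inside \<open>p\<close> and miss
  \<open>x\<close>, against minimality.\<close>

lemma (in cring) minimal_prime_nilpotent:
  assumes "minimal_prime R p" "x \<in> p"
  obtains w and k :: nat where "w \<in> carrier R" "w \<notin> p" "w \<otimes> x [^] k = \<zero>"
proof (rule ccontr)
  assume "\<not> thesis"
  note contr = this that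
  have p: "primeideal p R" using assms(1) by (simp add: minimal_prime_def)
  interpret p: primeideal p R by fact
  have x: "x \<in> carrier R" using assms(2) by auto
  have one: "\<one> \<notin> p" using p primeideal_iff[of p] by simp
  let ?T = "{w \<otimes> x [^] k | w (k::nat). w \<in> carrier R \<and> w \<notin> p}"
  have mult: "mult_subset R ?T"
  proof unfold_locales
    show "?T \<subseteq> carrier R" using x by auto
    have "\<one> = \<one> \<otimes> x [^] (0::nat)" by simp
    then show "\<one> \<in> ?T" using one by blast
    fix s t assume "s \<in> ?T" "t \<in> ?T"
    then obtain v k w l where *: "s = v \<otimes> x [^] (k::nat)" "t = w \<otimes> x [^] (l::nat)"
      "v \<in> carrier R" "v \<notin> p" "w \<in> carrier R" "w \<notin> p" by blast
    have "s \<otimes> t = (v \<otimes> w) \<otimes> (x [^] k \<otimes> x [^] l)"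
      using * x by (simp add: m_ac)
    then have "s \<otimes> t = (v \<otimes> w) \<otimes> x [^] (k + l)"
      using x by (simp add: nat_pow_mult)
    moreover have "v \<otimes> w \<notin> p" using * p.I_prime by blast
    ultimately show "s \<otimes> t \<in> ?T" using * by blast
  qed
  have "\<zero> \<notin> ?T"
  proof
    assume "\<zero> \<in> ?T"
    then obtain w and k :: nat where "w \<in> carrier R" "w \<notin> p" "\<zero> = w \<otimes> x [^] k" by blast
    then show False using contr(1) contr(2)[of w k] by simp
  qed
  then obtain q where q: "primeideal q R" "q \<inter> ?T = {}"
    using mult_subset.ex_primeideal_disjoint[OF mult] by blast
  have qc: "q \<subseteq> carrier R" using q(1) ideal_iff[of q] primeideal_iff[of q] by simp
  have "q \<subseteq> p"
  proof (rule ccontr)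
    assume "\<not> q \<subseteq> p"
    then obtain w where w: "w \<in> q" "w \<notin> p" "w \<in> carrier R" using qc by blast
    then have "w = w \<otimes> x [^] (0::nat)" by simp
    then have "w \<in> ?T" using w by blast
    then show False using q(2) w by blast
  qed
  then have "q = p" using assms(1) q(1) by (simp add: minimal_prime_def)
  moreover have "x = \<one> \<otimes> x [^] (1::nat)" using x by simp
  then have "x \<in> ?T" using one by blast
  ultimately show False using q(2) assms(2) by blast
qed

section \<open>Graded rings\<close>

text \<open>The grading is given by the projections \<open>c d\<close> onto the homogeneous pieces \<open>G d\<close>.\<close>

locale graded_cring = cring R for R (structure) +
  fixes G :: "nat \<Rightarrow> 'a set" and c :: "nat \<Rightarrow> 'a \<Rightarrow> 'a"
  assumes G_carrier: "G d \<subseteq> carrier R"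
    and c_G: "x \<in> carrier R \<Longrightarrow> c d x \<in> G d"
    and c_add: "x \<in> carrier R \<Longrightarrow> y \<in> carrier R \<Longrightarrow> c d (x \<oplus> y) = c d x \<oplus> c d y"
    and c_homogeneous: "x \<in> G d \<Longrightarrow> c e x = (if e = d then x else \<zero>)"
    and c_bound: "x \<in> carrier R \<Longrightarrow> \<exists>n. \<forall>d\<ge>n. c d x = \<zero>"
    and c_eq_zero: "x \<in> carrier R \<Longrightarrow> (\<And>d. c d x = \<zero>) \<Longrightarrow> x = \<zero>"
    and mult_G: "x \<in> G d \<Longrightarrow> y \<in> G e \<Longrightarrow> x \<otimes> y \<in> G (d + e)"
    and one_G: "\<one> \<in> G 0"
begin

lemma G_closed [simp]: "x \<in> G d \<Longrightarrow> x \<in> carrier R"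
  using G_carrier by auto

lemma c_closed [simp]: "x \<in> carrier R \<Longrightarrow> c d x \<in> carrier R"
  using c_G G_carrier by blast

lemma c_zero [simp]: "c d \<zero> = \<zero>"
proof -
  have "c d \<zero> \<oplus> c d \<zero> = c d \<zero>" using c_add[of \<zero> \<zero> d] by simp
  then show ?thesis using c_closed[of \<zero> d] by (simp add: add.l_cancel_one')
qed

lemma zero_G [simp]: "\<zero> \<in> G d"
  using c_G[of \<zero> d] by simp

lemma add_G: "x \<in> G d \<Longrightarrow> y \<in> G d \<Longrightarrow> x \<oplus> y \<in> G d"
  using c_add[of x y d] c_G[of "x \<oplus> y" d] by (simp add: c_homogeneous)

lemma c_uminus: "x \<in> carrier R \<Longrightarrow> c d (\<ominus> x) = \<ominus> c d x"
  using c_add[of "\<ominus> x" x d] by (simp add: l_neg minus_equality)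

lemma c_minus: "x \<in> carrier R \<Longrightarrow> y \<in> carrier R \<Longrightarrow> c d (x \<ominus> y) = c d x \<ominus> c d y"
  by (simp add: minus_eq c_add c_uminus)

lemma pow_G: "x \<in> G d \<Longrightarrow> x [^] (k::nat) \<in> G (k * d)"
proof (induction k)
  case 0
  then show ?case using one_G by simp
next
  case (Suc k)
  then show ?case using mult_G[OF Suc.IH[OF Suc.prems] Suc.prems] by (simp add: add.commute)
qed

text \<open>The bound is strict, so \<open>below 0\<close> leaves only zero and induction on the
  bound removes one top component at a time.\<close>

definition below :: "nat \<Rightarrow> 'a \<Rightarrow> bool"
  where "below n x \<longleftrightarrow> x \<in> carrier R \<and> (\<forall>d\<ge>n. c d x = \<zero>)"

lemma ex_below: "x \<in> carrier R \<Longrightarrow> \<exists>n. below n x"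
  using c_bound by (auto simp: below_def)

lemma below_carrier: "below n x \<Longrightarrow> x \<in> carrier R"
  by (simp add: below_def)

lemma below_0: "below 0 x \<Longrightarrow> x = \<zero>"
  using c_eq_zero by (auto simp: below_def)

lemma below_Suc: "below (Suc n) x \<Longrightarrow> below n (x \<ominus> c n x)"
  unfolding below_def
proof (elim conjE, intro conjI allI impI)
  fix d assume x: "x \<in> carrier R" "\<forall>d\<ge>Suc n. c d x = \<zero>" and d: "n \<le> d"
  have "c d (x \<ominus> c n x) = c d x \<ominus> (if d = n then c n x else \<zero>)"
    using x(1) c_homogeneous[OF c_G[OF x(1)], of d n] by (simp add: c_minus)
  then show "c d (x \<ominus> c n x) = \<zero>"
    using x d by (cases "d = n") (auto simp: minus_eq r_neg)
qed simp

lemma split_top: "x \<in> carrier R \<Longrightarrow> x = (x \<ominus> c n x) \<oplus> c n x"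
  by (simp add: minus_eq a_assoc l_neg)

text \<open>Stripping top components writes an element as a finite sum of homogeneous ones; the rule
  hides that sum.\<close>

lemma graded_induct [consumes 1, case_names zero homogeneous add]:
  assumes "x \<in> carrier R" "P \<zero>" "\<And>d x. x \<in> G d \<Longrightarrow> P x"
    and add: "\<And>x y. x \<in> carrier R \<Longrightarrow> y \<in> carrier R \<Longrightarrow> P x \<Longrightarrow> P y \<Longrightarrow> P (x \<oplus> y)"
  shows "P x"
proof -
  obtain n where "below n x" using ex_below assms(1) by blast
  then show ?thesis
  proof (induction n arbitrary: x)
    case 0
    then show ?case using below_0 assms(2) by blast
  next
    case (Suc n)
    have x: "x \<in> carrier R" using Suc.prems by (rule below_carrier)
    have "P (x \<ominus> c n x)" using Suc below_Suc by blast
    moreover have "P (c n x)" using assms(3) c_G x by blast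
    ultimately have "P ((x \<ominus> c n x) \<oplus> c n x)" using add x by simp
    then show ?case using split_top[OF x, of n] by metis
  qed
qed

lemma c_mult_homogeneous:
  assumes "y \<in> G e" "x \<in> carrier R"
  shows "c k (y \<otimes> x) = (if e \<le> k then y \<otimes> c (k - e) x else \<zero>)"
  using assms(2)
proof (induction x rule: graded_induct)
  case zero
  then show ?case using assms(1) by simp
next
  case (homogeneous d x)
  then show ?case using assms(1) mult_G[OF assms(1) homogeneous]
    by (auto simp: c_homogeneous)
next
  case (add x z)
  then show ?case using assms(1) by (simp add: r_distr c_add)
qed

text \<open>The asymmetric bounds mean degrees less than \<open>n\<close> and at most
  \<open>m\<close>, so products have degree less than \<open>n + m\<close>. In this shape it bounds
  what remains of a product once the top component of one factor is removed.\<close>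

lemma below_mult:
  "below n x \<Longrightarrow> below (Suc m) y \<Longrightarrow> below (n + m) (x \<otimes> y)"
proof (induction n arbitrary: x)
  case 0
  then have "x = \<zero>" "y \<in> carrier R" using below_0 below_carrier by blast+
  then show ?case by (simp add: below_def)
next
  case (Suc n)
  have x: "x \<in> carrier R" "y \<in> carrier R" using Suc.prems below_carrier by blast+
  have *: "below (n + m) ((x \<ominus> c n x) \<otimes> y)" using Suc below_Suc by blast
  have eq: "x \<otimes> y = (x \<ominus> c n x) \<otimes> y \<oplus> c n x \<otimes> y"
    using x split_top[OF x(1), of n] l_distr[of "x \<ominus> c n x" "c n x" y] by simp
  have "c k (x \<otimes> y) = \<zero>" if "k \<ge> Suc n + m" for k
  proof -
    have "c k ((x \<ominus> c n x) \<otimes> y) = \<zero>" using * that by (simp add: below_def)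
    moreover have "c k (c n x \<otimes> y) = \<zero>"
      using c_mult_homogeneous[OF c_G[OF x(1)] x(2), of k n] that Suc.prems x
      by (auto simp: below_def)
    ultimately show ?thesis unfolding eq using x by (subst c_add) auto
  qed
  then show ?case using x by (simp add: below_def)
qed

lemma c_mult_top:
  assumes "below (Suc n) x" "below (Suc m) y"
  shows "c (n + m) (x \<otimes> y) = c n x \<otimes> c m y"
proof -
  have x: "x \<in> carrier R" "y \<in> carrier R" using assms below_carrier by blast+
  have eq: "x \<otimes> y = (x \<ominus> c n x) \<otimes> y \<oplus> c n x \<otimes> y"
    using x split_top[OF x(1), of n] l_distr[of "x \<ominus> c n x" "c n x" y] by simp
  have "c (n + m) ((x \<ominus> c n x) \<otimes> y) = \<zero>"
    using below_mult[OF below_Suc[OF assms(1)] assms(2)] by (simp add: below_def)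
  then show ?thesis
    unfolding eq using x c_mult_homogeneous[OF c_G[OF x(1)] x(2), of "n + m" n]
    by (subst c_add) auto
qed

lemma ideal_components:
  assumes "ideal J R" "x \<in> carrier R" "\<And>d. c d x \<in> J"
  shows "x \<in> J"
proof -
  interpret ideal J R by fact
  obtain n where "below n x" using ex_below assms by blast
  then show ?thesis using assms(2,3)
  proof (induction n arbitrary: x)
    case 0
    then show ?case using below_0 zero_closed by blast
  next
    case (Suc n)
    have "c d (x \<ominus> c n x) \<in> J" for d
      using Suc.prems by (simp add: c_minus c_homogeneous[OF c_G] ideal_minus[OF assms(1)])
    then have "x \<ominus> c n x \<in> J" using Suc below_Suc by simp
    then have "(x \<ominus> c n x) \<oplus> c n x \<in> J" using Suc.prems(3) by simp
    then show ?case using split_top[OF Suc.prems(2), of n] by metis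
  qed
qed

text \<open>Closure under components is the form used in arguments with elements;
  \<open>homogeneous_ideal_iff\<close> links it to generation by homogeneous elements, as required
  of the points of \<open>Proj\<close>.\<close>

definition hom_ideal :: "'a set \<Rightarrow> bool"
  where "hom_ideal J \<longleftrightarrow> ideal J R \<and> (\<forall>x\<in>J. \<forall>d. c d x \<in> J)"

lemma ideal_componentwise:
  assumes "ideal J R"
  shows "ideal {x \<in> carrier R. \<forall>d. c d x \<in> J} R"
  unfolding ideal_iff
proof (intro conjI ballI)
  interpret ideal J R by fact
  let ?J = "{x \<in> carrier R. \<forall>d. c d x \<in> J}"
  show "?J \<subseteq> carrier R" by auto
  show "\<zero> \<in> ?J" by simp
  show add: "x \<oplus> y \<in> ?J" if "x \<in> ?J" "y \<in> ?J" for x y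
    using that by (simp add: c_add)
  fix r x assume "r \<in> carrier R" and x: "x \<in> ?J"
  then show "r \<otimes> x \<in> ?J"
  proof (induction r rule: graded_induct)
    case zero
    then show ?case by simp
  next
    case (homogeneous e r)
    then show ?case using I_l_closed by (simp add: c_mult_homogeneous)
  next
    case (add r s)
    then show ?case using \<open>\<And>x y. x \<in> ?J \<Longrightarrow> y \<in> ?J \<Longrightarrow> x \<oplus> y \<in> ?J\<close>[of "r \<otimes> x" "s \<otimes> x"]
      by (simp add: l_distr)
  qed
qed

text \<open>The elements all of whose components lie in \<open>J\<close> form an ideal containing
  the homogeneous elements of \<open>J\<close>, hence everything these generate. Conversely an
  element is recovered from its components.\<close>

lemma homogeneous_ideal_iff: "homogeneous_ideal R G J \<longleftrightarrow> hom_ideal J"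
proof
  assume *: "homogeneous_ideal R G J"
  then have J: "ideal J R" "J = Idl (J \<inter> (\<Union>d. G d))"
    by (auto simp: homogeneous_ideal_def)
  interpret ideal J R by fact
  have "Idl (J \<inter> (\<Union>d. G d)) \<subseteq> {x \<in> carrier R. \<forall>d. c d x \<in> J}"
    by (rule genideal_minimal[OF ideal_componentwise[OF J(1)]]) (auto simp: c_homogeneous)
  then show "hom_ideal J" using J by (auto simp: hom_ideal_def)
next
  assume J: "hom_ideal J"
  then interpret ideal J R by (simp add: hom_ideal_def)
  have sub: "J \<inter> (\<Union>d. G d) \<subseteq> carrier R" by auto
  have "J \<subseteq> Idl (J \<inter> (\<Union>d. G d))"
  proof
    fix x assume x: "x \<in> J"
    show "x \<in> Idl (J \<inter> (\<Union>d. G d))"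
    proof (rule ideal_components[OF genideal_ideal[OF sub]])
      show "x \<in> carrier R" using x by simp
      show "c d x \<in> Idl (J \<inter> (\<Union>d. G d))" for d
        using x J c_G[of x d] genideal_self[OF sub] by (auto simp: hom_ideal_def)
    qed
  qed
  moreover have "Idl (J \<inter> (\<Union>d. G d)) \<subseteq> J"
    by (rule genideal_minimal[OF is_ideal]) auto
  ultimately show "homogeneous_ideal R G J"
    using is_ideal by (auto simp: homogeneous_ideal_def)
qed

text \<open>The top components of the two factors multiply to a component of the product, hence to
  an element of \<open>J\<close>. The one that lies in \<open>J\<close> can be subtracted from its
  factor, which lowers the sum of the degree bounds.\<close>

lemma primeideal_homogeneousI:
  assumes J: "hom_ideal J" and "\<one> \<notin> J"
    and hom: "\<And>d e a b. a \<in> G d \<Longrightarrow> b \<in> G e \<Longrightarrow> a \<otimes> b \<in> J \<Longrightarrow> a \<in> J \<or> b \<in> J"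
  shows "primeideal J R"
  unfolding primeideal_iff
proof (intro conjI ballI impI)
  show id: "ideal J R" using J by (simp add: hom_ideal_def)
  show "\<one> \<notin> J" by fact
  interpret ideal J R by fact
  have *: "x \<in> J \<or> y \<in> J" if "below n x" "below m y" "x \<otimes> y \<in> J" "n + m = k" for n m x y k
    using that
  proof (induction k arbitrary: n m x y rule: less_induct)
    case (less k)
    have x: "x \<in> carrier R" "y \<in> carrier R" using less.prems below_carrier by blast+
    show ?case
    proof (cases "n = 0 \<or> m = 0")
      case True
      then show ?thesis using less.prems below_0 zero_closed by metis
    next
      case False
      then obtain n' m' where nm: "n = Suc n'" "m = Suc m'" using not0_implies_Suc by blast
      have "c (n' + m') (x \<otimes> y) = c n' x \<otimes> c m' y"
        using c_mult_top less.prems nm by blast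
      then have "c n' x \<in> J \<or> c m' y \<in> J"
        using hom[OF c_G[OF x(1)] c_G[OF x(2)]] J less.prems(3) by (metis hom_ideal_def)
      then show ?thesis
      proof
        assume t: "c n' x \<in> J"
        have "(x \<ominus> c n' x) \<otimes> y = x \<otimes> y \<ominus> c n' x \<otimes> y"
          using x by (simp add: minus_eq l_distr l_minus)
        then have "(x \<ominus> c n' x) \<otimes> y \<in> J"
          using less.prems(3) t x I_r_closed ideal_minus[OF id] by simp
        then have "x \<ominus> c n' x \<in> J \<or> y \<in> J"
          using less.IH[of "n' + m" n' "x \<ominus> c n' x" m y] less.prems nm below_Suc by simp
        then show ?thesis using split_top[OF x(1), of n'] t a_closed by metis
      next
        assume t: "c m' y \<in> J"
        have "x \<otimes> (y \<ominus> c m' y) = x \<otimes> y \<ominus> x \<otimes> c m' y"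
          using x by (simp add: minus_eq r_distr r_minus)
        then have "x \<otimes> (y \<ominus> c m' y) \<in> J"
          using less.prems(3) t x I_l_closed ideal_minus[OF id] by simp
        then have "x \<in> J \<or> y \<ominus> c m' y \<in> J"
          using less.IH[of "n + m'" n x m' "y \<ominus> c m' y"] less.prems nm below_Suc by simp
        then show ?thesis using split_top[OF x(2), of m'] t a_closed by metis
      qed
    qed
  qed
  fix a b assume "a \<in> carrier R" "b \<in> carrier R" "a \<otimes> b \<in> J"
  then show "a \<in> J \<or> b \<in> J" using * ex_below by metis
qed

text \<open>The largest homogeneous ideal inside an ideal \<open>p\<close>, often written p^* in the
  literature.\<close>

definition hom_part :: "'a set \<Rightarrow> 'a set"
  where "hom_part p = {x \<in> carrier R. \<forall>d. c d x \<in> p}"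

lemma hom_part_subset: "ideal p R \<Longrightarrow> hom_part p \<subseteq> p"
  using ideal_components by (auto simp: hom_part_def)

lemma hom_part_hom_ideal:
  assumes "ideal p R"
  shows "hom_ideal (hom_part p)"
proof -
  interpret ideal p R by fact
  show ?thesis
    using ideal_componentwise[OF assms]
    by (auto simp: hom_ideal_def hom_part_def c_homogeneous[OF c_G])
qed

text \<open>On homogeneous elements \<open>p\<close> and \<open>hom_part p\<close> agree, and
  primality of a homogeneous ideal need only be tested there.\<close>

lemma primeideal_hom_part:
  assumes "primeideal p R"
  shows "primeideal (hom_part p) R"
proof -
  interpret p: primeideal p R by fact
  have mem: "x \<in> hom_part p \<longleftrightarrow> x \<in> p" if "x \<in> G d" for x d
    using that by (auto simp: hom_part_def c_homogeneous)
  show ?thesis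
  proof (rule primeideal_homogeneousI[OF hom_part_hom_ideal[OF p.is_ideal]])
    show "\<one> \<notin> hom_part p" using assms primeideal_iff[of p] mem[OF one_G] by simp
    show "a \<in> hom_part p \<or> b \<in> hom_part p" if "a \<in> G d" "b \<in> G e" "a \<otimes> b \<in> hom_part p" for a b d e
      using that mem[OF that(1)] mem[OF that(2)] mem[OF mult_G[OF that(1,2)]] p.I_prime by simp
  qed
qed

lemma minimal_prime_hom_ideal:
  assumes "minimal_prime R p"
  shows "hom_ideal p"
proof -
  have p: "primeideal p R" using assms by (simp add: minimal_prime_def)
  then have id: "ideal p R" by (simp add: primeideal_iff)
  have "hom_part p = p"
    using assms primeideal_hom_part[OF p] hom_part_subset[OF id] by (simp add: minimal_prime_def)
  then show ?thesis using hom_part_hom_ideal[OF id] by simp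
qed

lemma irrelevant_ideal_subset_iff:
  assumes "ideal p R"
  shows "irrelevant_ideal R G \<subseteq> p \<longleftrightarrow> (\<forall>d\<ge>1. G d \<subseteq> p)"
proof
  have sub: "(\<Union>d\<in>{1..}. G d) \<subseteq> carrier R" by auto
  show "\<forall>d\<ge>1. G d \<subseteq> p" if "irrelevant_ideal R G \<subseteq> p"
    using that genideal_self[OF sub] by (fastforce simp: irrelevant_ideal_def)
  show "irrelevant_ideal R G \<subseteq> p" if "\<forall>d\<ge>1. G d \<subseteq> p"
    unfolding irrelevant_ideal_def by (rule genideal_minimal[OF assms]) (use that in auto)
qed

lemma proj_points_iff:
  "p \<in> proj_points R G \<longleftrightarrow> primeideal p R \<and> hom_ideal p \<and> \<not> (\<forall>d\<ge>1. G d \<subseteq> p)"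
proof -
  have "ideal p R" if "primeideal p R" using that by (simp add: primeideal_iff)
  then show ?thesis
    unfolding proj_points_def homogeneous_ideal_iff using irrelevant_ideal_subset_iff by blast
qed

text \<open>Provides, for the points of \<open>Proj\<close>, the condition \<open>Inter\<close> in
  the description of irreducible components.\<close>

lemma Inter_proj_points:
  assumes "V \<subseteq> proj_points R G" "V \<noteq> {}" "primeideal (\<Inter>V) R"
  shows "\<Inter>V \<in> proj_points R G"
proof -
  have "hom_ideal (\<Inter>V)"
    using assms(1,3) by (auto simp: hom_ideal_def proj_points_iff primeideal_iff subset_iff)
  moreover have "\<not> (\<forall>d\<ge>1. G d \<subseteq> \<Inter>V)"
  proof -
    obtain q where q: "q \<in> V" using assms(2) by blast
    then obtain d where d: "d \<ge> 1" "\<not> G d \<subseteq> q" using assms(1) proj_points_iff by blast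
    have "\<Inter>V \<subseteq> q" using q by auto
    then show ?thesis using d by blast
  qed
  ultimately show ?thesis using assms(3) proj_points_iff by blast
qed

end

section \<open>Lengthening chains\<close>

text \<open>Read contrapositively, this and the next two lemmas describe a chain of greatest
  possible length: no member of \<open>P\<close> fits strictly between neighbours, below the start
  or above the end.\<close>

lemma has_chain_insert:
  assumes "\<forall>i\<le>n. C i \<in> P" "\<forall>i<n. C i \<subset> C (Suc i)" "i < n" "K \<in> P" "C i \<subset> K" "K \<subset> C (Suc i)"
  shows "has_chain P (Suc n)"
proof -
  define J where "J k = (if k \<le> i then C k else if k = Suc i then K else C (k - 1))" for k
  have "J k \<in> P" if "k \<le> Suc n" for k
    using assms that by (auto simp: J_def)
  moreover have "J k \<subset> J (Suc k)" if "k < Suc n" for k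
  proof -
    consider "k < i" | "k = i" | "k = Suc i" | m where "k = Suc m" "i < m"
      by (metis less_SucE linorder_neqE_nat Suc_lessI lessE)
    then show ?thesis
      using assms that by cases (auto simp: J_def)
  qed
  ultimately show ?thesis unfolding has_chain_def by (intro exI[of _ J]) simp
qed

lemma has_chain_prepend:
  assumes "\<forall>i\<le>n. C i \<in> P" "\<forall>i<n. C i \<subset> C (Suc i)" "K \<in> P" "K \<subset> C 0"
  shows "has_chain P (Suc n)"
proof -
  have "case_nat K C k \<in> P" if "k \<le> Suc n" for k
    using assms that by (cases k) auto
  moreover have "case_nat K C k \<subset> case_nat K C (Suc k)" if "k < Suc n" for k
    using assms that by (cases k) auto
  ultimately show ?thesis unfolding has_chain_def by (intro exI[of _ "case_nat K C"]) blast
qed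

lemma has_chain_append:
  assumes "\<forall>i\<le>n. C i \<in> P" "\<forall>i<n. C i \<subset> C (Suc i)" "K \<in> P" "C n \<subset> K"
  shows "has_chain P (Suc n)"
proof -
  have "(if k \<le> n then C k else K) \<in> P" if "k \<le> Suc n" for k
    using assms that by auto
  moreover have "(if k \<le> n then C k else K) \<subset> (if Suc k \<le> n then C (Suc k) else K)"
    if "k < Suc n" for k
    using assms that by (cases "k = n") auto
  ultimately show ?thesis
    unfolding has_chain_def by (intro exI[of _ "\<lambda>k. if k \<le> n then C k else K"]) simp
qed

text \<open>Two extremal choices are made with it: the length of a longest chain, and the order of
  vanishing shared by all elements of \<open>I\<close>.\<close>

lemma ex_last_before:
  assumes "P 0" "\<not> P (n::nat)"
  shows "\<exists>l<n. P l \<and> \<not> P (Suc l)"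
proof (rule ccontr)
  assume *: "\<not> ?thesis"
  have "P l" if "l \<le> n" for l
    using that by (induction l) (use * assms(1) in auto)
  then show False using assms(2) by blast
qed

lemma saturatedD:
  "saturated R T J \<Longrightarrow> x \<in> carrier R \<Longrightarrow> u \<in> T \<Longrightarrow> u \<otimes>\<^bsub>R\<^esub> x \<in> J \<Longrightarrow> x \<in> J"
  by (auto simp: saturated_def)

lemma (in cring) mult_subset_compl_prime:
  assumes "primeideal p R"
  shows "mult_subset R (carrier R - p)"
proof -
  interpret primeideal p R by fact
  show ?thesis
    using assms primeideal_iff[of p] by unfold_locales (auto dest: I_prime)
qed

section \<open>Saturation at a minimal prime of a graded ring\<close>

context graded_cring
begin

abbreviation hom_compl :: "'a set \<Rightarrow> 'a set"
  where "hom_compl p \<equiv> (\<Union>d. G d) - p"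

lemma mult_subset_hom_compl:
  assumes "primeideal p R"
  shows "mult_subset R (hom_compl p)"
proof -
  interpret primeideal p R by fact
  show ?thesis
  proof unfold_locales
    show "hom_compl p \<subseteq> carrier R" by auto
    show "\<one> \<in> hom_compl p" using assms primeideal_iff[of p] one_G by auto
    fix s t assume "s \<in> hom_compl p" "t \<in> hom_compl p"
    then obtain d e where *: "s \<in> G d" "t \<in> G e" "s \<notin> p" "t \<notin> p" by blast
    then have "s \<otimes> t \<notin> p" using I_prime[of s t] by auto
    then show "s \<otimes> t \<in> hom_compl p" using mult_G[OF *(1,2)] by blast
  qed
qed

text \<open>As x^k is homogeneous, an equation w x^k = 0 holds for each component of
  \<open>w\<close> separately, and some component of \<open>w\<close> lies outside
  \<open>p\<close>.\<close>

lemma minimal_prime_homogeneous_nilpotent: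
  assumes p: "minimal_prime R p" and x: "x \<in> p" "x \<in> G n"
  obtains w and k :: nat where "w \<in> hom_compl p" "w \<otimes> x [^] k = \<zero>"
proof -
  have id: "ideal p R" using p by (simp add: minimal_prime_def primeideal_iff)
  obtain w and k :: nat where w: "w \<in> carrier R" "w \<notin> p" "w \<otimes> x [^] k = \<zero>"
    using minimal_prime_nilpotent[OF p x(1)] by blast
  then obtain d where d: "c d w \<notin> p" using ideal_components[OF id] by blast
  have xk: "x [^] k \<in> G (k * n)" using x(2) by (rule pow_G)
  have "x [^] k \<otimes> w = \<zero>" using w x(2) by (simp add: m_comm)
  then have "x [^] k \<otimes> c d w = \<zero>"
    using c_mult_homogeneous[OF xk w(1), of "k * n + d"] by simp
  then have "c d w \<otimes> x [^] k = \<zero>" using w x(2) by (simp add: m_comm)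
  moreover have "c d w \<in> hom_compl p" using d c_G[OF w(1)] by blast
  ultimately show ?thesis using that by blast
qed

text \<open>A non-homogeneous \<open>u\<close> outside \<open>p\<close> is stripped of its top component when that lies
  in \<open>p\<close>, because it is nilpotent up to a homogeneous factor outside \<open>p\<close>; otherwise the
  top components of \<open>u\<close> and \<open>s\<close> multiply.\<close>

lemma saturated_minimal_prime:
  assumes p: "minimal_prime R p" and J: "hom_ideal J" "saturated R (hom_compl p) J"
  shows "saturated R (carrier R - p) J"
proof -
  have pp: "primeideal p R" using p by (simp add: minimal_prime_def)
  interpret p: primeideal p R by fact
  have idJ: "ideal J R" using J(1) by (simp add: hom_ideal_def)
  interpret J: ideal J R by fact
  \<comment> \<open>The induction on the degree bound of \<open>u\<close> keeps \<open>s\<close>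
    arbitrary, because the case of a top component in \<open>p\<close> applies it to multiples of
    \<open>s\<close>.\<close>
  have "s \<in> J" if "below n u" "u \<notin> p" "s \<in> carrier R" "u \<otimes> s \<in> J" for n u s
    using that
  proof (induction n arbitrary: u s)
    case 0
    then have "u = \<zero>" using below_0 by blast
    then show ?case using 0 p.zero_closed by simp
  next
    case (Suc n)
    have u: "u \<in> carrier R" using Suc.prems(1) by (rule below_carrier)
    show ?case
    proof (cases "c n u \<in> p")
      case False
      then have top: "c n u \<in> hom_compl p" using c_G[OF u] by blast
      \<comment> \<open>With the top component of \<open>u\<close> outside \<open>p\<close>,
        homogeneous saturation puts the top component of \<open>s\<close> into \<open>J\<close>, and
        it can be subtracted.\<close>
      have "s \<in> J" if "below m s" "u \<otimes> s \<in> J" for m s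
        using that
      proof (induction m arbitrary: s)
        case 0
        then have "s = \<zero>" using below_0 by blast
        then show ?case by simp
      next
        case (Suc m)
        have s: "s \<in> carrier R" using Suc.prems(1) by (rule below_carrier)
        have "c (n + m) (u \<otimes> s) = c n u \<otimes> c m s"
          using c_mult_top \<open>below (Suc n) u\<close> Suc.prems(1) by blast
        then have "c n u \<otimes> c m s \<in> J" using J(1) Suc.prems(2) by (metis hom_ideal_def)
        then have cm: "c m s \<in> J" using saturatedD[OF J(2) _ top] s by simp
        have "u \<otimes> (s \<ominus> c m s) = u \<otimes> s \<ominus> u \<otimes> c m s"
          using u s by (simp add: minus_eq r_distr r_minus)
        also have "\<dots> \<in> J"
          using Suc.prems(2) cm u J.I_l_closed ideal_minus[OF idJ] by simp
        finally have "s \<ominus> c m s \<in> J" using Suc.IH below_Suc[OF Suc.prems(1)] by blast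
        then have "(s \<ominus> c m s) \<oplus> c m s \<in> J" using cm by simp
        then show ?case using split_top[OF s, of m] by metis
      qed
      then show ?thesis using ex_below[OF Suc.prems(3)] Suc.prems(4) by blast
    next
      case True
      let ?x = "c n u"
      have x: "?x \<in> carrier R" using u by simp
      have s: "s \<in> carrier R" by fact
      have v: "u \<ominus> ?x \<notin> p"
      proof
        assume "u \<ominus> ?x \<in> p"
        then have "(u \<ominus> ?x) \<oplus> ?x \<in> p" using True by simp
        then show False using split_top[OF u, of n] Suc.prems(2) by metis
      qed
      obtain w and k :: nat where w: "w \<in> hom_compl p" "w \<otimes> ?x [^] k = \<zero>"
        using minimal_prime_homogeneous_nilpotent[OF p True c_G[OF u]] by blast
      have wc: "w \<in> carrier R" using w by auto
      have "w \<otimes> (?x [^] k \<otimes> s) = \<zero>"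
        using w(2) wc x s by (simp add: m_assoc[symmetric])
      then have start: "?x [^] k \<otimes> s \<in> J" using saturatedD[OF J(2) _ w(1)] x s by simp
      \<comment> \<open>Descent on the power, with x the top component of \<open>u\<close>: (u - x)
        x^j s = x^j (u s) - x^(j+1) s lies in \<open>J\<close>. Since u - x is outside
        \<open>p\<close> and has a smaller degree bound, the outer hypothesis yields x^j s in
        \<open>J\<close>.\<close>
      have "s \<in> J" if "?x [^] (j::nat) \<otimes> s \<in> J" for j
        using that
      proof (induction j)
        case 0
        then show ?case using s by simp
      next
        case (Suc j)
        let ?y = "?x [^] j \<otimes> s"
        have y: "?y \<in> carrier R" using x s by simp
        have "(u \<ominus> ?x) \<otimes> ?y = u \<otimes> ?y \<ominus> ?x \<otimes> ?y"
          using u x y by (simp add: minus_eq l_distr l_minus del: m_closed)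
        moreover have "u \<otimes> ?y = ?x [^] j \<otimes> (u \<otimes> s)" "?x \<otimes> ?y = ?x [^] Suc j \<otimes> s"
          using u x s by (simp_all add: m_ac)
        ultimately have "(u \<ominus> ?x) \<otimes> ?y = ?x [^] j \<otimes> (u \<otimes> s) \<ominus> ?x [^] Suc j \<otimes> s"
          by simp
        then have "(u \<ominus> ?x) \<otimes> ?y \<in> J"
          using ideal_minus[OF idJ J.I_l_closed[OF \<open>u \<otimes> s \<in> J\<close>] Suc.prems] x by simp
        then have "?y \<in> J"
          using \<open>\<And>u s. below n u \<Longrightarrow> u \<notin> p \<Longrightarrow> s \<in> carrier R \<Longrightarrow> u \<otimes> s \<in> J \<Longrightarrow> s \<in> J\<close>
            below_Suc[OF \<open>below (Suc n) u\<close>] v y by blast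
        then show ?case by (rule Suc.IH)
      qed
      then show ?thesis using start by blast
    qed
  qed
  then show ?thesis unfolding saturated_def using ex_below by blast
qed

section \<open>Saturated homogeneous ideals and the comparison of lengths\<close>

definition sat_hom_ideals :: "'a set \<Rightarrow> 'a set set"
  where "sat_hom_ideals p = {J. hom_ideal J \<and> saturated R (hom_compl p) J}"

lemma sat_hom_idealsD:
  "J \<in> sat_hom_ideals p \<Longrightarrow> ideal J R"
  "J \<in> sat_hom_ideals p \<Longrightarrow> x \<in> J \<Longrightarrow> c d x \<in> J"
  "J \<in> sat_hom_ideals p \<Longrightarrow> x \<in> carrier R \<Longrightarrow> u \<in> hom_compl p \<Longrightarrow> u \<otimes> x \<in> J \<Longrightarrow> x \<in> J"
  unfolding sat_hom_ideals_def hom_ideal_def saturated_def by blast+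

lemma sat_hom_idealsI:
  assumes "J \<subseteq> carrier R" "\<zero> \<in> J" "\<And>x y. x \<in> J \<Longrightarrow> y \<in> J \<Longrightarrow> x \<oplus> y \<in> J"
    "\<And>r x. r \<in> carrier R \<Longrightarrow> x \<in> J \<Longrightarrow> r \<otimes> x \<in> J"
    "\<And>x d. x \<in> J \<Longrightarrow> c d x \<in> J"
    "\<And>x u. x \<in> carrier R \<Longrightarrow> u \<in> hom_compl p \<Longrightarrow> u \<otimes> x \<in> J \<Longrightarrow> x \<in> J"
  shows "J \<in> sat_hom_ideals p"
  unfolding sat_hom_ideals_def hom_ideal_def saturated_def ideal_iff
  by (intro CollectI conjI ballI allI impI; (rule assms; assumption))

text \<open>This is the kernel of the map into the localization at the homogeneous elements outside
  \<open>p\<close>. It lies in every saturated homogeneous ideal, so a longest chain must begin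
  here.\<close>

lemma kernel_sat_hom_ideals:
  assumes p: "primeideal p R"
  shows "{x \<in> carrier R. \<exists>u\<in>hom_compl p. u \<otimes> x = \<zero>} \<in> sat_hom_ideals p" (is "?J \<in> _")
proof (rule sat_hom_idealsI)
  interpret T: mult_subset R "hom_compl p" using mult_subset_hom_compl[OF p] .
  have Tc: "u \<in> carrier R" if H: "u \<in> hom_compl p" for u using H by auto
  show "?J \<subseteq> carrier R" by auto
  show "\<zero> \<in> ?J" using T.one_T by auto
  show "x \<oplus> y \<in> ?J" if H: "x \<in> ?J" "y \<in> ?J" for x y
  proof -
    obtain u v where uv: "u \<in> hom_compl p" "u \<otimes> x = \<zero>" "v \<in> hom_compl p" "v \<otimes> y = \<zero>"
      using H by blast
    have xy: "x \<in> carrier R" "y \<in> carrier R" using H by auto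
    have "(u \<otimes> v) \<otimes> (x \<oplus> y) = v \<otimes> (u \<otimes> x) \<oplus> u \<otimes> (v \<otimes> y)"
      using xy Tc[OF uv(1)] Tc[OF uv(3)] by (simp add: r_distr m_ac)
    then have "(u \<otimes> v) \<otimes> (x \<oplus> y) = \<zero>" using uv Tc by simp
    then show ?thesis using xy T.mult_T[OF uv(1,3)] by auto
  qed
  show "r \<otimes> x \<in> ?J" if H: "r \<in> carrier R" "x \<in> ?J" for r x
  proof -
    obtain u where u: "u \<in> hom_compl p" "u \<otimes> x = \<zero>" "x \<in> carrier R" using H by blast
    have "u \<otimes> (r \<otimes> x) = r \<otimes> (u \<otimes> x)" using u(3) H(1) Tc[OF u(1)] by (simp add: m_ac)
    then show ?thesis using u H(1) by auto
  qed
  show "c d x \<in> ?J" if H: "x \<in> ?J" for x d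
  proof -
    obtain u e where u: "u \<in> hom_compl p" "u \<in> G e" "u \<otimes> x = \<zero>" "x \<in> carrier R" using H by blast
    have "u \<otimes> c d x = \<zero>"
      using c_mult_homogeneous[OF u(2,4), of "e + d"] u(3) by simp
    then show ?thesis using u by auto
  qed
  show "x \<in> ?J" if H: "x \<in> carrier R" "u \<in> hom_compl p" "u \<otimes> x \<in> ?J" for x u
  proof -
    obtain v where v: "v \<in> hom_compl p" "v \<otimes> (u \<otimes> x) = \<zero>" using H by blast
    then have "(v \<otimes> u) \<otimes> x = \<zero>" using H(1) Tc[OF v(1)] Tc[OF H(2)] by (simp add: m_assoc)
    then show ?thesis using H(1) T.mult_T[OF v(1) H(2)] by blast
  qed
qed

text \<open>The set is the saturation of C + R x, the least saturated homogeneous ideal above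
  \<open>C\<close> that contains \<open>x\<close>. Homogeneity of \<open>x\<close> makes the
  components of r x + z again elements of that form.\<close>

lemma sat_hom_ideals_adjoin:
  assumes p: "primeideal p R" and C: "C \<in> sat_hom_ideals p" and x: "x \<in> G f"
  shows "{y \<in> carrier R. \<exists>u\<in>hom_compl p. \<exists>r\<in>carrier R. \<exists>z\<in>C. u \<otimes> y = r \<otimes> x \<oplus> z} \<in> sat_hom_ideals p"
    (is "?J \<in> _")
proof (rule sat_hom_idealsI)
  interpret T: mult_subset R "hom_compl p" using mult_subset_hom_compl[OF p] .
  interpret C: ideal C R using C by (rule sat_hom_idealsD)
  have Tc: "u \<in> carrier R" if H: "u \<in> hom_compl p" for u using H by auto
  have xc: "x \<in> carrier R" using x by simp
  show "?J \<subseteq> carrier R" by auto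
  have "\<one> \<otimes> \<zero> = \<zero> \<otimes> x \<oplus> \<zero>" using xc by simp
  then show "\<zero> \<in> ?J" using T.one_T C.zero_closed by blast
  show "y \<oplus> y' \<in> ?J" if H: "y \<in> ?J" "y' \<in> ?J" for y y'
  proof -
    obtain u r z v r' z' where *: "u \<in> hom_compl p" "r \<in> carrier R" "z \<in> C" "u \<otimes> y = r \<otimes> x \<oplus> z"
      "v \<in> hom_compl p" "r' \<in> carrier R" "z' \<in> C" "v \<otimes> y' = r' \<otimes> x \<oplus> z'"
      "y \<in> carrier R" "y' \<in> carrier R" using H by blast
    note [simp] = xc Tc[OF *(1)] Tc[OF *(5)]
    have "(u \<otimes> v) \<otimes> (y \<oplus> y') = v \<otimes> (u \<otimes> y) \<oplus> u \<otimes> (v \<otimes> y')"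
      using *(9,10) by (simp add: r_distr m_ac)
    also have "\<dots> = (v \<otimes> r \<oplus> u \<otimes> r') \<otimes> x \<oplus> (v \<otimes> z \<oplus> u \<otimes> z')"
      unfolding *(4,8) using *(2,3,6,7) by (simp add: r_distr l_distr m_ac a_ac)
    finally have eq: "(u \<otimes> v) \<otimes> (y \<oplus> y') = (v \<otimes> r \<oplus> u \<otimes> r') \<otimes> x \<oplus> (v \<otimes> z \<oplus> u \<otimes> z')" .
    have "v \<otimes> z \<oplus> u \<otimes> z' \<in> C" using * by (simp add: C.I_l_closed)
    moreover have "v \<otimes> r \<oplus> u \<otimes> r' \<in> carrier R" "y \<oplus> y' \<in> carrier R" using * by simp_all
    ultimately show ?thesis using eq T.mult_T[OF *(1,5)] by blast
  qed
  show "s \<otimes> y \<in> ?J" if H: "s \<in> carrier R" "y \<in> ?J" for s y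
  proof -
    obtain u r z where *: "u \<in> hom_compl p" "r \<in> carrier R" "z \<in> C" "u \<otimes> y = r \<otimes> x \<oplus> z"
      "y \<in> carrier R" using H by blast
    have "u \<otimes> (s \<otimes> y) = s \<otimes> (u \<otimes> y)" using *(5) H(1) Tc[OF *(1)] by (simp add: m_ac)
    also have "\<dots> = (s \<otimes> r) \<otimes> x \<oplus> s \<otimes> z"
      unfolding *(4) using *(2,3) H(1) xc by (simp add: r_distr m_ac)
    finally have eq: "u \<otimes> (s \<otimes> y) = (s \<otimes> r) \<otimes> x \<oplus> s \<otimes> z" .
    have "s \<otimes> z \<in> C" "s \<otimes> r \<in> carrier R" "s \<otimes> y \<in> carrier R"
      using * H(1) by (simp_all add: C.I_l_closed)
    then show ?thesis using eq *(1) by blast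
  qed
  show "c d y \<in> ?J" if H: "y \<in> ?J" for y d
  proof -
    obtain u e r z where *: "u \<in> hom_compl p" "r \<in> carrier R" "z \<in> C" "u \<otimes> y = r \<otimes> x \<oplus> z"
      "y \<in> carrier R" "u \<in> G e" using H by blast
    have "u \<otimes> c d y = c (e + d) (x \<otimes> r \<oplus> z)"
      using c_mult_homogeneous[OF *(6,5), of "e + d"] *(2,4) xc by (simp add: m_comm)
    also have "\<dots> = c (e + d) (x \<otimes> r) \<oplus> c (e + d) z" using * xc by (simp add: c_add)
    also have "c (e + d) (x \<otimes> r) = (if f \<le> e + d then c (e + d - f) r else \<zero>) \<otimes> x"
      using c_mult_homogeneous[OF x *(2), of "e + d"] *(2) xc by (simp add: m_comm)
    finally have "u \<otimes> c d y = (if f \<le> e + d then c (e + d - f) r else \<zero>) \<otimes> x \<oplus> c (e + d) z" .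
    moreover have "(if f \<le> e + d then c (e + d - f) r else \<zero>) \<in> carrier R" using * by simp
    moreover have "c (e + d) z \<in> C" using sat_hom_idealsD(2)[OF C *(3)] .
    moreover have "c d y \<in> carrier R" using * by simp
    ultimately show ?thesis using *(1) by blast
  qed
  show "y \<in> ?J" if H: "y \<in> carrier R" "u \<in> hom_compl p" "u \<otimes> y \<in> ?J" for y u
  proof -
    obtain v r z where *: "v \<in> hom_compl p" "r \<in> carrier R" "z \<in> C" "v \<otimes> (u \<otimes> y) = r \<otimes> x \<oplus> z"
      using H by blast
    then have "(v \<otimes> u) \<otimes> y = r \<otimes> x \<oplus> z"
      using H(1) Tc[OF H(2)] Tc[OF *(1)] by (simp add: m_assoc)
    then show ?thesis using * H(1) T.mult_T[OF *(1) H(2)] by blast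
  qed
qed

text \<open>Consecutive members \<open>C \<subset> C'\<close> have a quotient of rank one over the residue field at \<open>p\<close>.\<close>

lemma consecutive_rank_one:
  assumes p: "minimal_prime R p" and C: "C \<in> sat_hom_ideals p" "C' \<in> sat_hom_ideals p"
    and strict: "C \<subset> C'" and consec: "\<And>K. K \<in> sat_hom_ideals p \<Longrightarrow> C \<subset> K \<Longrightarrow> K \<subset> C' \<Longrightarrow> False"
    and ab: "a \<in> C'" "b \<in> C'" "b \<notin> C"
  obtains u s where "u \<in> carrier R" "u \<notin> p" "s \<in> carrier R" "u \<otimes> a \<ominus> s \<otimes> b \<in> C"
proof -
  have pp: "primeideal p R" using p by (simp add: minimal_prime_def)
  interpret p: primeideal p R by fact
  interpret T: mult_subset R "hom_compl p" using mult_subset_hom_compl[OF pp] .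
  have idC: "ideal C R" "ideal C' R" using C sat_hom_idealsD(1) by blast+
  interpret C: ideal C R by fact
  interpret C': ideal C' R by fact
  have "saturated R (carrier R - p) C"
    using saturated_minimal_prime[OF p] C(1) unfolding sat_hom_ideals_def by blast
  note satC = saturatedD[OF this]
  \<comment> \<open>A homogeneous \<open>x\<close> in \<open>C'\<close> outside \<open>C\<close>
    generates \<open>C'\<close> over \<open>C\<close> up to saturation: the adjoined ideal is
    strictly above \<open>C\<close> and inside \<open>C'\<close>, so \<open>consec\<close> makes it
    equal to \<open>C'\<close>.\<close>
  have gen: "\<exists>u\<in>hom_compl p. \<exists>r\<in>carrier R. \<exists>z\<in>C. u \<otimes> y = r \<otimes> x \<oplus> z"
    if x: "x \<in> G f" "x \<in> C'" "x \<notin> C" and y: "y \<in> C'" for x f y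
  proof -
    let ?K = "{y \<in> carrier R. \<exists>u\<in>hom_compl p. \<exists>r\<in>carrier R. \<exists>z\<in>C. u \<otimes> y = r \<otimes> x \<oplus> z}"
    have K: "?K \<in> sat_hom_ideals p" by (rule sat_hom_ideals_adjoin[OF pp C(1) x(1)])
    have xc: "x \<in> carrier R" using x(1) by simp
    have "C \<subseteq> ?K"
    proof
      fix z assume z: "z \<in> C"
      have "\<one> \<otimes> z = \<zero> \<otimes> x \<oplus> z" using z xc by simp
      then show "z \<in> ?K" using z C.Icarr[OF z] T.one_T zero_closed by blast
    qed
    moreover have "x \<in> ?K"
    proof -
      have "\<one> \<otimes> x = \<one> \<otimes> x \<oplus> \<zero>" using xc by simp
      then show ?thesis using xc T.one_T C.zero_closed one_closed by blast
    qed
    ultimately have "C \<subset> ?K" using x(3) by blast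
    moreover have "?K \<subseteq> C'"
    proof
      fix y assume "y \<in> ?K"
      then obtain u r z where *: "u \<in> hom_compl p" "r \<in> carrier R" "z \<in> C" "u \<otimes> y = r \<otimes> x \<oplus> z"
        "y \<in> carrier R" by blast
      have "r \<otimes> x \<oplus> z \<in> C'" using * x(2) strict by (intro C'.a_closed C'.I_l_closed) auto
      then show "y \<in> C'" using sat_hom_idealsD(3)[OF C(2) *(5,1)] *(4) by simp
    qed
    ultimately have "?K = C'" using consec[OF K] by blast
    then show ?thesis using y by blast
  qed
  obtain b0 where b0: "b0 \<in> C'" "b0 \<notin> C" using strict by blast
  then have b0c: "b0 \<in> carrier R" by simp
  then obtain e where "c e b0 \<notin> C" using ideal_components[OF idC(1) b0c] b0(2) by blast
  then obtain x f where x: "x \<in> G f" "x \<in> C'" "x \<notin> C"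
    using c_G[OF b0c, of e] sat_hom_idealsD(2)[OF C(2) b0(1), of e] by blast
  have xc: "x \<in> carrier R" using x(1) by simp
  \<comment> \<open>The prime \<open>p\<close> annihilates the quotient. Otherwise x times a
    component of \<open>r\<close> would generate \<open>C'\<close> over \<open>C\<close> too, giving
    (u - r' c_k(r)) x in \<open>C\<close>. That multiplier is outside \<open>p\<close> but need not
    be homogeneous, which is where saturation for the full complement of \<open>p\<close> is
    used.\<close>
  have px: "r \<otimes> x \<in> C" if r: "r \<in> p" for r
  proof (rule ideal_components[OF idC(1)])
    have rc: "r \<in> carrier R" using r by simp
    then show "r \<otimes> x \<in> carrier R" using xc by simp
    fix d
    have "x \<otimes> c k r \<in> C" for k
    proof (rule ccontr)
      assume nC: "x \<otimes> c k r \<notin> C"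
      have ck: "c k r \<in> p" using minimal_prime_hom_ideal[OF p] r by (simp add: hom_ideal_def)
      have "x \<otimes> c k r \<in> G (f + k)" using mult_G[OF x(1) c_G[OF rc]] .
      moreover have "x \<otimes> c k r \<in> C'" using x(2) rc by (simp add: C'.I_r_closed)
      ultimately obtain u r' z where *: "u \<in> hom_compl p" "r' \<in> carrier R" "z \<in> C"
          "u \<otimes> x = r' \<otimes> (x \<otimes> c k r) \<oplus> z"
        using gen[OF _ _ nC x(2)] by blast
      have uc: "u \<in> carrier R" using *(1) by auto
      have zc: "z \<in> carrier R" using *(3) by simp
      have "(u \<ominus> r' \<otimes> c k r) \<otimes> x = u \<otimes> x \<ominus> r' \<otimes> (x \<otimes> c k r)"
        using uc xc rc *(2) by (simp add: minus_eq r_distr r_minus l_distr l_minus m_ac)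
      also have "\<dots> = z"
        unfolding *(4) using xc rc *(2) zc by (simp add: minus_eq a_ac r_neg2 r_neg1 r_neg)
      finally have "(u \<ominus> r' \<otimes> c k r) \<otimes> x \<in> C" using *(3) by simp
      moreover have "u \<ominus> r' \<otimes> c k r \<notin> p"
      proof
        assume "u \<ominus> r' \<otimes> c k r \<in> p"
        moreover have "r' \<otimes> c k r \<in> p" using ck *(2) by (rule p.I_l_closed)
        ultimately have "(u \<ominus> r' \<otimes> c k r) \<oplus> r' \<otimes> c k r \<in> p" by simp
        moreover have "(u \<ominus> r' \<otimes> c k r) \<oplus> r' \<otimes> c k r = u"
          using uc rc *(2) by (simp add: minus_eq a_assoc l_neg)
        ultimately show False using *(1) by simp
      qed
      ultimately have "x \<in> C" using satC[OF xc, of "u \<ominus> r' \<otimes> c k r"] uc rc *(2) by auto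
      then show False using x(3) by simp
    qed
    moreover have "c d (r \<otimes> x) = (if f \<le> d then x \<otimes> c (d - f) r else \<zero>)"
      using c_mult_homogeneous[OF x(1) rc] rc xc by (simp add: m_comm)
    ultimately show "c d (r \<otimes> x) \<in> C" by simp
  qed
  obtain w r z where a: "w \<in> hom_compl p" "r \<in> carrier R" "z \<in> C" "w \<otimes> a = r \<otimes> x \<oplus> z"
    using gen[OF x ab(1)] by blast
  obtain w' r' z' where b: "w' \<in> hom_compl p" "r' \<in> carrier R" "z' \<in> C" "w' \<otimes> b = r' \<otimes> x \<oplus> z'"
    using gen[OF x ab(2)] by blast
  have wc: "w \<in> carrier R" "w' \<in> carrier R" "w \<notin> p" "w' \<notin> p" using a(1) b(1) by auto
  have abc: "a \<in> carrier R" "b \<in> carrier R" "z \<in> carrier R" "z' \<in> carrier R"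
    using ab a(3) b(3) by auto
  \<comment> \<open>If \<open>r'\<close> were in \<open>p\<close>, then w' b would lie in
    \<open>C\<close>, and saturation would put \<open>b\<close> itself there.\<close>
  have r': "r' \<notin> p"
  proof
    assume "r' \<in> p"
    then have "w' \<otimes> b \<in> C" unfolding b(4) using px b(3) by simp
    then show False using sat_hom_idealsD(3)[OF C(1) abc(2) b(1)] ab(3) by simp
  qed
  have "r' \<otimes> w \<notin> p" using p.I_prime[OF b(2) wc(1)] r' wc(3) by blast
  \<comment> \<open>Cross-multiplying the expressions of \<open>a\<close> and \<open>b\<close>
    through \<open>x\<close> cancels the multiples of \<open>x\<close> and leaves only elements of
    \<open>C\<close>.\<close>
  moreover have "(r' \<otimes> w) \<otimes> a \<ominus> (r \<otimes> w') \<otimes> b \<in> C"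
  proof -
    have "(r' \<otimes> w) \<otimes> a = r \<otimes> (r' \<otimes> x) \<oplus> r' \<otimes> z"
    proof -
      have "(r' \<otimes> w) \<otimes> a = r' \<otimes> (w \<otimes> a)" using wc abc b(2) by (simp add: m_assoc)
      also have "\<dots> = r \<otimes> (r' \<otimes> x) \<oplus> r' \<otimes> z"
        unfolding a(4) using a(2) b(2) abc xc by (simp add: r_distr m_lcomm)
      finally show ?thesis .
    qed
    moreover have "(r \<otimes> w') \<otimes> b = r \<otimes> (r' \<otimes> x) \<oplus> r \<otimes> z'"
    proof -
      have "(r \<otimes> w') \<otimes> b = r \<otimes> (w' \<otimes> b)" using wc abc a(2) by (simp add: m_assoc)
      also have "\<dots> = r \<otimes> (r' \<otimes> x) \<oplus> r \<otimes> z'"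
        unfolding b(4) using a(2) b(2) abc xc by (simp add: r_distr)
      finally show ?thesis .
    qed
    moreover have "(y \<oplus> v) \<ominus> (y \<oplus> v') = v \<ominus> v'"
      if "y \<in> carrier R" "v \<in> carrier R" "v' \<in> carrier R" for y v v'
    proof -
      have "(y \<oplus> v) \<ominus> (y \<oplus> v') = (y \<ominus> y) \<oplus> (v \<ominus> v')"
        using that by (simp add: minus_eq minus_add a_ac)
      then show ?thesis using that by (simp add: minus_eq r_neg)
    qed
    ultimately have "(r' \<otimes> w) \<otimes> a \<ominus> (r \<otimes> w') \<otimes> b = r' \<otimes> z \<ominus> r \<otimes> z'"
      using a(2) b(2) abc xc by simp
    moreover have "r' \<otimes> z \<ominus> r \<otimes> z' \<in> C"
      using a(2,3) b(2,3) by (intro ideal_minus[OF idC(1)] C.I_l_closed)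
    ultimately show ?thesis by simp
  qed
  ultimately show ?thesis using that[of "r' \<otimes> w" "r \<otimes> w'"] wc a(2) b(2) by simp
qed

text \<open>A chain \<open>A\<close> of saturated ideals is measured against a maximal chain \<open>C\<close> of homogeneous
  ones by the set of \<open>i\<close> for which \<open>A\<close> meets \<open>C (Suc i)\<close> outside \<open>C i\<close>, as in the
  Jordan--Hoelder theorem.\<close>

lemma has_chain_saturated_iff:
  assumes p: "minimal_prime R p"
  shows "has_chain {J. ideal J R \<and> saturated R (carrier R - p) J} n \<longleftrightarrow>
    has_chain (sat_hom_ideals p) n"
proof
  have pp: "primeideal p R" using p by (simp add: minimal_prime_def)
  let ?S = "{J. ideal J R \<and> saturated R (carrier R - p) J}"
  let ?H = "sat_hom_ideals p"
  have sub: "?H \<subseteq> ?S"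
    using saturated_minimal_prime[OF p] by (auto simp: sat_hom_ideals_def hom_ideal_def)
  then show "has_chain ?S n" if "has_chain ?H n"
    using has_chain_image[of ?H "\<lambda>J. J" ?S, OF _ _ that] by blast
  assume S: "has_chain ?S n"
  show "has_chain ?H n"
  proof (rule ccontr)
    assume no: "\<not> has_chain ?H n"
    have carr: "carrier R \<in> ?H" by (rule sat_hom_idealsI) auto
    then have "has_chain ?H 0" by (auto simp: has_chain_def)
    \<comment> \<open>Length \<open>l\<close> is attained and \<open>l + 1\<close> is not, so the
      chain \<open>C\<close> chosen next is a longest one, and none of the three ways to lengthen it
      is available.\<close>
    then obtain l where l: "l < n" "has_chain ?H l" "\<not> has_chain ?H (Suc l)"
      using ex_last_before[of "has_chain ?H", OF _ no] by blast
    then obtain C where C: "\<forall>i\<le>l. C i \<in> ?H" "\<forall>i<l. C i \<subset> C (Suc i)"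
      by (auto simp: has_chain_def)
    obtain A where A: "\<forall>i\<le>n. A i \<in> ?S" "\<forall>i<n. A i \<subset> A (Suc i)"
      using S by (auto simp: has_chain_def)
    have top: "C l = carrier R"
    proof (rule ccontr)
      assume "C l \<noteq> carrier R"
      moreover have "C l \<subseteq> carrier R" using sat_hom_idealsD(1)[of "C l" p] C(1) ideal_iff by simp
      ultimately have "C l \<subset> carrier R" by blast
      then show False using has_chain_append[OF C carr] l(3) by blast
    qed
    \<comment> \<open>A longest chain starts at the kernel of the localization. Its elements are
      annihilated by something outside \<open>p\<close>, so they belong to every saturated
      ideal.\<close>
    have bot: "x \<in> J" if H: "x \<in> C 0" "J \<in> ?S" for x J
    proof -
      let ?K = "{x \<in> carrier R. \<exists>u\<in>hom_compl p. u \<otimes> x = \<zero>}"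
      have C0: "C 0 \<in> ?H" using C(1) by simp
      have K: "?K \<in> ?H" by (rule kernel_sat_hom_ideals[OF pp])
      have "y \<in> C 0" if y: "y \<in> ?K" for y
      proof -
        obtain u where u: "y \<in> carrier R" "u \<in> hom_compl p" "u \<otimes> y = \<zero>" using y by blast
        then have "u \<otimes> y \<in> C 0" using sat_hom_idealsD(1)[OF C0] ideal_iff by simp
        then show ?thesis by (rule sat_hom_idealsD(3)[OF C0 u(1,2)])
      qed
      then have "?K \<subseteq> C 0" by blast
      then have "?K = C 0" using has_chain_prepend[OF C K] l(3) by blast
      then have "x \<in> ?K" using H(1) by simp
      then obtain u where u: "x \<in> carrier R" "u \<in> hom_compl p" "u \<otimes> x = \<zero>" by blast
      have J: "ideal J R" "saturated R (carrier R - p) J" using H(2) by simp_all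
      have "u \<otimes> x \<in> J" using J(1) u(3) by (simp add: ideal_iff)
      moreover have "u \<in> carrier R - p" using u(2) by auto
      ultimately show ?thesis using saturatedD[OF J(2) u(1)] by blast
    qed
    define Q where "Q B = {i. i < l \<and> (\<exists>a\<in>B. a \<in> C (Suc i) \<and> a \<notin> C i)}" for B
    have finQ: "finite (Q B)" "card (Q B) \<le> l" for B
    proof -
      have "Q B \<subseteq> {..<l}" by (auto simp: Q_def)
      then show "finite (Q B)" "card (Q B) \<le> l"
        using finite_subset card_mono[of "{..<l}" "Q B"] by auto
    qed
    \<comment> \<open>If \<open>B\<close> and \<open>B'\<close> had the same jumps, induction on
      \<open>i\<close> would give B' \<inter> C i \<subseteq> B: by rank one, an element of
      \<open>B'\<close> new at step \<open>i\<close> becomes, after a multiplier outside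
      \<open>p\<close>, a multiple of an element of \<open>B\<close> modulo \<open>C i\<close>. At
      \<open>i = l\<close> this contradicts the strict inclusion.\<close>
    have strict: "Q B \<subset> Q B'" if B: "B \<in> ?S" "B' \<in> ?S" "B \<subset> B'" for B B'
    proof (rule ccontr)
      have sub: "Q B \<subseteq> Q B'" using B(3) by (auto simp: Q_def)
      assume "\<not> Q B \<subset> Q B'"
      then have eq: "Q B' = Q B" using sub by blast
      have idB: "ideal B R" "ideal B' R" and satB: "saturated R (carrier R - p) B" using B by auto
      interpret B: ideal B R by fact
      interpret B': ideal B' R by fact
      have "a \<in> B" if "i \<le> l" "a \<in> B'" "a \<in> C i" for i a
        using that
      proof (induction i arbitrary: a)
        case 0
        then show ?case using bot B(1) by blast
      next
        case (Suc i)
        have Ci: "C i \<in> ?H" "C (Suc i) \<in> ?H" "C i \<subset> C (Suc i)" using C Suc.prems(1) by auto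
        have consec: False if "K \<in> ?H" "C i \<subset> K" "K \<subset> C (Suc i)" for K
          using has_chain_insert[OF C _ that] l(3) Suc.prems(1) by simp
        show ?case
        proof (cases "a \<in> C i")
          case True
          then show ?thesis using Suc by simp
        next
          case False
          then have "i \<in> Q B'" using Suc.prems by (auto simp: Q_def)
          then obtain b where b: "b \<in> B" "b \<in> C (Suc i)" "b \<notin> C i"
            unfolding eq by (auto simp: Q_def)
          obtain u s where us: "u \<in> carrier R" "u \<notin> p" "s \<in> carrier R" "u \<otimes> a \<ominus> s \<otimes> b \<in> C i"
            by (rule consecutive_rank_one[OF p Ci consec Suc.prems(3) b(2,3)])
          have "u \<otimes> a \<ominus> s \<otimes> b \<in> B'"
            using us Suc.prems(2) b(1) B(3) by (intro ideal_minus[OF idB(2)] B'.I_l_closed) auto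
          then have "u \<otimes> a \<ominus> s \<otimes> b \<in> B" using Suc.IH us(4) Suc.prems(1) by simp
          then have "(u \<otimes> a \<ominus> s \<otimes> b) \<oplus> s \<otimes> b \<in> B"
            using b(1) us(3) by (intro B.a_closed B.I_l_closed)
          moreover have "(u \<otimes> a \<ominus> s \<otimes> b) \<oplus> s \<otimes> b = u \<otimes> a"
            using us Suc.prems(2) b(1) by (simp add: minus_eq a_assoc l_neg)
          ultimately show ?thesis
            using saturatedD[OF satB, of a u] us Suc.prems(2) by simp
        qed
      qed
      from this[of l] have "B' \<subseteq> B" unfolding top using B'.a_subset by auto
      then show False using B(3) by blast
    qed
    \<comment> \<open>Every step of \<open>A\<close> gains at least one jump, so \<open>n\<close>
      steps would need \<open>n\<close> jumps, while only \<open>l < n\<close> are possible.\<close>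
    have "i \<le> n \<Longrightarrow> i \<le> card (Q (A i))" for i
    proof (induction i)
      case (Suc i)
      then have "Q (A i) \<subset> Q (A (Suc i))" using A strict by simp
      then have "card (Q (A i)) < card (Q (A (Suc i)))" using finQ(1) by (intro psubset_card_mono)
      then show ?case using Suc by simp
    qed simp
    then show False using finQ(2)[of "A n"] l(1) by fastforce
  qed
qed

text \<open>An element \<open>t\<close> of degree one outside \<open>p\<close> turns homogeneous elements of degree \<open>d\<close> into the
  fractions \<open>a / t^d\<close> of degree zero.\<close>

lemma has_chain_homogeneous_localization:
  assumes p: "primeideal p R" and t: "t \<in> G 1" "t \<notin> p" and A0: "A0 \<subseteq> G 0"
  defines "HL \<equiv> homogeneous_localization R G p"
  shows "cring HL"
    and "has_chain {J. ideal J HL \<and> (\<lambda>a. fraction R (hom_compl p) a \<one>) ` A0 \<subseteq> J} n \<longleftrightarrow>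
      has_chain {J \<in> sat_hom_ideals p. A0 \<subseteq> J} n"
proof -
  interpret p: primeideal p R by fact
  interpret T: mult_subset R "hom_compl p" using mult_subset_hom_compl[OF p] .
  interpret L: cring "localization R (hom_compl p)" by (rule T.cring_localization)
  let ?T = "hom_compl p"
  let ?L = "localization R ?T"
  let ?fr = "fraction R ?T"
  define K where "K = {?fr a s | a s d. a \<in> G d \<and> s \<in> G d \<and> s \<in> ?T}"
  have HL: "HL = ?L\<lparr>carrier := K\<rparr>"
    by (simp add: HL_def homogeneous_localization_def K_def Let_def)
  have K_I: "?fr a s \<in> K" if "a \<in> G d" "s \<in> G d" "s \<in> ?T" for a s d
    using that unfolding K_def by blast
  have K_E: "\<exists>a s d. x = ?fr a s \<and> a \<in> G d \<and> s \<in> G d \<and> s \<in> ?T" if "x \<in> K" for x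
    using that unfolding K_def by blast
  have Tc: "s \<in> carrier R" if "s \<in> ?T" for s using that by auto
  have sub: "subring K ?L"
  proof (rule L.subringI)
    show "K \<subseteq> carrier ?L" using K_E by fastforce
    show "\<one>\<^bsub>?L\<^esub> \<in> K" unfolding T.one_localization by (rule K_I[OF one_G one_G T.one_T])
    fix x assume "x \<in> K"
    then obtain a s d where x: "x = ?fr a s" "a \<in> G d" "s \<in> G d" "s \<in> ?T" using K_E by blast
    have a: "\<ominus> a \<in> G d" using c_G[of "\<ominus> a" d] x(2) by (simp add: c_uminus c_homogeneous)
    have "?fr (\<ominus> a) s \<oplus>\<^bsub>?L\<^esub> x = \<zero>\<^bsub>?L\<^esub>"
      unfolding x(1) T.zero_localization using x a T.one_T
      by (simp add: T.add_fraction_same l_neg) (intro T.fraction_eqI; simp)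
    then have "\<ominus>\<^bsub>?L\<^esub> x = ?fr (\<ominus> a) s"
      using x a by (intro L.minus_equality) auto
    then show "\<ominus>\<^bsub>?L\<^esub> x \<in> K" using K_I[OF a x(3,4)] by simp
    fix y assume "y \<in> K"
    then obtain b r e where y: "y = ?fr b r" "b \<in> G e" "r \<in> G e" "r \<in> ?T" using K_E by blast
    show "x \<otimes>\<^bsub>?L\<^esub> y \<in> K"
      unfolding x(1) y(1) T.mult_fraction[OF G_closed[OF x(2)] x(4) G_closed[OF y(2)] y(4)]
      by (rule K_I[OF mult_G[OF x(2) y(2)] mult_G[OF x(3) y(3)] T.mult_T[OF x(4) y(4)]])
    have "b \<otimes> s \<in> G (d + e)" using mult_G[OF y(2) x(3)] by (simp add: add.commute)
    then show "x \<oplus>\<^bsub>?L\<^esub> y \<in> K"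
      unfolding x(1) y(1) T.add_fraction[OF G_closed[OF x(2)] x(4) G_closed[OF y(2)] y(4)]
      by (intro K_I[OF add_G[OF mult_G[OF x(2) y(3)]] mult_G[OF x(3) y(3)] T.mult_T[OF x(4) y(4)]])
  qed
  show crHL: "cring HL"
    unfolding HL using L.subcringI'[OF sub] L.subcring_iff[OF subringE(1)[OF sub]] by simp
  interpret HL: cring HL by (rule crHL)
  have carrHL: "carrier HL = K" by (simp add: HL)
  have multHL: "x \<otimes>\<^bsub>HL\<^esub> y = x \<otimes>\<^bsub>?L\<^esub> y" for x y by (simp add: HL)
  have addHL: "x \<oplus>\<^bsub>HL\<^esub> y = x \<oplus>\<^bsub>?L\<^esub> y" for x y by (simp add: HL)
  have zeroHL: "\<zero>\<^bsub>HL\<^esub> = ?fr \<zero> \<one>" by (simp add: HL T.zero_localization)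
  have tG: "t [^] d \<in> G d" for d :: nat using pow_G[OF t(1), of d] by simp
  have tc: "t \<in> carrier R" using t(1) by simp
  have tp: "t [^] d \<notin> p" for d :: nat
  proof (induction d)
    case 0
    then show ?case using p primeideal_iff[of p] by simp
  next
    case (Suc d)
    then show ?case using p.I_prime[of "t [^] d" t] t tc by auto
  qed
  have tT: "t [^] d \<in> ?T" for d :: nat using tG tp by blast
  have frzero: "?fr \<zero> s = \<zero>\<^bsub>HL\<^esub>" if "s \<in> ?T" for s
    unfolding zeroHL using that T.one_T Tc by (intro T.fraction_eqI) auto
  have split: "?fr a r = ?fr a s \<otimes>\<^bsub>HL\<^esub> ?fr s r" if "a \<in> carrier R" "s \<in> ?T" "r \<in> ?T" for a s r
    unfolding multHL using that by (rule T.fraction_split)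
  \<comment> \<open>Division by t^d brings the component of degree \<open>d\<close> into degree
    zero. In the other direction, \<open>g\<close> collects the fractions of degree zero with
    numerator in \<open>J\<close>.\<close>
  define f where "f B = {x \<in> carrier R. \<forall>d. ?fr (c d x) (t [^] d) \<in> B}" for B
  define g where "g J = {?fr a s | a s d. a \<in> J \<and> a \<in> G d \<and> s \<in> G d \<and> s \<in> ?T}" for J
  have g_I: "?fr a s \<in> g J" if "a \<in> J" "a \<in> G d" "s \<in> G d" "s \<in> ?T" for a s d J
    using that unfolding g_def by blast
  have g_E: "\<exists>a s d. x = ?fr a s \<and> a \<in> J \<and> a \<in> G d \<and> s \<in> G d \<and> s \<in> ?T" if "x \<in> g J" for x J
    using that unfolding g_def by blast
  have f_hom: "x \<in> f B \<longleftrightarrow> ?fr x (t [^] d) \<in> B" if "ideal B HL" "x \<in> G d" for B x d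
  proof -
    have "?fr (c e x) (t [^] e) \<in> B \<longleftrightarrow> e = d \<longrightarrow> ?fr x (t [^] d) \<in> B" for e
      using that frzero[OF tT] HL.ideal_iff[of B] by (auto simp: c_homogeneous)
    then show ?thesis using that(2) by (auto simp: f_def)
  qed
  have f_add: "x \<oplus> y \<in> f B" if B: "ideal B HL" and xy: "x \<in> f B" "y \<in> f B" for B x y
  proof -
    have "?fr (c d x \<oplus> c d y) (t [^] d) \<in> B" for d
    proof -
      have "?fr (c d x) (t [^] d) \<oplus>\<^bsub>HL\<^esub> ?fr (c d y) (t [^] d) \<in> B"
        using B xy unfolding HL.ideal_iff f_def by simp
      then show ?thesis
        using xy T.add_fraction_same[of "c d x" "c d y" "t [^] d"] tT unfolding addHL f_def by simp
    qed
    then show ?thesis using xy by (simp add: f_def c_add)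
  qed
  have f_mem: "f B \<in> {J \<in> sat_hom_ideals p. A0 \<subseteq> J}"
    if B: "ideal B HL" "(\<lambda>a. ?fr a \<one>) ` A0 \<subseteq> B" for B
  proof -
    interpret B: ideal B HL by fact
    have "f B \<in> sat_hom_ideals p"
    proof (rule sat_hom_idealsI)
      show "f B \<subseteq> carrier R" by (auto simp: f_def)
      show "\<zero> \<in> f B" using frzero[OF tT] B.zero_closed by (simp add: f_def)
      show "x \<oplus> y \<in> f B" if "x \<in> f B" "y \<in> f B" for x y
        using f_add[OF B(1) that] .
      show "c d x \<in> f B" if "x \<in> f B" for x d
      proof -
        have "x \<in> carrier R" using that by (simp add: f_def)
        then show ?thesis using that f_hom[OF B(1) c_G[of x d]] by (simp add: f_def)
      qed
      show "r \<otimes> x \<in> f B" if "r \<in> carrier R" and x: "x \<in> f B" for r x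
        using that(1)
      proof (induction r rule: graded_induct)
        case zero
        then show ?case using x \<open>\<zero> \<in> f B\<close> by (simp add: f_def)
      next
        case (homogeneous e r)
        have xc: "x \<in> carrier R" using x by (simp add: f_def)
        have "?fr (c d (r \<otimes> x)) (t [^] d) \<in> B" for d
        proof (cases "e \<le> d")
          case True
          have "?fr r (t [^] e) \<otimes>\<^bsub>HL\<^esub> ?fr (c (d - e) x) (t [^] (d - e)) \<in> B"
            using x K_I[OF homogeneous tG tT] by (intro B.I_l_closed) (auto simp: f_def carrHL)
          moreover have "?fr r (t [^] e) \<otimes>\<^bsub>HL\<^esub> ?fr (c (d - e) x) (t [^] (d - e)) =
              ?fr (r \<otimes> c (d - e) x) (t [^] d)"
            unfolding multHL using T.mult_fraction[OF G_closed[OF homogeneous] tT[of e] c_closed[OF xc] tT[of "d - e"], of "d - e"]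
              nat_pow_mult[OF tc, of e "d - e"] True by simp
          ultimately show ?thesis
            using c_mult_homogeneous[OF homogeneous xc, of d] True by simp
        next
          case False
          then show ?thesis
            using c_mult_homogeneous[OF homogeneous xc, of d] frzero[OF tT] B.zero_closed by simp
        qed
        then show ?case using homogeneous xc by (simp add: f_def)
      next
        case (add r s)
        then show ?case using f_add[OF B(1), of "r \<otimes> x" "s \<otimes> x"] x by (simp add: l_distr f_def)
      qed
      show "x \<in> f B" if x: "x \<in> carrier R" and u: "u \<in> hom_compl p" and ux: "u \<otimes> x \<in> f B" for x u
      proof -
        obtain e where e: "u \<in> G e" using u by blast
        have "?fr (c d x) (t [^] d) \<in> B" for d
        proof -
          \<comment> \<open>The multiplier \<open>u\<close> has degree \<open>e\<close>, so the
            fraction t^e / u has degree zero; multiplying by it removes \<open>u\<close> inside the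
            degree zero ring.\<close>
          have "c (e + d) (u \<otimes> x) = u \<otimes> c d x"
            using c_mult_homogeneous[OF e x, of "e + d"] by simp
          then have "?fr (u \<otimes> c d x) (t [^] (e + d)) \<in> B"
            using ux unfolding f_def by (metis (mono_tags, lifting) mem_Collect_eq)
          then have "?fr (t [^] e) u \<otimes>\<^bsub>HL\<^esub> ?fr (u \<otimes> c d x) (t [^] (e + d)) \<in> B"
            using K_I[OF tG e u] by (intro B.I_l_closed) (auto simp: carrHL)
          moreover have "?fr (t [^] e) u \<otimes>\<^bsub>HL\<^esub> ?fr (u \<otimes> c d x) (t [^] (e + d)) =
              ?fr (t [^] e \<otimes> (u \<otimes> c d x)) (u \<otimes> t [^] (e + d))"
            unfolding multHL using x tc Tc[OF u] u tT by (intro T.mult_fraction) auto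
          moreover have "\<dots> = ?fr (c d x) (t [^] d)"
          proof (rule T.fraction_eqI)
            show "t [^] e \<otimes> (u \<otimes> c d x) \<otimes> t [^] d = c d x \<otimes> (u \<otimes> t [^] (e + d))"
              using x tc Tc[OF u] unfolding nat_pow_mult[OF tc, symmetric] by (simp add: m_ac)
            show "u \<otimes> t [^] (e + d) \<in> hom_compl p" by (rule T.mult_T[OF u tT])
          qed (use x tc Tc[OF u] tT in auto)
          ultimately show ?thesis by simp
        qed
        then show ?thesis using x by (simp add: f_def)
      qed
    qed
    \<comment> \<open>Elements of \<open>A0\<close> have degree zero and are divided by t^0 = 1.
      Carrying \<open>A0\<close> along lets the same correspondence describe quotients of the local
      ring.\<close>
    moreover have "A0 \<subseteq> f B"
      using f_hom[OF B(1), of _ 0] B(2) A0 by auto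
    ultimately show ?thesis by simp
  qed
  have f_strict: "f A \<subset> f B" if AB: "ideal A HL" "ideal B HL" "A \<subset> B" for A B
  proof -
    obtain z where z: "z \<in> B" "z \<notin> A" using AB(3) by blast
    have "z \<in> K" using z(1) HL.ideal_iff[of B] AB(2) carrHL by auto
    then obtain a s d where as: "z = ?fr a s" "a \<in> G d" "s \<in> G d" "s \<in> ?T" using K_E by blast
    have "?fr a (t [^] d) = z \<otimes>\<^bsub>HL\<^esub> ?fr s (t [^] d)"
      unfolding as(1) using as by (intro split tT) auto
    then have "?fr a (t [^] d) \<in> B"
      using ideal.I_r_closed[OF AB(2) z(1)] K_I[OF as(3) tG tT] carrHL by simp
    then have "a \<in> f B" using f_hom[OF AB(2) as(2)] by simp
    moreover have "a \<notin> f A"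
    proof
      assume "a \<in> f A"
      then have "?fr a (t [^] d) \<in> A" using f_hom[OF AB(1) as(2)] by simp
      then have "?fr a (t [^] d) \<otimes>\<^bsub>HL\<^esub> ?fr (t [^] d) s \<in> A"
        using ideal.I_r_closed[OF AB(1)] K_I[OF tG as(3,4)] carrHL by simp
      moreover have "z = ?fr a (t [^] d) \<otimes>\<^bsub>HL\<^esub> ?fr (t [^] d) s"
        unfolding as(1) using as by (intro split tT) auto
      ultimately show False using z(2) by simp
    qed
    moreover have "f A \<subseteq> f B" using AB(3) unfolding f_def by blast
    ultimately show ?thesis by blast
  qed
  have g_mem: "ideal (g J) HL" "(\<lambda>a. ?fr a \<one>) ` A0 \<subseteq> g J"
    if J: "J \<in> sat_hom_ideals p" "A0 \<subseteq> J" for J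
  proof -
    interpret J: ideal J R using J(1) by (rule sat_hom_idealsD)
    show "(\<lambda>a. ?fr a \<one>) ` A0 \<subseteq> g J"
      using J(2) A0 g_I[OF _ _ one_G T.one_T] by auto
    show "ideal (g J) HL"
      unfolding HL.ideal_iff carrHL
    proof (intro conjI ballI)
      show "g J \<subseteq> K" unfolding g_def K_def by blast
      show "\<zero>\<^bsub>HL\<^esub> \<in> g J" unfolding zeroHL by (rule g_I[OF _ _ one_G T.one_T]) auto
      fix x y assume y: "y \<in> g J"
      obtain b r e where y: "y = ?fr b r" "b \<in> J" "b \<in> G e" "r \<in> G e" "r \<in> ?T"
        using g_E[OF y] by blast
      {
        assume x: "x \<in> g J"
        obtain a s d where x: "x = ?fr a s" "a \<in> J" "a \<in> G d" "s \<in> G d" "s \<in> ?T"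
          using g_E[OF x] by blast
        have bs: "b \<otimes> s \<in> G (d + e)" using mult_G[OF y(3) x(4)] by (simp add: add.commute)
        show "x \<oplus>\<^bsub>HL\<^esub> y \<in> g J"
          unfolding addHL x(1) y(1) T.add_fraction[OF G_closed[OF x(3)] x(5) G_closed[OF y(3)] y(5)]
        proof (rule g_I[OF _ add_G[OF mult_G[OF x(3) y(4)] bs] mult_G[OF x(4) y(4)] T.mult_T[OF x(5) y(5)]])
          show "a \<otimes> r \<oplus> b \<otimes> s \<in> J" using x y Tc by (intro J.a_closed J.I_r_closed) auto
        qed
      }
      {
        assume x: "x \<in> K"
        obtain a s d where x: "x = ?fr a s" "a \<in> G d" "s \<in> G d" "s \<in> ?T"
          using K_E[OF x] by blast
        show "x \<otimes>\<^bsub>HL\<^esub> y \<in> g J"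
          unfolding multHL x(1) y(1) T.mult_fraction[OF G_closed[OF x(2)] x(4) G_closed[OF y(3)] y(5)]
          using J.I_l_closed[OF y(2) G_closed[OF x(2)]]
          by (rule g_I[OF _ mult_G[OF x(2) y(3)] mult_G[OF x(3) y(4)] T.mult_T[OF x(4) y(5)]])
      }
    qed
  qed
  have g_strict: "g A \<subset> g B" if AB: "A \<in> sat_hom_ideals p" "B \<in> sat_hom_ideals p" "A \<subset> B" for A B
  proof -
    interpret A: ideal A R using AB(1) by (rule sat_hom_idealsD)
    interpret B: ideal B R using AB(2) by (rule sat_hom_idealsD)
    obtain b0 where b0: "b0 \<in> B" "b0 \<notin> A" using AB(3) by blast
    then have b0c: "b0 \<in> carrier R" by simp
    then obtain d where d: "c d b0 \<notin> A" using ideal_components[OF A.is_ideal b0c] b0(2) by blast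
    let ?b = "c d b0"
    have b: "?b \<in> B" "?b \<in> G d" using sat_hom_idealsD(2)[OF AB(2) b0(1)] c_G[OF b0c] by auto
    have "?fr ?b (t [^] d) \<in> g B" by (rule g_I[OF b tG tT])
    moreover have "?fr ?b (t [^] d) \<notin> g A"
    proof
      assume mem: "?fr ?b (t [^] d) \<in> g A"
      obtain a s e where as: "?fr ?b (t [^] d) = ?fr a s" "a \<in> A" "a \<in> G e" "s \<in> G e" "s \<in> ?T"
        using g_E[OF mem] by blast
      then obtain u where u: "u \<in> ?T" "u \<otimes> (?b \<otimes> s) = u \<otimes> (a \<otimes> t [^] d)"
        using T.fraction_eq_iff[OF G_closed[OF b(2)] tT G_closed[OF as(3)] as(5)] by blast
      have "u \<otimes> (a \<otimes> t [^] d) \<in> A"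
        using as(2) tc Tc[OF u(1)] by (intro A.I_l_closed A.I_r_closed) auto
      moreover have "(u \<otimes> s) \<otimes> ?b = u \<otimes> (?b \<otimes> s)"
        using Tc[OF u(1)] Tc[OF as(5)] b(2) by (simp add: m_ac)
      ultimately have "(u \<otimes> s) \<otimes> ?b \<in> A" using u(2) by simp
      then show False
        using sat_hom_idealsD(3)[OF AB(1) G_closed[OF b(2)] T.mult_T[OF u(1) as(5)]] d by simp
    qed
    moreover have "g A \<subseteq> g B" using AB(3) unfolding g_def by blast
    ultimately show ?thesis by blast
  qed
  show "has_chain {J. ideal J HL \<and> (\<lambda>a. ?fr a \<one>) ` A0 \<subseteq> J} n \<longleftrightarrow>
      has_chain {J \<in> sat_hom_ideals p. A0 \<subseteq> J} n" (is "?l \<longleftrightarrow> ?r")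
  proof
    show ?r if ?l
      by (rule has_chain_image[OF _ _ that, where f = f]) (use f_mem f_strict in auto)
    show ?l if ?r
      by (rule has_chain_image[OF _ _ that, where f = g]) (use g_mem g_strict in auto)
  qed
qed

lemma ring_length_homogeneous_localization:
  assumes p: "minimal_prime R p" and t: "t \<in> G 1" "t \<notin> p"
  shows "ring_length (homogeneous_localization R G p) = ring_length (localization R (carrier R - p))"
proof -
  have pp: "primeideal p R" using p by (simp add: minimal_prime_def)
  interpret T: mult_subset R "carrier R - p" by (rule mult_subset_compl_prime[OF pp])
  show ?thesis
    unfolding ring_length_has_chain T.has_chain_localization has_chain_saturated_iff[OF p]
    using has_chain_homogeneous_localization(2)[OF pp t, of "{}"] by simp
qed

end

section \<open>Graded surjections\<close>

locale surjective_hom = R: cring R + S: cring S for R (structure) and S (structure) +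
  fixes h
  assumes hom: "h \<in> ring_hom R S" and surj: "h ` carrier R = carrier S"
begin

sublocale ring_hom_cring R S h
  by (rule ring_hom_cring.intro) (unfold_locales, rule hom)

lemma ring_hom_ring: "ring_hom_ring R S h"
  by (rule ring_hom_ringI2[OF R.ring_axioms S.ring_axioms hom])

definition vim :: "'c set \<Rightarrow> 'a set"
  where "vim J = {x \<in> carrier R. h x \<in> J}"

definition ker :: "'a set"
  where "ker = {x \<in> carrier R. h x = \<zero>\<^bsub>S\<^esub>}"

lemma surj_cases:
  assumes "y \<in> carrier S"
  obtains x where "x \<in> carrier R" "y = h x"
  using assms surj by blast

lemma ideal_vim: "ideal J S \<Longrightarrow> ideal (vim J) R"
  unfolding vim_def by (rule ring_hom_ring.ideal_vimage[OF ring_hom_ring])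

lemma ker_subset_vim: "ideal J S \<Longrightarrow> ker \<subseteq> vim J"
  by (auto simp: ker_def vim_def S.ideal_iff)

text \<open>Surjectivity makes an ideal of \<open>S\<close> recoverable from its preimage, so
  preimages of strict chains stay strict.\<close>

lemma vim_strict_mono:
  assumes "ideal A S" "ideal B S"
  shows "vim A \<subseteq> vim B \<longleftrightarrow> A \<subseteq> B"
proof
  assume *: "vim A \<subseteq> vim B"
  show "A \<subseteq> B"
  proof
    fix y assume y: "y \<in> A"
    then have "y \<in> carrier S" using assms(1) by (auto simp: S.ideal_iff)
    then obtain x where "x \<in> carrier R" "y = h x" by (rule surj_cases)
    then show "y \<in> B" using * y by (auto simp: vim_def)
  qed
qed (auto simp: vim_def)

text \<open>Two preimages of the same element differ by an element of the kernel, which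
  \<open>J\<close> absorbs.\<close>

lemma mem_image_iff:
  assumes "ideal J R" "ker \<subseteq> J" "x \<in> carrier R"
  shows "h x \<in> h ` J \<longleftrightarrow> x \<in> J"
proof
  interpret J: ideal J R by fact
  assume "h x \<in> h ` J"
  then obtain j where j: "j \<in> J" "h x = h j" by blast
  then have jc: "j \<in> carrier R" by simp
  have "h (x \<ominus> j) = \<zero>\<^bsub>S\<^esub>" using assms(3) j jc by (simp add: R.minus_eq S.r_neg)
  then have "x \<ominus> j \<in> J" using assms(2,3) jc by (auto simp: ker_def)
  then have "(x \<ominus> j) \<oplus> j \<in> J" using j(1) by simp
  moreover have "(x \<ominus> j) \<oplus> j = x" using assms(3) jc by (simp add: R.minus_eq R.a_assoc R.l_neg)
  ultimately show "x \<in> J" by simp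
qed simp

lemma ideal_image:
  assumes "ideal J R"
  shows "ideal (h ` J) S"
  unfolding S.ideal_iff
proof (intro conjI ballI)
  interpret J: ideal J R by fact
  show "h ` J \<subseteq> carrier S" using J.a_subset by auto
  show "\<zero>\<^bsub>S\<^esub> \<in> h ` J" using J.zero_closed hom_zero by (metis image_eqI)
  fix x y assume "y \<in> h ` J"
  then obtain b where b: "b \<in> J" "y = h b" by blast
  have bc: "b \<in> carrier R" using b(1) by simp
  {
    assume "x \<in> h ` J"
    then obtain a where a: "a \<in> J" "x = h a" by blast
    have "x \<oplus>\<^bsub>S\<^esub> y = h (a \<oplus> b)" using a b bc by simp
    then show "x \<oplus>\<^bsub>S\<^esub> y \<in> h ` J" using J.a_closed[OF a(1) b(1)] by blast
  }
  {
    assume "x \<in> carrier S"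
    then obtain a where a: "a \<in> carrier R" "x = h a" by (rule surj_cases)
    have "x \<otimes>\<^bsub>S\<^esub> y = h (a \<otimes> b)" using a b bc by simp
    then show "x \<otimes>\<^bsub>S\<^esub> y \<in> h ` J" using J.I_l_closed[OF b(1) a(1)] by blast
  }
qed

lemma vim_image: "ideal J R \<Longrightarrow> ker \<subseteq> J \<Longrightarrow> vim (h ` J) = J"
  using mem_image_iff by (auto simp: vim_def R.ideal_iff)

lemma primeideal_vim: "primeideal P S \<Longrightarrow> primeideal (vim P) R"
  unfolding vim_def by (rule ring_hom_ring.primeideal_vimage[OF ring_hom_ring R.is_cring])

lemma primeideal_image:
  assumes "primeideal P R" "ker \<subseteq> P"
  shows "primeideal (h ` P) S"
  unfolding S.primeideal_iff
proof (intro conjI ballI impI)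
  have P: "ideal P R" "\<one> \<notin> P" using assms(1) R.primeideal_iff[of P] by simp_all
  note mem = mem_image_iff[OF P(1) assms(2)]
  show "ideal (h ` P) S" by (rule ideal_image[OF P(1)])
  show "\<one>\<^bsub>S\<^esub> \<notin> h ` P" using mem[of \<one>] P(2) by simp
  fix x y assume xy: "x \<in> carrier S" "y \<in> carrier S" "x \<otimes>\<^bsub>S\<^esub> y \<in> h ` P"
  obtain a where a: "a \<in> carrier R" "x = h a" using xy(1) by (rule surj_cases)
  obtain b where b: "b \<in> carrier R" "y = h b" using xy(2) by (rule surj_cases)
  have "a \<otimes> b \<in> P" using xy(3) mem[of "a \<otimes> b"] a b by simp
  then have "a \<in> P \<or> b \<in> P" using assms(1) R.primeideal_iff[of P] a b by simp
  then show "x \<in> h ` P \<or> y \<in> h ` P" using a b by blast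
qed

lemma has_chain_ideals_surjective:
  "has_chain {J. ideal J S} n \<longleftrightarrow> has_chain {J. ideal J R \<and> ker \<subseteq> J} n" (is "?l \<longleftrightarrow> ?r")
proof
  show ?r if ?l
  proof (rule has_chain_image[OF _ _ that, where f = vim])
    show "vim A \<in> {J. ideal J R \<and> ker \<subseteq> J}" if "A \<in> {J. ideal J S}" for A
      using that ideal_vim ker_subset_vim by blast
    show "vim A \<subset> vim B" if "A \<in> {J. ideal J S}" "B \<in> {J. ideal J S}" "A \<subset> B" for A B
      using that vim_strict_mono[of A B] vim_strict_mono[of B A] by auto
  qed
  show ?l if ?r
  proof (rule has_chain_image[OF _ _ that, where f = "(`) h"])
    show "h ` A \<in> {J. ideal J S}" if "A \<in> {J. ideal J R \<and> ker \<subseteq> J}" for A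
      using that ideal_image by blast
    show "h ` A \<subset> h ` B"
      if "A \<in> {J. ideal J R \<and> ker \<subseteq> J}" "B \<in> {J. ideal J R \<and> ker \<subseteq> J}" "A \<subset> B" for A B
      using that vim_image[of A] vim_image[of B] by (metis (no_types, lifting) image_mono
        mem_Collect_eq psubset_eq)
  qed
qed

end

lemma zero_FactRing: "\<zero>\<^bsub>R Quot I\<^esub> = I"
  by (simp add: FactRing_def)

lemma surjective_hom_quotient:
  assumes "cring R" "ideal I R"
  shows "surjective_hom R (R Quot I) ((+>\<^bsub>R\<^esub>) I)"
proof -
  interpret R: cring R by fact
  interpret I: ideal I R by fact
  interpret Q: cring "R Quot I" using I.quotient_is_cring[OF R.is_cring] .
  show ?thesis
  proof unfold_locales
    show "(+>\<^bsub>R\<^esub>) I \<in> ring_hom R (R Quot I)" by (rule I.rcos_ring_hom)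
    show "(+>\<^bsub>R\<^esub>) I ` carrier R = carrier (R Quot I)"
      by (auto simp: FactRing_def A_RCOSETS_def')
  qed
qed

lemma ker_quotient:
  assumes "cring R" "ideal I R"
  shows "surjective_hom.ker R (R Quot I) ((+>\<^bsub>R\<^esub>) I) = I"
proof -
  interpret R: cring R by fact
  interpret I: ideal I R by fact
  have "I +>\<^bsub>R\<^esub> x = I \<longleftrightarrow> x \<in> I" if "x \<in> carrier R" for x
    using that I.a_rcos_const I.a_rcos_self[of x] by auto
  then have "{x \<in> carrier R. I +>\<^bsub>R\<^esub> x = I} = {x \<in> carrier R. x \<in> I}"
    by (intro Collect_cong) auto
  then show ?thesis
    unfolding surjective_hom.ker_def[OF surjective_hom_quotient[OF assms]] zero_FactRing
    using I.a_subset by blast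
qed

lemma has_chain_quotient:
  assumes "cring R" "ideal I R"
  shows "has_chain {J. ideal J (R Quot I)} n \<longleftrightarrow> has_chain {J. ideal J R \<and> I \<subseteq> J} n"
  using surjective_hom.has_chain_ideals_surjective[OF surjective_hom_quotient[OF assms]]
  unfolding ker_quotient[OF assms] .

locale graded_surjection = surjective_hom R S h + R: graded_cring R G c + S: graded_cring S G' c'
  for R (structure) and S (structure) and h G c G' c' +
  assumes image_G: "h ` G d = G' d"
    and c_hom: "x \<in> carrier R \<Longrightarrow> h (c d x) = c' d (h x)"
begin

lemma hom_ideal_vim: "S.hom_ideal J \<Longrightarrow> R.hom_ideal (vim J)"
  using ideal_vim c_hom by (auto simp: S.hom_ideal_def R.hom_ideal_def vim_def)

lemma hom_ideal_image:
  assumes "R.hom_ideal J"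
  shows "S.hom_ideal (h ` J)"
proof -
  have J: "ideal J R" using assms by (simp add: R.hom_ideal_def)
  have "c' d (h x) \<in> h ` J" if x: "x \<in> J" for x d
  proof -
    have "x \<in> carrier R" using J x by (auto simp: R.ideal_iff)
    then have "c' d (h x) = h (c d x)" by (simp add: c_hom)
    then show ?thesis using x assms by (auto simp: R.hom_ideal_def)
  qed
  then show ?thesis using ideal_image[OF J] by (auto simp: S.hom_ideal_def)
qed

lemma sat_hom_ideals_vim:
  assumes "J \<in> S.sat_hom_ideals p"
  shows "vim J \<in> R.sat_hom_ideals (vim p)"
proof -
  have J: "S.hom_ideal J" using assms by (simp add: S.sat_hom_ideals_def)
  have "x \<in> vim J" if x: "x \<in> carrier R" and u: "u \<in> R.hom_compl (vim p)" and ux: "u \<otimes> x \<in> vim J" for x u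
  proof -
    obtain d where d: "u \<in> G d" using u by blast
    have uc: "u \<in> carrier R" using d by simp
    have "h u \<in> G' d" using d image_G by blast
    moreover have "h u \<notin> p" using u uc by (auto simp: vim_def)
    ultimately have "h u \<in> S.hom_compl p" by blast
    moreover have "h u \<otimes>\<^bsub>S\<^esub> h x \<in> J" using ux x uc by (simp add: vim_def)
    ultimately have "h x \<in> J" using S.sat_hom_idealsD(3)[OF assms hom_closed[OF x]] by blast
    then show ?thesis using x by (simp add: vim_def)
  qed
  then show ?thesis
    using hom_ideal_vim[OF J] unfolding R.sat_hom_ideals_def saturated_def by blast
qed

text \<open>A homogeneous multiplier in \<open>S\<close> lifts to one of the same degree by
  \<open>image_G\<close>, and the lift stays outside the preimage of \<open>p\<close>, so saturation
  can be tested in \<open>R\<close>.\<close>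

lemma sat_hom_ideals_image:
  assumes J: "J \<in> R.sat_hom_ideals (vim p)" "ker \<subseteq> J"
  shows "h ` J \<in> S.sat_hom_ideals p"
proof -
  have hJ: "R.hom_ideal J" using J by (simp add: R.sat_hom_ideals_def)
  then have idJ: "ideal J R" by (simp add: R.hom_ideal_def)
  have "y \<in> h ` J" if y: "y \<in> carrier S" and v: "v \<in> S.hom_compl p" and vy: "v \<otimes>\<^bsub>S\<^esub> y \<in> h ` J" for y v
  proof -
    obtain x where x: "x \<in> carrier R" "y = h x" using y by (rule surj_cases)
    obtain d where d: "v \<in> G' d" using v by blast
    then obtain u where u: "u \<in> G d" "v = h u" using image_G by blast
    have uc: "u \<in> carrier R" using u by simp
    have "u \<in> R.hom_compl (vim p)" using u v by (auto simp: vim_def)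
    moreover have "u \<otimes> x \<in> J" using mem_image_iff[OF idJ J(2), of "u \<otimes> x"] vy x u uc by simp
    ultimately have "x \<in> J" using R.sat_hom_idealsD(3)[OF J(1) x(1)] by blast
    then show ?thesis using x by blast
  qed
  then show ?thesis
    using hom_ideal_image[OF hJ] unfolding S.sat_hom_ideals_def saturated_def by blast
qed

lemma has_chain_sat_hom_ideals_surjective:
  "has_chain (S.sat_hom_ideals p) n \<longleftrightarrow> has_chain {J \<in> R.sat_hom_ideals (vim p). ker \<subseteq> J} n"
    (is "?l \<longleftrightarrow> ?r")
proof
  show ?r if ?l
  proof (rule has_chain_image[OF _ _ that, where f = vim])
    show "vim A \<in> {J \<in> R.sat_hom_ideals (vim p). ker \<subseteq> J}" if "A \<in> S.sat_hom_ideals p" for A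
      using that sat_hom_ideals_vim ker_subset_vim S.sat_hom_idealsD(1) by blast
    show "vim A \<subset> vim B" if "A \<in> S.sat_hom_ideals p" "B \<in> S.sat_hom_ideals p" "A \<subset> B" for A B
      using that vim_strict_mono[of A B] vim_strict_mono[of B A] S.sat_hom_idealsD(1) by blast
  qed
  show ?l if ?r
  proof (rule has_chain_image[OF _ _ that, where f = "(`) h"])
    show "h ` A \<in> S.sat_hom_ideals p" if "A \<in> {J \<in> R.sat_hom_ideals (vim p). ker \<subseteq> J}" for A
      using that sat_hom_ideals_image by blast
    show "h ` A \<subset> h ` B" if "A \<in> {J \<in> R.sat_hom_ideals (vim p). ker \<subseteq> J}"
      "B \<in> {J \<in> R.sat_hom_ideals (vim p). ker \<subseteq> J}" "A \<subset> B" for A B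
    proof -
      have "vim (h ` A) = A" "vim (h ` B) = B"
        using that(1,2) vim_image R.sat_hom_idealsD(1) by blast+
      then have "h ` A \<noteq> h ` B" using that(3) by (metis psubset_eq)
      then show ?thesis using that(3) by blast
    qed
  qed
qed

lemma vim_proj_points:
  assumes "p \<in> proj_points S G'"
  shows "vim p \<in> proj_points R G" "ker \<subseteq> vim p"
proof -
  have p: "primeideal p S" "S.hom_ideal p" "\<not> (\<forall>d\<ge>1. G' d \<subseteq> p)"
    using assms by (simp_all add: S.proj_points_iff)
  then obtain d y where "d \<ge> 1" "y \<in> G' d" "y \<notin> p" by blast
  then obtain x where "x \<in> G d" "y = h x" using image_G[of d] by blast
  then have "x \<in> G d" "x \<notin> vim p" using \<open>y \<notin> p\<close> by (auto simp: vim_def)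
  then have "\<not> (\<forall>d\<ge>1. G d \<subseteq> vim p)" using \<open>d \<ge> 1\<close> by blast
  then show "vim p \<in> proj_points R G"
    using primeideal_vim[OF p(1)] hom_ideal_vim[OF p(2)] by (simp add: R.proj_points_iff)
  show "ker \<subseteq> vim p" using ker_subset_vim p(1) by (simp add: S.primeideal_iff)
qed

lemma image_proj_points:
  assumes "q \<in> proj_points R G" "ker \<subseteq> q"
  shows "h ` q \<in> proj_points S G'" "vim (h ` q) = q"
proof -
  have q: "primeideal q R" "R.hom_ideal q" "\<not> (\<forall>d\<ge>1. G d \<subseteq> q)"
    using assms(1) by (simp_all add: R.proj_points_iff)
  have idq: "ideal q R" using q(1) by (simp add: R.primeideal_iff)
  show vq: "vim (h ` q) = q" by (rule vim_image[OF idq assms(2)])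
  from q(3) obtain d x where dx: "d \<ge> 1" "x \<in> G d" "x \<notin> q" by blast
  then have "h x \<notin> h ` q" using mem_image_iff[OF idq assms(2), of x] by simp
  then have "\<not> (\<forall>d\<ge>1. G' d \<subseteq> h ` q)" using dx(1,2) image_G[of d] by blast
  then show "h ` q \<in> proj_points S G'"
    using primeideal_image[OF q(1) assms(2)] hom_ideal_image[OF q(2)] by (simp add: S.proj_points_iff)
qed

text \<open>The surjection induces a closed immersion of \<open>Proj S\<close> into
  \<open>Proj R\<close>; this traces closed subsets through it.\<close>

lemma vim_image_proj_points:
  "vim ` {p \<in> proj_points S G'. p0 \<subseteq> p} = {q \<in> proj_points R G. ker \<subseteq> q \<and> vim p0 \<subseteq> q}"
  if "ideal p0 S"
proof (intro equalityI subsetI)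
  have ideal: "ideal p S" if "p \<in> proj_points S G'" for p
    using that by (simp add: S.proj_points_iff S.primeideal_iff)
  fix q
  {
    assume "q \<in> vim ` {p \<in> proj_points S G'. p0 \<subseteq> p}"
    then obtain p where p: "p \<in> proj_points S G'" "p0 \<subseteq> p" "q = vim p" by blast
    then show "q \<in> {q \<in> proj_points R G. ker \<subseteq> q \<and> vim p0 \<subseteq> q}"
      using vim_proj_points[OF p(1)] by (auto simp: vim_def)
  }
  {
    assume "q \<in> {q \<in> proj_points R G. ker \<subseteq> q \<and> vim p0 \<subseteq> q}"
    then have q: "q \<in> proj_points R G" "ker \<subseteq> q" "vim p0 \<subseteq> q" by auto
    have "p0 \<subseteq> h ` q"
      using vim_strict_mono[OF that ideal[OF image_proj_points(1)[OF q(1,2)]]] q(3)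
        image_proj_points(2)[OF q(1,2)] by simp
    then show "q \<in> vim ` {p \<in> proj_points S G'. p0 \<subseteq> p}"
      using image_proj_points[OF q(1,2)] by (intro image_eqI[of _ _ "h ` q"]) auto
  }
qed

text \<open>The condition on \<open>A0\<close> says that it generates the kernel. Chains of ideals
  in the quotient of the local ring become chains of saturated homogeneous ideals of
  \<open>R\<close> above the kernel, and these match the ones of \<open>S\<close>. Only chains are
  compared; no isomorphism of local rings is constructed.\<close>

lemma ring_length_homogeneous_localization_quotient:
  assumes p: "p \<in> proj_points S G'" and t: "t \<in> G' 1" "t \<notin> p"
    and A0: "A0 \<subseteq> G 0" "\<And>J. ideal J R \<Longrightarrow> A0 \<subseteq> J \<longleftrightarrow> ker \<subseteq> J"
  defines "HL \<equiv> homogeneous_localization R G (vim p)"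
  shows "ring_length (HL Quot (Idl\<^bsub>HL\<^esub> ((\<lambda>a. fraction R (R.hom_compl (vim p)) a \<one>) ` A0))) =
    ring_length (homogeneous_localization S G' p)"
proof -
  let ?E = "(\<lambda>a. fraction R (R.hom_compl (vim p)) a \<one>) ` A0"
  have pp: "primeideal p S" using p by (simp add: S.proj_points_iff)
  have vp: "primeideal (vim p) R" by (rule primeideal_vim[OF pp])
  obtain s where "s \<in> G 1" "t = h s" using t(1) image_G[of 1] by blast
  then have s: "s \<in> G 1" "s \<notin> vim p" using t(2) by (auto simp: vim_def)
  interpret HL: cring HL
    unfolding HL_def by (rule R.has_chain_homogeneous_localization(1)[OF vp s A0(1)])
  have E: "?E \<subseteq> carrier HL"
  proof -
    have one: "\<one> \<in> R.hom_compl (vim p)"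
      using mult_subset.one_T[OF R.mult_subset_hom_compl[OF vp]] .
    have "fraction R (R.hom_compl (vim p)) a \<one> \<in> carrier HL" if "a \<in> A0" for a
      using that A0(1) one R.one_G
      unfolding HL_def homogeneous_localization_def Let_def by auto
    then show ?thesis by auto
  qed
  have iff: "Idl\<^bsub>HL\<^esub> ?E \<subseteq> J \<longleftrightarrow> ?E \<subseteq> J" if "ideal J HL" for J
    using HL.genideal_minimal[OF that] HL.genideal_self[OF E] by blast
  have "has_chain {J. ideal J (HL Quot (Idl\<^bsub>HL\<^esub> ?E))} n \<longleftrightarrow>
      has_chain {J. ideal J (homogeneous_localization S G' p)} n" for n
  proof -
    have "has_chain {J. ideal J (HL Quot (Idl\<^bsub>HL\<^esub> ?E))} n \<longleftrightarrow>
        has_chain {J. ideal J HL \<and> Idl\<^bsub>HL\<^esub> ?E \<subseteq> J} n"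
      by (rule has_chain_quotient[OF HL.is_cring HL.genideal_ideal[OF E]])
    also have "{J. ideal J HL \<and> Idl\<^bsub>HL\<^esub> ?E \<subseteq> J} = {J. ideal J HL \<and> ?E \<subseteq> J}"
      using iff by blast
    also have "has_chain \<dots> n \<longleftrightarrow> has_chain {J \<in> R.sat_hom_ideals (vim p). A0 \<subseteq> J} n"
      unfolding HL_def by (rule R.has_chain_homogeneous_localization(2)[OF vp s A0(1)])
    also have "{J \<in> R.sat_hom_ideals (vim p). A0 \<subseteq> J} = {J \<in> R.sat_hom_ideals (vim p). ker \<subseteq> J}"
      using A0(2) R.sat_hom_idealsD(1) by blast
    also have "has_chain \<dots> n \<longleftrightarrow> has_chain (S.sat_hom_ideals p) n"
      using has_chain_sat_hom_ideals_surjective by simp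
    also have "\<dots> \<longleftrightarrow> has_chain {J. ideal J (homogeneous_localization S G' p)} n"
      using S.has_chain_homogeneous_localization(2)[OF pp t, of "{}" n] by simp
    finally show ?thesis .
  qed
  then show ?thesis unfolding ring_length_has_chain by simp
qed

end

section \<open>Rees algebra and associated graded ring\<close>

lemma add_FactRing: "x \<oplus>\<^bsub>R Quot J\<^esub> y = x <+>\<^bsub>R\<^esub> y"
  by (simp add: FactRing_def)

lemma finsum_class: "finsum (cring_class_ops :: 'a::comm_ring_1 ring) f F = sum f F"
proof (induction F rule: infinite_finite_induct)
  case (infinite F)
  then show ?case using cring_class.finsum_infinite[of F f] by simp
next
  case empty
  then show ?case using cring_class.finsum_empty[of f] by simp
next
  case (insert x F)
  then show ?case
    using cring_class.finsum_insert[of F x f] by (simp add: carrier_class)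
qed

lemma ring_class: "ring cring_class_ops"
  using cring.axioms(1)[OF cring_class] .

lemma ideal_class_iff:
  "ideal J (cring_class_ops :: 'a::comm_ring_1 ring) \<longleftrightarrow>
    0 \<in> J \<and> (\<forall>x\<in>J. \<forall>y\<in>J. x + y \<in> J) \<and> (\<forall>r. \<forall>x\<in>J. r * x \<in> J)"
  unfolding cring_class.ideal_iff by (auto simp: cring_class_ops_def)

text \<open>In a type-class ring the carrier is the whole type, so membership conditions for
  \<open>R\<close> disappear; the polynomial ring is an instance.\<close>

locale class_ideal =
  fixes I :: "'a::comm_ring_1 set"
  assumes ideal_I: "ideal I cring_class_ops"
begin

abbreviation R where "R \<equiv> cring_class_ops :: 'a ring"
abbreviation Pow where "Pow \<equiv> ideal_pow R I"
abbreviation Rees where "Rees \<equiv> rees_algebra R I"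
abbreviation Gr where "Gr \<equiv> assoc_graded R I"
abbreviation \<pi> where "\<pi> \<equiv> rees_to_graded R I"

lemma ideal_Pow: "ideal (Pow d) R"
proof (induction d)
  case 0
  then show ?case using ring.oneideal[OF ring_class] by simp
next
  case (Suc d)
  then show ?case using ring.ideal_prod_is_ideal[OF ring_class ideal_I] by simp
qed

lemma Pow_0: "Pow 0 = UNIV"
  by (simp add: cring_class_ops_def)

lemma Pow_zero: "0 \<in> Pow d"
  and Pow_add: "x \<in> Pow d \<Longrightarrow> y \<in> Pow d \<Longrightarrow> x + y \<in> Pow d"
  and Pow_mult_left: "x \<in> Pow d \<Longrightarrow> r * x \<in> Pow d"
  using ideal_Pow[of d] unfolding ideal_class_iff by auto

lemma Pow_uminus: "x \<in> Pow d \<Longrightarrow> - x \<in> Pow d"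
  using Pow_mult_left[of x d "- 1"] by simp

lemma Pow_diff: "x \<in> Pow d \<Longrightarrow> y \<in> Pow d \<Longrightarrow> x - y \<in> Pow d"
  using Pow_add[OF _ Pow_uminus] by simp

lemma Pow_sum: "(\<And>i. i \<in> F \<Longrightarrow> f i \<in> Pow d) \<Longrightarrow> sum f F \<in> Pow d"
  by (induction F rule: infinite_finite_induct) (auto intro: Pow_zero Pow_add)

text \<open>Facts about powers of \<open>I\<close> are thereby checked on products i j with i in
  \<open>I\<close> and j one power lower, in place of explicit finite sums.\<close>

lemma Pow_Suc_induct [consumes 1, case_names prod sum]:
  assumes "x \<in> Pow (Suc d)"
    and "\<And>i j. i \<in> I \<Longrightarrow> j \<in> Pow d \<Longrightarrow> P (i * j)"
    and "\<And>x y. x \<in> Pow (Suc d) \<Longrightarrow> y \<in> Pow (Suc d) \<Longrightarrow> P x \<Longrightarrow> P y \<Longrightarrow> P (x + y)"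
  shows "P x"
proof -
  have "x \<in> I \<cdot>\<^bsub>R\<^esub> Pow d" using assms(1) by simp
  then show ?thesis
  proof (induction x rule: ideal_prod.induct)
    case (prod i j)
    then show ?case using assms(2) by (simp add: times_class)
  next
    case (sum x y)
    then show ?case using assms(3)[of x y] by (simp add: plus_class)
  qed
qed

lemma Pow_Suc_mult: "i \<in> I \<Longrightarrow> j \<in> Pow d \<Longrightarrow> i * j \<in> Pow (Suc d)"
  using ideal_prod.prod[of i I j "Pow d" R] by (simp add: times_class)

lemma I_Pow_1: "i \<in> I \<Longrightarrow> i \<in> Pow (Suc 0)"
  using Pow_Suc_mult[of i 1 0] Pow_0 by simp

lemma Pow_mult: "x \<in> Pow d \<Longrightarrow> y \<in> Pow e \<Longrightarrow> x * y \<in> Pow (d + e)"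
proof (induction d arbitrary: x)
  case 0
  then show ?case using Pow_mult_left by simp
next
  case (Suc d)
  from Suc.prems(1) show ?case
  proof (induction x rule: Pow_Suc_induct)
    case (prod i j)
    then have "i * (j * y) \<in> Pow (Suc (d + e))"
      using Suc.IH[OF prod(2) Suc.prems(2)] by (intro Pow_Suc_mult)
    then show ?case by (simp only: mult.assoc add_Suc)
  next
    case (sum x z)
    then show ?case using Pow_add by (simp add: distrib_right del: ideal_pow.simps)
  qed
qed

lemma Pow_Suc_subset: "x \<in> Pow (Suc d) \<Longrightarrow> x \<in> Pow d"
  by (induction x rule: Pow_Suc_induct) (auto intro: Pow_add Pow_mult_left)

lemma Rees_carrier: "f \<in> carrier Rees \<longleftrightarrow> (\<forall>d. f d \<in> Pow d) \<and> finite {d. f d \<noteq> 0}"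
  by (simp add: rees_algebra_def zero_class)

lemma Rees_simps:
  "f \<otimes>\<^bsub>Rees\<^esub> g = (\<lambda>d. \<Sum>i\<le>d. f i * g (d - i))"
  "f \<oplus>\<^bsub>Rees\<^esub> g = (\<lambda>d. f d + g d)"
  "\<zero>\<^bsub>Rees\<^esub> = (\<lambda>d. 0)"
  "\<one>\<^bsub>Rees\<^esub> = (\<lambda>d. if d = 0 then 1 else 0)"
  by (simp_all add: rees_algebra_def finsum_class zero_class one_class plus_class times_class
      cong: if_cong)

lemma Rees_mult_coeff: "coeff p \<otimes>\<^bsub>Rees\<^esub> coeff q = coeff (p * q)"
  by (simp add: Rees_simps coeff_mult fun_eq_iff)

text \<open>The Rees algebra is the subring of the one-variable polynomials whose coefficient in
  degree \<open>d\<close> lies in \<open>I ^ d\<close>.\<close>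

lemma cring_Rees: "cring Rees"
proof -
  let ?P = "cring_class_ops :: 'a poly ring"
  let ?W = "{p :: 'a poly. \<forall>d. coeff p d \<in> Pow d}"
  have "subring ?W ?P"
  proof (rule ring.subringI[OF ring_class], unfold class_simps)
    show "?W \<subseteq> carrier ?P" by (simp add: cring_class_ops_def)
    show "1 \<in> ?W" using Pow_0 Pow_zero by (auto simp: coeff_1 simp del: ideal_pow.simps)
    show "- p \<in> ?W" if "p \<in> ?W" for p using that Pow_uminus by (simp del: ideal_pow.simps)
    show "p + q \<in> ?W" if "p \<in> ?W" "q \<in> ?W" for p q using that Pow_add by (simp del: ideal_pow.simps)
    show "p * q \<in> ?W" if "p \<in> ?W" "q \<in> ?W" for p q
    proof -
      have "coeff p i * coeff q (d - i) \<in> Pow d" if "i \<le> d" for i d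
        using Pow_mult[of "coeff p i" i "coeff q (d - i)" "d - i"] \<open>p \<in> ?W\<close> \<open>q \<in> ?W\<close> that by simp
      then show ?thesis by (auto simp: coeff_mult intro!: Pow_sum)
    qed
  qed
  then have "cring (?P\<lparr>carrier := ?W\<rparr>)"
    using cring.subcringI'[OF cring_class] ring.subcring_iff[OF ring_class, of ?W] subringE(1) by blast
  then show ?thesis
  proof (rule cring_surj_image)
    show "coeff \<in> ring_hom (?P\<lparr>carrier := ?W\<rparr>) Rees"
    proof (rule ring_hom_memI)
      fix p q assume "p \<in> carrier (?P\<lparr>carrier := ?W\<rparr>)" "q \<in> carrier (?P\<lparr>carrier := ?W\<rparr>)"
      then show "coeff p \<in> carrier Rees"
        by (auto simp: Rees_carrier eventually_cofinite[symmetric] MOST_coeff_eq_0)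
      show "coeff (p \<otimes>\<^bsub>?P\<lparr>carrier := ?W\<rparr>\<^esub> q) = coeff p \<otimes>\<^bsub>Rees\<^esub> coeff q"
        by (simp add: Rees_mult_coeff times_class)
      show "coeff (p \<oplus>\<^bsub>?P\<lparr>carrier := ?W\<rparr>\<^esub> q) = coeff p \<oplus>\<^bsub>Rees\<^esub> coeff q"
        by (simp add: Rees_simps plus_class fun_eq_iff)
    next
      show "coeff \<one>\<^bsub>?P\<lparr>carrier := ?W\<rparr>\<^esub> = \<one>\<^bsub>Rees\<^esub>"
        by (simp add: Rees_simps one_class fun_eq_iff coeff_1)
    qed
    show "coeff ` carrier (?P\<lparr>carrier := ?W\<rparr>) = carrier Rees"
    proof (intro equalityI subsetI)
      fix f assume "f \<in> coeff ` carrier (?P\<lparr>carrier := ?W\<rparr>)"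
      then show "f \<in> carrier Rees"
        by (auto simp: Rees_carrier eventually_cofinite[symmetric] MOST_coeff_eq_0)
    next
      fix f assume f: "f \<in> carrier Rees"
      then have "coeff (Abs_poly f) = f"
        by (intro Abs_poly_inverse) (simp add: Rees_carrier eventually_cofinite)
      moreover have "Abs_poly f \<in> ?W" using f calculation by (simp add: Rees_carrier)
      ultimately show "f \<in> coeff ` carrier (?P\<lparr>carrier := ?W\<rparr>)"
        by (intro image_eqI[of _ _ "Abs_poly f"]) auto
    qed
    show "coeff \<zero>\<^bsub>?P\<lparr>carrier := ?W\<rparr>\<^esub> = \<zero>\<^bsub>Rees\<^esub>"
      by (simp add: Rees_simps zero_class fun_eq_iff)
  qed
qed

definition rees_component :: "nat \<Rightarrow> (nat \<Rightarrow> 'a) \<Rightarrow> nat \<Rightarrow> 'a"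
  where "rees_component d f = (\<lambda>e. if e = d then f d else 0)"

lemma rees_piece_iff: "f \<in> rees_piece R I d \<longleftrightarrow> f d \<in> Pow d \<and> (\<forall>e. e \<noteq> d \<longrightarrow> f e = 0)"
proof
  assume *: "f d \<in> Pow d \<and> (\<forall>e. e \<noteq> d \<longrightarrow> f e = 0)"
  then have "{e. f e \<noteq> 0} \<subseteq> {d}" by auto
  then have "finite {e. f e \<noteq> 0}" using finite_subset by blast
  moreover have "f e \<in> Pow e" for e using * Pow_zero by (cases "e = d") auto
  ultimately show "f \<in> rees_piece R I d" using * by (simp add: rees_piece_def Rees_carrier zero_class)
qed (auto simp: rees_piece_def Rees_carrier zero_class)

lemma graded_Rees: "graded_cring Rees (rees_piece R I) rees_component"
proof -
  interpret cring Rees by (rule cring_Rees)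
  show ?thesis
  proof unfold_locales
    show "rees_piece R I d \<subseteq> carrier Rees" for d by (auto simp: rees_piece_def)
    show "rees_component d f \<in> rees_piece R I d" if "f \<in> carrier Rees" for f d
      using that by (simp add: rees_piece_iff rees_component_def Rees_carrier)
    show "rees_component d (f \<oplus>\<^bsub>Rees\<^esub> g) = rees_component d f \<oplus>\<^bsub>Rees\<^esub> rees_component d g" for f g d
      by (auto simp: rees_component_def Rees_simps)
    show "rees_component e f = (if e = d then f else \<zero>\<^bsub>Rees\<^esub>)" if "f \<in> rees_piece R I d" for f d e
      using that by (auto simp: rees_piece_iff rees_component_def Rees_simps)
    show "\<exists>n. \<forall>d\<ge>n. rees_component d f = \<zero>\<^bsub>Rees\<^esub>" if f: "f \<in> carrier Rees" for f
    proof -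
      have "finite {d. f d \<noteq> 0}" using f by (simp add: Rees_carrier)
      then obtain n where "\<forall>d\<in>{d. f d \<noteq> 0}. d < n" using finite_nat_set_iff_bounded by blast
      then have "\<forall>d\<ge>n. rees_component d f = \<zero>\<^bsub>Rees\<^esub>"
        by (force simp: rees_component_def Rees_simps)
      then show ?thesis by blast
    qed
    show "f = \<zero>\<^bsub>Rees\<^esub>" if f: "\<And>d. rees_component d f = \<zero>\<^bsub>Rees\<^esub>" for f
    proof
      show "f d = \<zero>\<^bsub>Rees\<^esub> d" for d
        using fun_cong[OF f[of d], of d] by (simp add: rees_component_def)
    qed
    show "f \<otimes>\<^bsub>Rees\<^esub> g \<in> rees_piece R I (d + e)"
      if f: "f \<in> rees_piece R I d" and g: "g \<in> rees_piece R I e" for f g d e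
    proof -
      have fg: "f \<otimes>\<^bsub>Rees\<^esub> g \<in> carrier Rees"
        using f g by (intro m_closed) (auto simp: rees_piece_def)
      have "(\<Sum>i\<le>k. f i * g (k - i)) = 0" if k: "k \<noteq> d + e" for k
      proof (rule sum.neutral, rule ballI)
        fix i assume "i \<in> {..k}"
        then consider "i \<noteq> d" | "k - i \<noteq> e" using k by force
        then show "f i * g (k - i) = 0"
          using f g unfolding rees_piece_iff by cases simp_all
      qed
      then show ?thesis using fg by (simp add: rees_piece_def Rees_simps zero_class)
    qed
    show "\<one>\<^bsub>Rees\<^esub> \<in> rees_piece R I 0"
      using Pow_0 by (simp add: rees_piece_iff Rees_simps)
  qed
qed

definition mono :: "nat \<Rightarrow> 'a \<Rightarrow> nat \<Rightarrow> 'a"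
  where "mono d a = (\<lambda>e. if e = d then a else 0)"

lemma mono_coeff: "mono d a = coeff (monom a d)"
  by (auto simp: mono_def)

lemma mono_mult: "mono d a \<otimes>\<^bsub>Rees\<^esub> mono e b = mono (d + e) (a * b)"
  unfolding mono_coeff Rees_mult_coeff by (simp add: mult_monom)

lemma mono_add: "mono d a \<oplus>\<^bsub>Rees\<^esub> mono d b = mono d (a + b)"
  by (auto simp: mono_def Rees_simps)

lemma mono_mem: "a \<in> Pow d \<Longrightarrow> mono d a \<in> rees_piece R I d"
  by (simp add: rees_piece_iff mono_def)

lemma mono_carrier: "a \<in> Pow d \<Longrightarrow> mono d a \<in> carrier Rees"
  using mono_mem by (auto simp: rees_piece_def)

lemma rees_component_mono: "rees_component d f = mono d (f d)"
  by (simp add: rees_component_def mono_def)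

lemma rees_piece_mono: "f \<in> rees_piece R I d \<Longrightarrow> f = mono d (f d)"
  by (auto simp: rees_piece_iff mono_def)

lemma rees_const_mono: "rees_const R a = mono 0 a"
  by (simp add: rees_const_def mono_def zero_class cong: if_cong)

text \<open>An element of I^(e+1), placed in degree e+1, is a sum of products of an element of
  \<open>I\<close> in degree one with an element of I^e in degree e. So the Rees algebra is
  generated in degree one over its degree zero part.\<close>

lemma rees_generated_degree_one:
  assumes q: "ideal q Rees" and sub: "rees_piece R I 1 \<subseteq> q"
  shows "d \<ge> 1 \<Longrightarrow> rees_piece R I d \<subseteq> q"
proof
  interpret q: ideal q Rees by fact
  fix f assume d: "d \<ge> 1" and f: "f \<in> rees_piece R I d"
  then obtain e where e: "d = Suc e" using not0_implies_Suc[of d] by auto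
  have "mono (Suc e) a \<in> q" if "a \<in> Pow (Suc e)" for a
    using that
  proof (induction a rule: Pow_Suc_induct)
    case (prod i j)
    have "mono 1 i \<in> q" using mono_mem[of i 1] I_Pow_1[OF prod(1)] sub by auto
    then have "mono 1 i \<otimes>\<^bsub>Rees\<^esub> mono e j \<in> q" using mono_carrier[OF prod(2)] by (rule q.I_r_closed)
    then show ?case by (simp add: mono_mult)
  next
    case (sum x y)
    then show ?case using q.a_closed by (simp add: mono_add[symmetric])
  qed
  moreover have "f d \<in> Pow (Suc e)" using f e unfolding rees_piece_iff by blast
  ultimately show "f \<in> q" using rees_piece_mono[OF f] e by metis
qed

lemma coset_def': "Pow k +>\<^bsub>R\<^esub> a = {x. x - a \<in> Pow k}"
proof -
  have "x = (x - a) + a" for x by simp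
  then show ?thesis by (force simp: a_r_coset_def' plus_class)
qed

lemma coset_eq_iff: "Pow k +>\<^bsub>R\<^esub> a = Pow k +>\<^bsub>R\<^esub> b \<longleftrightarrow> a - b \<in> Pow k"
proof
  assume "Pow k +>\<^bsub>R\<^esub> a = Pow k +>\<^bsub>R\<^esub> b"
  moreover have "a \<in> Pow k +>\<^bsub>R\<^esub> a" using Pow_zero by (simp add: coset_def')
  ultimately show "a - b \<in> Pow k" by (simp add: coset_def')
next
  assume ab: "a - b \<in> Pow k"
  have "x - a \<in> Pow k \<longleftrightarrow> x - b \<in> Pow k" for x
    using Pow_add[OF _ ab, of "x - a"] Pow_diff[OF _ ab, of "x - b"] by auto
  then show "Pow k +>\<^bsub>R\<^esub> a = Pow k +>\<^bsub>R\<^esub> b" by (simp add: coset_def')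
qed

lemma coset_zero: "Pow k +>\<^bsub>R\<^esub> 0 = Pow k"
  by (simp add: coset_def')

lemma coset_eq_Pow_iff: "Pow k +>\<^bsub>R\<^esub> a = Pow k \<longleftrightarrow> a \<in> Pow k"
  using coset_eq_iff[of k a 0] by (simp add: coset_zero)

text \<open>Three moduli occur. The product is well defined because a b - x y = (a - x) b + x (b -
  y), and both summands lie in I^(i+j+1).\<close>

lemma rcoset_mult_coset:
  assumes "x \<in> Pow i" "y \<in> Pow j"
  shows "rcoset_mult R (Pow (Suc (i + j))) (Pow (Suc i) +>\<^bsub>R\<^esub> x) (Pow (Suc j) +>\<^bsub>R\<^esub> y) =
    Pow (Suc (i + j)) +>\<^bsub>R\<^esub> (x * y)"
proof -
  have "Pow (Suc (i + j)) +>\<^bsub>R\<^esub> (a * b) = Pow (Suc (i + j)) +>\<^bsub>R\<^esub> (x * y)"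
    if "a \<in> Pow (Suc i) +>\<^bsub>R\<^esub> x" "b \<in> Pow (Suc j) +>\<^bsub>R\<^esub> y" for a b
  proof -
    have ab: "a - x \<in> Pow (Suc i)" "b - y \<in> Pow (Suc j)" using that by (simp_all only: coset_def' mem_Collect_eq)
    have b: "b \<in> Pow j" using Pow_add[OF Pow_Suc_subset[OF ab(2)] assms(2)] by simp
    have "(a - x) * b \<in> Pow (Suc (i + j))" using Pow_mult[OF ab(1) b] by (simp only: add_Suc)
    moreover have "x * (b - y) \<in> Pow (Suc (i + j))" using Pow_mult[OF assms(1) ab(2)] by (simp only: add_Suc_right)
    moreover have "a * b - x * y = (a - x) * b + x * (b - y)" by (simp add: algebra_simps)
    ultimately show ?thesis unfolding coset_eq_iff using Pow_add by (simp only:)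
  qed
  moreover have "x \<in> Pow (Suc i) +>\<^bsub>R\<^esub> x" "y \<in> Pow (Suc j) +>\<^bsub>R\<^esub> y"
    using Pow_zero by (simp_all add: coset_def' del: ideal_pow.simps)
  ultimately show ?thesis
    unfolding rcoset_mult_def times_class by blast
qed

lemma finsum_coset:
  "finsum (R Quot Pow k) (\<lambda>i. Pow k +>\<^bsub>R\<^esub> f i) F = Pow k +>\<^bsub>R\<^esub> sum f F"
proof -
  interpret ring_hom_cring R "R Quot Pow k" "(+>\<^bsub>R\<^esub>) (Pow k)"
    by (rule ideal.rcos_ring_hom_cring[OF ideal_Pow cring_class])
  show ?thesis
    using hom_finsum[of f F] by (simp add: finsum_class carrier_class comp_def)
qed

lemma add_coset: "(Pow k +>\<^bsub>R\<^esub> a) <+>\<^bsub>R\<^esub> (Pow k +>\<^bsub>R\<^esub> b) = Pow k +>\<^bsub>R\<^esub> (a + b)"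
proof -
  interpret ring_hom_cring R "R Quot Pow k" "(+>\<^bsub>R\<^esub>) (Pow k)"
    by (rule ideal.rcos_ring_hom_cring[OF ideal_Pow cring_class])
  have "Pow k +>\<^bsub>R\<^esub> (a \<oplus>\<^bsub>R\<^esub> b) = (Pow k +>\<^bsub>R\<^esub> a) \<oplus>\<^bsub>R Quot Pow k\<^esub> (Pow k +>\<^bsub>R\<^esub> b)"
    by (rule hom_add) (simp_all add: carrier_class)
  then show ?thesis by (simp only: add_FactRing plus_class)
qed

lemma Gr_simps:
  "\<zero>\<^bsub>Gr\<^esub> = (\<lambda>d. Pow (Suc d))"
  "x \<oplus>\<^bsub>Gr\<^esub> y = (\<lambda>d. x d <+>\<^bsub>R\<^esub> y d)"
  "x \<otimes>\<^bsub>Gr\<^esub> y = (\<lambda>d. finsum (R Quot Pow (Suc d))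
     (\<lambda>i. rcoset_mult R (Pow (Suc d)) (x i) (y (d - i))) {..d})"
  "\<one>\<^bsub>Gr\<^esub> = (\<lambda>d. if d = 0 then Pow 1 +>\<^bsub>R\<^esub> 1 else Pow (Suc d))"
  by (simp_all add: assoc_graded_def one_class cong: if_cong del: ideal_pow.simps)

lemma Gr_carrier: "x \<in> carrier Gr \<longleftrightarrow>
    (\<forall>d. \<exists>a\<in>Pow d. x d = Pow (Suc d) +>\<^bsub>R\<^esub> a) \<and> finite {d. x d \<noteq> Pow (Suc d)}"
  by (simp add: assoc_graded_def)

lemma \<pi>_apply: "\<pi> f d = Pow (Suc d) +>\<^bsub>R\<^esub> f d"
  by (simp add: rees_to_graded_def)

lemma \<pi>_closed: "f \<in> carrier Rees \<Longrightarrow> \<pi> f \<in> carrier Gr"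
proof -
  assume f: "f \<in> carrier Rees"
  have "{d. \<pi> f d \<noteq> Pow (Suc d)} \<subseteq> {d. f d \<noteq> 0}"
    using coset_zero by (auto simp: \<pi>_apply simp del: ideal_pow.simps)
  then have "finite {d. \<pi> f d \<noteq> Pow (Suc d)}"
    using f finite_subset by (auto simp: Rees_carrier simp del: ideal_pow.simps)
  then show ?thesis using f by (auto simp: Gr_carrier Rees_carrier \<pi>_apply simp del: ideal_pow.simps)
qed

lemma \<pi>_surj: "\<pi> ` carrier Rees = carrier Gr"
proof (intro equalityI subsetI)
  fix x assume "x \<in> carrier Gr"
  then have x: "\<forall>d. \<exists>a. a \<in> Pow d \<and> x d = Pow (Suc d) +>\<^bsub>R\<^esub> a" "finite {d. x d \<noteq> Pow (Suc d)}"
    unfolding Gr_carrier by blast+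
  from x(1) obtain a where a: "\<And>d. a d \<in> Pow d" "\<And>d. x d = Pow (Suc d) +>\<^bsub>R\<^esub> a d" by metis
  \<comment> \<open>Representing each zero coset by 0 keeps the lifted family finitely
    supported.\<close>
  define f where "f d = (if x d = Pow (Suc d) then 0 else a d)" for d
  have "finite {d. f d \<noteq> 0}"
    by (rule finite_subset[OF _ x(2)]) (auto simp: f_def simp del: ideal_pow.simps)
  moreover have "f d \<in> Pow d" for d using a(1) Pow_zero by (simp add: f_def)
  ultimately have "f \<in> carrier Rees" by (simp add: Rees_carrier)
  moreover have "\<pi> f = x"
  proof
    show "\<pi> f d = x d" for d
      unfolding \<pi>_apply f_def using a(2)[of d] coset_zero by (simp del: ideal_pow.simps)
  qed
  ultimately show "x \<in> \<pi> ` carrier Rees" by blast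
qed (use \<pi>_closed in blast)

lemma \<pi>_hom: "\<pi> \<in> ring_hom Rees Gr"
proof (rule ring_hom_memI)
  fix f g assume f: "f \<in> carrier Rees" and g: "g \<in> carrier Rees"
  show "\<pi> f \<in> carrier Gr" by (rule \<pi>_closed[OF f])
  show "\<pi> (f \<oplus>\<^bsub>Rees\<^esub> g) = \<pi> f \<oplus>\<^bsub>Gr\<^esub> \<pi> g"
    unfolding Gr_simps \<pi>_apply[abs_def] Rees_simps add_coset ..
  have cos: "rcoset_mult R (Pow (Suc d)) (\<pi> f i) (\<pi> g (d - i)) = Pow (Suc d) +>\<^bsub>R\<^esub> (f i * g (d - i))"
    if "i \<in> {..d}" for i d
    using rcoset_mult_coset[of "f i" i "g (d - i)" "d - i"] f g that
    unfolding \<pi>_apply Rees_carrier by (simp del: ideal_pow.simps)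
  show "\<pi> (f \<otimes>\<^bsub>Rees\<^esub> g) = \<pi> f \<otimes>\<^bsub>Gr\<^esub> \<pi> g"
  proof
    fix d
    interpret Q: cring "R Quot Pow (Suc d)"
      using ideal.quotient_is_cring[OF ideal_Pow cring_class] .
    have "Pow (Suc d) +>\<^bsub>R\<^esub> a \<in> carrier (R Quot Pow (Suc d))" for a
      using ring_hom_closed[OF ideal.rcos_ring_hom[OF ideal_Pow]] carrier_class by blast
    then have "finsum (R Quot Pow (Suc d)) (\<lambda>i. rcoset_mult R (Pow (Suc d)) (\<pi> f i) (\<pi> g (d - i))) {..d} =
        finsum (R Quot Pow (Suc d)) (\<lambda>i. Pow (Suc d) +>\<^bsub>R\<^esub> (f i * g (d - i))) {..d}"
      by (intro Q.finsum_cong') (simp_all add: cos del: ideal_pow.simps)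
    moreover have "\<pi> (f \<otimes>\<^bsub>Rees\<^esub> g) d = Pow (Suc d) +>\<^bsub>R\<^esub> (\<Sum>i\<le>d. f i * g (d - i))"
      by (simp only: \<pi>_apply Rees_simps)
    ultimately show "\<pi> (f \<otimes>\<^bsub>Rees\<^esub> g) d = (\<pi> f \<otimes>\<^bsub>Gr\<^esub> \<pi> g) d"
      by (simp only: Gr_simps finsum_coset)
  qed
next
  show "\<pi> \<one>\<^bsub>Rees\<^esub> = \<one>\<^bsub>Gr\<^esub>"
    by (auto simp: fun_eq_iff \<pi>_apply Gr_simps Rees_simps coset_zero simp del: ideal_pow.simps)
qed

lemma \<pi>_zero: "\<pi> \<zero>\<^bsub>Rees\<^esub> = \<zero>\<^bsub>Gr\<^esub>"
  by (auto simp: fun_eq_iff \<pi>_apply Gr_simps Rees_simps coset_zero simp del: ideal_pow.simps)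

lemma cring_Gr: "cring Gr"
  by (rule cring_surj_image[where A = Rees and h = \<pi> and B = Gr, OF cring_Rees \<pi>_hom \<pi>_surj \<pi>_zero])

definition gr_component :: "nat \<Rightarrow> (nat \<Rightarrow> 'a set) \<Rightarrow> nat \<Rightarrow> 'a set"
  where "gr_component d x = (\<lambda>e. if e = d then x d else Pow (Suc e))"

lemma \<pi>_component: "\<pi> (rees_component d f) = gr_component d (\<pi> f)"
  by (auto simp: fun_eq_iff \<pi>_apply gr_component_def rees_component_def coset_zero simp del: ideal_pow.simps)

lemma gr_component_mem: "x \<in> carrier Gr \<Longrightarrow> gr_component d x \<in> assoc_graded_piece R I d"
proof -
  assume "x \<in> carrier Gr"
  then obtain f where f: "f \<in> carrier Rees" "x = \<pi> f" using \<pi>_surj by blast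
  have "rees_component d f \<in> carrier Rees"
    using graded_cring.c_closed[OF graded_Rees f(1)] .
  then have "gr_component d x \<in> carrier Gr" unfolding f(2) \<pi>_component[symmetric] by (rule \<pi>_closed)
  then show ?thesis by (simp add: assoc_graded_piece_def gr_component_def)
qed

lemma gr_piece_component: "x \<in> assoc_graded_piece R I d \<Longrightarrow> gr_component d x = x"
  by (auto simp: assoc_graded_piece_def gr_component_def fun_eq_iff simp del: ideal_pow.simps)

lemma \<pi>_piece: "\<pi> ` rees_piece R I d = assoc_graded_piece R I d"
proof -
  interpret A: graded_cring Rees "rees_piece R I" rees_component by (rule graded_Rees)
  show ?thesis
  proof (intro equalityI subsetI)
    fix x assume "x \<in> \<pi> ` rees_piece R I d"
    then obtain f where f: "f \<in> rees_piece R I d" "x = \<pi> f" by blast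
    have "x = gr_component d (\<pi> f)"
      unfolding f(2) \<pi>_component[symmetric] using A.c_homogeneous[OF f(1), of d] by simp
    then show "x \<in> assoc_graded_piece R I d"
      using gr_component_mem[OF \<pi>_closed] f(1) by simp
  next
    fix x assume x: "x \<in> assoc_graded_piece R I d"
    then have "x \<in> carrier Gr" by (simp add: assoc_graded_piece_def)
    then obtain f where f: "f \<in> carrier Rees" "x = \<pi> f" using \<pi>_surj by blast
    have "x = \<pi> (rees_component d f)"
      unfolding \<pi>_component using gr_piece_component[OF x] f(2) by simp
    then show "x \<in> \<pi> ` rees_piece R I d" using A.c_G[OF f(1)] by blast
  qed
qed

lemma graded_Gr: "graded_cring Gr (assoc_graded_piece R I) gr_component"
proof -
  interpret A: graded_cring Rees "rees_piece R I" rees_component by (rule graded_Rees)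
  interpret cring Gr by (rule cring_Gr)
  show ?thesis
  proof unfold_locales
    show "assoc_graded_piece R I d \<subseteq> carrier Gr" for d by (auto simp: assoc_graded_piece_def)
    show "gr_component d x \<in> assoc_graded_piece R I d" if "x \<in> carrier Gr" for x d
      by (rule gr_component_mem[OF that])
    show "gr_component d (x \<oplus>\<^bsub>Gr\<^esub> y) = gr_component d x \<oplus>\<^bsub>Gr\<^esub> gr_component d y" for x y d
      using add_coset[of _ 0 0] coset_zero
      by (auto simp: gr_component_def Gr_simps fun_eq_iff simp del: ideal_pow.simps)
    show "gr_component e x = (if e = d then x else \<zero>\<^bsub>Gr\<^esub>)" if "x \<in> assoc_graded_piece R I d" for x d e
    proof (cases "e = d")
      case True
      then show ?thesis using gr_piece_component[OF that] by simp
    next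
      case False
      then have "x e = Pow (Suc e)" using that unfolding assoc_graded_piece_def by blast
      then show ?thesis
        using False by (auto simp: gr_component_def Gr_simps fun_eq_iff simp del: ideal_pow.simps)
    qed
    show "\<exists>n. \<forall>d\<ge>n. gr_component d x = \<zero>\<^bsub>Gr\<^esub>" if x: "x \<in> carrier Gr" for x
    proof -
      have "finite {d. x d \<noteq> Pow (Suc d)}" using x unfolding Gr_carrier by blast
      then obtain n where n: "\<forall>d\<in>{d. x d \<noteq> Pow (Suc d)}. d < n"
        using finite_nat_set_iff_bounded by blast
      have "gr_component d x = \<zero>\<^bsub>Gr\<^esub>" if "d \<ge> n" for d
      proof -
        have "x d = Pow (Suc d)" using n that by (metis (mono_tags) mem_Collect_eq not_less)
        then show ?thesis by (auto simp: gr_component_def Gr_simps fun_eq_iff simp del: ideal_pow.simps)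
      qed
      then show ?thesis by blast
    qed
    show "x = \<zero>\<^bsub>Gr\<^esub>" if x: "\<And>d. gr_component d x = \<zero>\<^bsub>Gr\<^esub>" for x
    proof
      show "x d = \<zero>\<^bsub>Gr\<^esub> d" for d
        using fun_cong[OF x[of d], of d] by (simp add: gr_component_def)
    qed
    show "x \<otimes>\<^bsub>Gr\<^esub> y \<in> assoc_graded_piece R I (d + e)"
      if xy: "x \<in> assoc_graded_piece R I d" "y \<in> assoc_graded_piece R I e" for x y d e
    proof -
      obtain f g where fg: "f \<in> rees_piece R I d" "x = \<pi> f" "g \<in> rees_piece R I e" "y = \<pi> g"
        using xy unfolding \<pi>_piece[symmetric] by blast
      have "x \<otimes>\<^bsub>Gr\<^esub> y = \<pi> (f \<otimes>\<^bsub>Rees\<^esub> g)"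
        unfolding fg(2,4) using fg(1,3) by (simp add: ring_hom_mult[OF \<pi>_hom])
      then show ?thesis unfolding \<pi>_piece[symmetric] using A.mult_G[OF fg(1,3)] by blast
    qed
    show "\<one>\<^bsub>Gr\<^esub> \<in> assoc_graded_piece R I 0"
      unfolding \<pi>_piece[symmetric] ring_hom_one[OF \<pi>_hom, symmetric] using A.one_G by blast
  qed
qed

lemma graded_surjection_\<pi>:
  "graded_surjection Rees Gr \<pi> (rees_piece R I) rees_component (assoc_graded_piece R I) gr_component"
proof -
  interpret A: graded_cring Rees "rees_piece R I" rees_component by (rule graded_Rees)
  interpret B: graded_cring Gr "assoc_graded_piece R I" gr_component by (rule graded_Gr)
  show ?thesis
    by unfold_locales (use \<pi>_hom \<pi>_surj \<pi>_piece \<pi>_component in auto)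
qed

end

sublocale class_ideal \<subseteq> gr: graded_surjection Rees Gr \<pi> "rees_piece R I" rees_component
    "assoc_graded_piece R I" gr_component
  by (rule graded_surjection_\<pi>)

context class_ideal
begin

lemma ker_\<pi>: "gr.ker = {f \<in> carrier Rees. \<forall>d. f d \<in> Pow (Suc d)}"
  unfolding gr.ker_def Gr_simps by (simp add: fun_eq_iff \<pi>_apply coset_eq_Pow_iff del: ideal_pow.simps)

text \<open>In degree d the kernel is I^(d+1) = I I^d, so it is generated by \<open>I\<close> placed
  in degree zero. This is why the projective cone and the preimage of V(I) in the blowup coincide,
  and it makes \<open>I\<close> in degree zero an admissible choice for \<open>A0\<close>.\<close>

lemma rees_const_subset_iff:
  assumes "ideal J Rees"
  shows "rees_const R ` I \<subseteq> J \<longleftrightarrow> gr.ker \<subseteq> J"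
proof
  interpret J: ideal J Rees by fact
  assume sub: "rees_const R ` I \<subseteq> J"
  have mono: "mono d a \<in> J" if "a \<in> Pow (Suc d)" for d a
    using that
  proof (induction a rule: Pow_Suc_induct)
    case (prod i j)
    have "mono 0 i \<otimes>\<^bsub>Rees\<^esub> mono d j \<in> J"
      using sub prod mono_carrier by (intro J.I_r_closed) (auto simp: rees_const_mono)
    then show ?case by (simp add: mono_mult)
  next
    case (sum x y)
    then show ?case using J.a_closed by (simp add: mono_add[symmetric])
  qed
  show "gr.ker \<subseteq> J"
  proof
    fix f assume f: "f \<in> gr.ker"
    show "f \<in> J"
    proof (rule gr.R.ideal_components[OF assms])
      show "f \<in> carrier Rees" using f by (simp add: ker_\<pi>)
      show "rees_component d f \<in> J" for d
        unfolding rees_component_mono using f ker_\<pi> by (intro mono) blast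
    qed
  qed
next
  assume sub: "gr.ker \<subseteq> J"
  have "rees_const R a \<in> gr.ker" if "a \<in> I" for a
    unfolding ker_\<pi> rees_const_mono using that mono_carrier[of a 0] I_Pow_1 Pow_0 Pow_zero
    by (auto simp: mono_def simp del: ideal_pow.simps)
  then show "rees_const R ` I \<subseteq> J" using sub by blast
qed

lemma gr_generated_degree_one:
  assumes p: "ideal p Gr" and sub: "assoc_graded_piece R I 1 \<subseteq> p" and d: "d \<ge> 1"
  shows "assoc_graded_piece R I d \<subseteq> p"
proof -
  have "rees_piece R I 1 \<subseteq> gr.vim p"
    using sub unfolding \<pi>_piece[symmetric] by (auto simp: gr.vim_def)
  then have "rees_piece R I d \<subseteq> gr.vim p"
    using rees_generated_degree_one[OF gr.ideal_vim[OF p] _ d] by blast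
  then show ?thesis unfolding \<pi>_piece[symmetric] by (auto simp: gr.vim_def)
qed

text \<open>The element \<open>t\<close> found here is the degree one denominator on which both
  length comparisons rely.\<close>

lemma proj_points_degree_one:
  assumes "p \<in> proj_points Gr (assoc_graded_piece R I)"
  obtains t where "t \<in> assoc_graded_piece R I 1" "t \<notin> p"
proof -
  have "ideal p Gr" "\<not> (\<forall>d\<ge>1. assoc_graded_piece R I d \<subseteq> p)"
    using assms by (simp_all add: gr.S.proj_points_iff gr.S.primeideal_iff)
  then show ?thesis using gr_generated_degree_one that by blast
qed

end

section \<open>Polynomials over the complex numbers\<close>

definition Const :: "complex \<Rightarrow> 'n cpoly"
  where "Const a = Poly_Mapping.single 0 a"

definition Var :: "'n \<Rightarrow> 'n cpoly"
  where "Var i = Poly_Mapping.single (Poly_Mapping.single i 1) 1"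

lemma Const_simps:
  "Const 0 = 0" "Const 1 = 1" "Const (a + b) = Const a + Const b" "Const (a * b) = Const a * Const b"
  "Const (- a) = - Const a" "Const (a - b) = Const a - Const b"
  by (simp_all add: Const_def single_add mult_single single_one single_uminus single_diff)

lemma sum_singles: "f = (\<Sum>m\<in>Poly_Mapping.keys f. Poly_Mapping.single m (poly_mapping.lookup f m))"
  by (rule poly_mapping_eqI)
    (simp add: lookup_sum lookup_single when_def in_keys_iff sum.delta')

lemma lookup_single_sum:
  fixes m :: "'n::finite \<Rightarrow>\<^sub>0 nat"
  shows "(\<Sum>i\<in>UNIV. Poly_Mapping.single i (poly_mapping.lookup m i)) = m"
  by (rule poly_mapping_eqI) (simp add: lookup_sum lookup_single when_def)

lemma Var_power: "Var i ^ k = Poly_Mapping.single (Poly_Mapping.single i k) 1"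
  by (induction k) (simp_all add: Var_def mult_single single_add[symmetric] single_one)

lemma single_eq_Const_mult_Var:
  fixes m :: "'n::finite \<Rightarrow>\<^sub>0 nat"
  shows "Poly_Mapping.single m a = Const a * (\<Prod>i\<in>UNIV. Var i ^ poly_mapping.lookup m i)"
proof -
  have "(\<Prod>i\<in>F. Var i ^ poly_mapping.lookup m i) =
      Poly_Mapping.single (\<Sum>i\<in>F. Poly_Mapping.single i (poly_mapping.lookup m i)) 1" for F :: "'n set"
    by (induction F rule: infinite_finite_induct) (simp_all add: Var_power mult_single single_one)
  then show ?thesis
    by (simp add: lookup_single_sum Const_def mult_single)
qed

lemma cpoly_induct [case_names Const Var add mult]:
  fixes f :: "'n::finite cpoly"
  assumes Const: "\<And>a. P (Const a)" and Var: "\<And>i. P (Var i)"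
    and add: "\<And>f g. P f \<Longrightarrow> P g \<Longrightarrow> P (f + g)" and mult: "\<And>f g. P f \<Longrightarrow> P g \<Longrightarrow> P (f * g)"
  shows "P f"
proof -
  have one: "P 1" using Const[of 1] by (simp add: Const_simps)
  have zero: "P 0" using Const[of 0] by (simp add: Const_simps)
  have power: "P (Var i ^ k)" for i k by (induction k) (simp_all add: one Var mult)
  have prod: "P (\<Prod>i\<in>F. Var i ^ k i)" for F k
    by (induction F rule: infinite_finite_induct) (simp_all add: one power mult)
  have "P (Poly_Mapping.single m a)" for m a
    unfolding single_eq_Const_mult_Var by (intro mult Const prod)
  then have "P (\<Sum>m\<in>F. Poly_Mapping.single m (poly_mapping.lookup f m))" for F
    by (induction F rule: infinite_finite_induct) (simp_all add: zero add)
  then show ?thesis using sum_singles[of f] by metis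
qed

text \<open>The polynomials \<open>x i\<close> parametrize a curve in affine space, and the value is
  the restriction of \<open>f\<close> to that curve.\<close>

definition subst :: "('n::finite \<Rightarrow> complex poly) \<Rightarrow> 'n cpoly \<Rightarrow> complex poly"
  where "subst x f = (\<Sum>m\<in>Poly_Mapping.keys f. [:poly_mapping.lookup f m:] * (\<Prod>i\<in>UNIV. x i ^ poly_mapping.lookup m i))"

text \<open>Exponents outside the support contribute zero; over a common finite set of exponents
  additivity can be checked term by term.\<close>

lemma subst_superset:
  "finite K \<Longrightarrow> Poly_Mapping.keys f \<subseteq> K \<Longrightarrow> subst x f = (\<Sum>m\<in>K. [:poly_mapping.lookup f m:] * (\<Prod>i\<in>UNIV. x i ^ poly_mapping.lookup m i))"
  unfolding subst_def by (intro sum.mono_neutral_left) (auto simp: in_keys_iff)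

lemma subst_single: "subst x (Poly_Mapping.single m a) = [:a:] * (\<Prod>i\<in>UNIV. x i ^ poly_mapping.lookup m i)"
  by (subst subst_superset[of "{m}"]) auto

lemma subst_add: "subst x (f + g) = subst x f + subst x g"
proof -
  have K: "finite (Poly_Mapping.keys f \<union> Poly_Mapping.keys g)" "Poly_Mapping.keys f \<subseteq> Poly_Mapping.keys f \<union> Poly_Mapping.keys g" "Poly_Mapping.keys g \<subseteq> Poly_Mapping.keys f \<union> Poly_Mapping.keys g"
    "Poly_Mapping.keys (f + g) \<subseteq> Poly_Mapping.keys f \<union> Poly_Mapping.keys g" using keys_add[of f g] by auto
  have "[:poly_mapping.lookup f m + poly_mapping.lookup g m:] = [:poly_mapping.lookup f m:] + [:poly_mapping.lookup g m:]" for m by simp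
  then show ?thesis
    unfolding subst_superset[OF K(1,2)] subst_superset[OF K(1,3)] subst_superset[OF K(1,4)]
    by (simp only: lookup_add distrib_right sum.distrib)
qed

lemma subst_0: "subst x 0 = 0"
  by (simp add: subst_def)

lemma subst_sum: "subst x (sum f F) = (\<Sum>i\<in>F. subst x (f i))"
  by (induction F rule: infinite_finite_induct) (simp_all add: subst_0 subst_add)

lemma subst_mult: "subst x (f * g) = subst x f * subst x g"
proof -
  have single: "subst x (Poly_Mapping.single m a * Poly_Mapping.single n b) =
      subst x (Poly_Mapping.single m a) * subst x (Poly_Mapping.single n b)" for m n a b
    unfolding mult_single subst_single
    by (simp add: lookup_add power_add prod.distrib mult.commute mult.left_commute)
  have "f * g = (\<Sum>m\<in>Poly_Mapping.keys f. \<Sum>n\<in>Poly_Mapping.keys g.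
      Poly_Mapping.single m (poly_mapping.lookup f m) * Poly_Mapping.single n (poly_mapping.lookup g n))"
    unfolding sum_product[symmetric] by (rule arg_cong2[where f = "(*)", OF sum_singles sum_singles])
  then have "subst x (f * g) = (\<Sum>m\<in>Poly_Mapping.keys f. \<Sum>n\<in>Poly_Mapping.keys g.
      subst x (Poly_Mapping.single m (poly_mapping.lookup f m)) * subst x (Poly_Mapping.single n (poly_mapping.lookup g n)))"
    by (simp only: subst_sum single)
  also have "\<dots> = subst x (\<Sum>m\<in>Poly_Mapping.keys f. Poly_Mapping.single m (poly_mapping.lookup f m)) *
      subst x (\<Sum>n\<in>Poly_Mapping.keys g. Poly_Mapping.single n (poly_mapping.lookup g n))"
    by (simp only: subst_sum sum_product)
  also have "\<dots> = subst x f * subst x g"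
    by (simp only: sum_singles[symmetric])
  finally show ?thesis .
qed

lemma subst_Const: "subst x (Const a) = [:a:]"
  by (simp add: Const_def subst_single)

lemma subst_Var: "subst x (Var i) = x i"
proof -
  have "(\<Prod>j\<in>UNIV. x j ^ poly_mapping.lookup (Poly_Mapping.single i 1) j) = (\<Prod>j\<in>UNIV. if j = i then x j else 1)"
    by (intro prod.cong) (auto simp: lookup_single when_def)
  then show ?thesis by (simp add: Var_def subst_single)
qed

lemma subst_diff: "subst x (f - g) = subst x f - subst x g"
  using subst_add[of x "f - g" g] by simp

lemma primeideal_class_iff:
  "primeideal J (cring_class_ops :: 'a::comm_ring_1 ring) \<longleftrightarrow>
    ideal J cring_class_ops \<and> 1 \<notin> J \<and> (\<forall>a b. a * b \<in> J \<longrightarrow> a \<in> J \<or> b \<in> J)"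
  unfolding cring_class.primeideal_iff by (simp add: cring_class_ops_def)

lemma ideal_class_diff:
  "ideal J (cring_class_ops :: 'a::comm_ring_1 ring) \<Longrightarrow> x \<in> J \<Longrightarrow> y \<in> J \<Longrightarrow> x - y \<in> J"
  unfolding ideal_class_iff by (metis add_uminus_conv_diff mult_minus1)

lemma ideal_class_sum:
  assumes "ideal J (cring_class_ops :: 'a::comm_ring_1 ring)" "\<And>i. i \<in> F \<Longrightarrow> f i \<in> J"
  shows "sum f F \<in> J"
  using assms(2) by (induction F rule: infinite_finite_induct)
    (use assms(1) in \<open>auto simp: ideal_class_iff\<close>)

section \<open>Points of maximal ideals\<close>

definition eval_at :: "'n cpoly \<Rightarrow> complex poly \<Rightarrow> 'n cpoly"
  where "eval_at v P = poly (map_poly Const P) v"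

lemma eval_at_pCons: "eval_at v (pCons a P) = Const a + v * eval_at v P"
  by (simp add: eval_at_def map_poly_pCons Const_simps)

lemma eval_at_0: "eval_at v 0 = 0"
  by (simp add: eval_at_def)

lemma eval_at_add: "eval_at v (P + Q) = eval_at v P + eval_at v Q"
  by (induction P Q rule: poly_induct2)
    (simp_all add: eval_at_0 eval_at_pCons Const_simps algebra_simps)

lemma eval_at_smult: "eval_at v (smult a P) = Const a * eval_at v P"
  by (induction P) (simp_all add: eval_at_0 eval_at_pCons Const_simps algebra_simps)

text \<open>Over the complex numbers nonzero polynomials split into linear factors, so this case of
  multiplicativity suffices.\<close>

lemma eval_at_linear_mult: "eval_at v ([:- z, 1:] * Q) = (v - Const z) * eval_at v Q"
proof -
  have "[:- z, 1:] * Q = smult (- z) Q + pCons 0 Q" by (simp add: mult_pCons_left)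
  then have "eval_at v ([:- z, 1:] * Q) = Const (- z) * eval_at v Q + (Const 0 + v * eval_at v Q)"
    by (simp only: eval_at_add eval_at_smult eval_at_pCons)
  then show ?thesis by (simp only: Const_simps) (simp add: algebra_simps)
qed

lemma eval_at_sum: "eval_at v (sum f F) = (\<Sum>i\<in>F. eval_at v (f i))"
  by (induction F rule: infinite_finite_induct) (simp_all add: eval_at_0 eval_at_add)

lemma eval_at_prod_linear:
  "finite F \<Longrightarrow> eval_at v (\<Prod>z\<in>F. [:- z, 1:]) = (\<Prod>z\<in>F. v - Const z)"
proof (induction F rule: finite_induct)
  case empty
  then show ?case by (simp add: eval_at_pCons eval_at_0 Const_simps one_pCons)
next
  case (insert z F)
  have "(\<Prod>z\<in>insert z F. [:- z, 1:]) = [:- z, 1:] * (\<Prod>z\<in>F. [:- z, 1:])"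
    "(\<Prod>z\<in>insert z F. v - Const z) = (v - Const z) * (\<Prod>z\<in>F. v - Const z)"
    by (rule prod.insert[OF insert.hyps])+
  then show ?case using insert.IH by (simp only: eval_at_linear_mult)
qed

text \<open>With finite fibres only, the reals would be a countable union of finite sets.\<close>

lemma uncountable_fibre:
  fixes F :: "real \<Rightarrow> 'k"
  assumes "countable (range F)"
  obtains k where "infinite {r. F r = k}"
proof (rule ccontr)
  assume "\<not> thesis"
  then have "\<And>k. finite {r. F r = k}" using that by blast
  then have "countable (\<Union>k\<in>range F. {r. F r = k})"
    using assms by (intro countable_UN) (auto intro: countable_finite)
  moreover have "(\<Union>k\<in>range F. {r. F r = k}) = UNIV" by auto
  ultimately show False using uncountable_UNIV_real by simp
qed

text \<open>Scalars act through constant polynomials; this gives access to the bound on independent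
  sets inside a finite span.\<close>

interpretation cpoly_space: vector_space "\<lambda>a (f :: 'n cpoly). Const a * f"
  by unfold_locales (simp_all add: Const_simps algebra_simps)

lemma countable_exponents: "countable (UNIV :: ('n::finite \<Rightarrow>\<^sub>0 nat) set)"
proof -
  have "inj (poly_mapping.lookup :: ('n \<Rightarrow>\<^sub>0 nat) \<Rightarrow> 'n \<Rightarrow> nat)" by (auto intro: injI poly_mapping_eqI)
  then show ?thesis by (rule countableI')
qed

text \<open>The classical argument for uncountable fields: the residue field has countable dimension,
  so the inverses of the \<open>Var i - a\<close> cannot be linearly independent.\<close>

lemma maximal_ideal_contains_linear:
  fixes M :: "'n::finite cpoly set"
  assumes M: "primeideal M poly_ring" and inverse: "\<And>f. f \<notin> M \<Longrightarrow> \<exists>g. f * g - 1 \<in> M"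
  shows "\<exists>a. Var i - Const a \<in> M"
proof (rule ccontr)
  assume "\<not> ?thesis"
  then have nM: "Var i - Const a \<notin> M" for a by blast
  have id: "ideal M poly_ring" and one: "1 \<notin> M"
    and prime: "\<And>a b. a * b \<in> M \<Longrightarrow> a \<in> M \<or> b \<in> M"
    using M unfolding primeideal_class_iff by blast+
  have mult: "a * b \<in> M" if "b \<in> M" for a b using id that unfolding ideal_class_iff by blast
  have Const: "Const a \<notin> M" if "a \<noteq> 0" for a
    using mult[of "Const a" "Const (inverse a)"] one that by (auto simp: Const_simps(2,4)[symmetric])
  let ?v = "Var i :: 'n cpoly"
  \<comment> \<open>The class of the variable modulo \<open>M\<close> is transcendental: a root
    splits off a linear factor, no such factor lies in \<open>M\<close>, and \<open>M\<close> is
    prime.\<close>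
  have eval: "eval_at ?v P \<notin> M" if "P \<noteq> 0" for P
    using that
  proof (induction "degree P" arbitrary: P)
    case 0
    then obtain a where "P = [:a:]" "a \<noteq> 0" by (metis degree_eq_zeroE pCons_0_0)
    then show ?case using Const by (simp add: eval_at_pCons eval_at_0)
  next
    case (Suc n)
    have "\<not> constant (poly P)" using Suc.hyps(2) by (simp add: constant_degree)
    then obtain z where "poly P z = 0" using fundamental_theorem_of_algebra by blast
    then obtain Q where Q: "P = [:- z, 1:] * Q" using poly_eq_0_iff_dvd dvdE by blast
    then have "Q \<noteq> 0" using Suc.prems by auto
    moreover have "degree P = Suc (degree Q)" unfolding Q using \<open>Q \<noteq> 0\<close> by (subst degree_mult_eq) auto
    ultimately have "eval_at ?v Q \<notin> M" using Suc.hyps by simp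
    then show ?case unfolding Q eval_at_linear_mult using prime nM by blast
  qed
  define g where "g r = (SOME g. (?v - Const (of_real r)) * g - 1 \<in> M)" for r
  have g: "(?v - Const (of_real r)) * g r - 1 \<in> M" for r
    unfolding g_def by (rule someI_ex[OF inverse[OF nM]])
  \<comment> \<open>There are countably many finite supports but uncountably many real
    \<open>r\<close>. So infinitely many of the inverses \<open>g r\<close> share one support
    \<open>K\<close> and lie in the finite-dimensional span of its monomials.\<close>
  have "countable {K :: ('n \<Rightarrow>\<^sub>0 nat) set. finite K \<and> K \<subseteq> UNIV}"
    using countable_Collect_finite_subset countable_exponents by blast
  then have "countable (range (\<lambda>r. Poly_Mapping.keys (g r)))"
    by (rule countable_subset[rotated]) auto
  then obtain K where K: "infinite {r. Poly_Mapping.keys (g r) = K}" by (rule uncountable_fibre)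
  let ?Z = "{r. Poly_Mapping.keys (g r) = K}"
  have finK: "finite K" using K infinite_imp_nonempty by fastforce
  \<comment> \<open>Equal inverses for \<open>r\<close> and \<open>s\<close> would force (s - r)
    g(r), hence g(r), into \<open>M\<close>, although \<open>g r\<close> inverts an element modulo
    \<open>M\<close>. So infinitely many parameters give infinitely many polynomials.\<close>
  have inj: "inj_on g A" for A
  proof (rule inj_onI, rule ccontr)
    fix r s assume eq: "g r = g s" and "r \<noteq> s"
    have "((?v - Const (of_real r)) * g r - 1) - ((?v - Const (of_real s)) * g s - 1) \<in> M"
      by (rule ideal_class_diff[OF id g g])
    then have "Const (of_real s - of_real r) * g r \<in> M"
      unfolding eq by (simp add: Const_simps algebra_simps)
    then have "g r \<in> M" using prime Const[of "of_real s - of_real r"] \<open>r \<noteq> s\<close> by auto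
    then have "(?v - Const (of_real r)) * g r \<in> M" by (rule mult)
    from ideal_class_diff[OF id this g[of r]] show False using one by simp
  qed
  have span: "g ` ?Z \<subseteq> cpoly_space.span ((\<lambda>m. Poly_Mapping.single m 1) ` K)"
  proof
    fix f assume "f \<in> g ` ?Z"
    then have keys: "Poly_Mapping.keys f = K" by auto
    have "Poly_Mapping.single m (poly_mapping.lookup f m) = Const (poly_mapping.lookup f m) * Poly_Mapping.single m 1" for m
      by (simp add: Const_def mult_single)
    then have "f = (\<Sum>m\<in>K. Const (poly_mapping.lookup f m) * Poly_Mapping.single m 1)"
      using sum_singles[of f] keys by simp
    moreover have "(\<Sum>m\<in>K. Const (poly_mapping.lookup f m) * Poly_Mapping.single m 1) \<in>
        cpoly_space.span ((\<lambda>m. Poly_Mapping.single m 1) ` K)"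
      by (intro cpoly_space.span_sum cpoly_space.span_scale cpoly_space.span_base) blast
    ultimately show "f \<in> cpoly_space.span ((\<lambda>m. Poly_Mapping.single m 1) ` K)" by simp
  qed
  have "cpoly_space.dependent (g ` ?Z)"
  proof (rule ccontr)
    assume "cpoly_space.independent (g ` ?Z)"
    then have "finite (g ` ?Z)"
      using cpoly_space.independent_span_bound[OF _ _ span] finK by blast
    then show False using K finite_imageD inj by blast
  qed
  then obtain t u w where t: "finite t" "t \<subseteq> g ` ?Z" "(\<Sum>f\<in>t. Const (u f) * f) = 0"
      "w \<in> t" "u w \<noteq> 0"
    unfolding cpoly_space.dependent_explicit by blast
  obtain Z where Z: "finite Z" "t = g ` Z" using finite_subset_image[OF t(1,2)] by blast
  obtain r0 where r0: "r0 \<in> Z" "w = g r0" using t(4) Z(2) by blast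
  have sum0: "(\<Sum>r\<in>Z. Const (u (g r)) * g r) = 0"
    using t(3) unfolding Z(2) by (simp add: sum.reindex[OF inj])
  let ?c = "\<lambda>r. complex_of_real r"
  have injc: "inj_on ?c A" for A by (simp add: inj_on_def)
  let ?W = "?c ` Z"
  \<comment> \<open>Numerator of the linear relation among the inverses of the
    \<open>Var i - Const r\<close> after clearing denominators. At \<open>r0\<close> every summand
    except its own vanishes, so \<open>P\<close> is nonzero, whereas its value at the variable lies
    in \<open>M\<close>.\<close>
  define P where "P = (\<Sum>r\<in>Z. smult (u (g r)) (\<Prod>z\<in>?W - {?c r}. [:- z, 1:]))"
  have "poly P (?c r0) = (\<Sum>r\<in>Z. u (g r) * (\<Prod>z\<in>?W - {?c r}. ?c r0 - z))"
    by (simp add: P_def poly_sum poly_prod)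
  also have "\<dots> = (\<Sum>r\<in>{r0}. u (g r) * (\<Prod>z\<in>?W - {?c r}. ?c r0 - z))"
    using Z(1) r0(1) by (intro sum.mono_neutral_right) (auto intro!: prod_zero)
  finally have "poly P (?c r0) = u w * (\<Prod>z\<in>?W - {?c r0}. ?c r0 - z)" using r0(2) by simp
  moreover have "(\<Prod>z\<in>?W - {?c r0}. ?c r0 - z) \<noteq> 0"
    using Z(1) by (auto simp: prod_zero_iff)
  ultimately have "poly P (?c r0) \<noteq> 0" using t(5) by simp
  then have "P \<noteq> 0" by auto
  then have "eval_at ?v P \<notin> M" by (rule eval)
  moreover have "eval_at ?v P \<in> M"
  proof -
    let ?prod = "\<Prod>z\<in>?W. ?v - Const z"
    have summand: "Const (u (g r)) * (\<Prod>z\<in>?W - {?c r}. ?v - Const z) - ?prod * (Const (u (g r)) * g r) \<in> M"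
      if "r \<in> Z" for r
    proof -
      let ?q = "\<Prod>z\<in>?W - {?c r}. ?v - Const z"
      have "?prod = (?v - Const (?c r)) * ?q"
        using Z(1) that by (intro prod.remove) auto
      moreover have "a * q - (y * q) * (a * h) = (- a * q) * (y * h - 1)" for a q y h :: "'n cpoly"
        by (simp add: algebra_simps)
      ultimately have "Const (u (g r)) * ?q - ?prod * (Const (u (g r)) * g r) =
          (- Const (u (g r)) * ?q) * ((?v - Const (?c r)) * g r - 1)"
        by (simp only:)
      then show ?thesis by (simp only: mult[OF g])
    qed
    have "eval_at ?v P = (\<Sum>r\<in>Z. Const (u (g r)) * (\<Prod>z\<in>?W - {?c r}. ?v - Const z))"
      using Z(1) by (simp add: P_def eval_at_sum eval_at_smult eval_at_prod_linear)
    also have "\<dots> = (\<Sum>r\<in>Z. Const (u (g r)) * (\<Prod>z\<in>?W - {?c r}. ?v - Const z)) -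
        ?prod * (\<Sum>r\<in>Z. Const (u (g r)) * g r)"
      unfolding sum0 by simp
    also have "\<dots> = (\<Sum>r\<in>Z. Const (u (g r)) * (\<Prod>z\<in>?W - {?c r}. ?v - Const z) -
        ?prod * (Const (u (g r)) * g r))"
      by (simp add: sum_distrib_left sum_subtractf)
    also have "\<dots> \<in> M" by (rule ideal_class_sum[OF id summand])
    finally show ?thesis .
  qed
  ultimately show False by simp
qed

text \<open>Modulo \<open>M\<close> every variable is a constant, so each f is congruent to its
  value at the point \<open>a\<close>; for f in \<open>M\<close> this value is zero, as
  \<open>M\<close> contains no nonzero constant. The line used passes through \<open>a\<close> at
  parameter 0.\<close>

lemma maximal_ideal_point:
  fixes M :: "'n::finite cpoly set"
  assumes M: "primeideal M poly_ring" and inverse: "\<And>f. f \<notin> M \<Longrightarrow> \<exists>g. f * g - 1 \<in> M"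
  obtains a where "\<And>f. f \<in> M \<Longrightarrow> poly (subst (\<lambda>i. [:a i, 1:]) f) 0 = 0"
proof -
  have id: "ideal M poly_ring" and one: "1 \<notin> M" using M unfolding primeideal_class_iff by blast+
  have mult: "f * g \<in> M" "g * f \<in> M" if "g \<in> M" for f g
    using id that unfolding ideal_class_iff by (auto simp: mult.commute)
  have add: "f + g \<in> M" if "f \<in> M" "g \<in> M" for f g using id that unfolding ideal_class_iff by blast
  have "\<forall>i. \<exists>a. Var i - Const a \<in> M" using maximal_ideal_contains_linear[OF assms] by blast
  then obtain a where a: "\<And>i. Var i - Const (a i) \<in> M" by metis
  let ?\<phi> = "subst (\<lambda>i. [:a i, 1:])"
  have *: "f - Const (poly (?\<phi> f) 0) \<in> M" for f
  proof (induction f rule: cpoly_induct)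
    case (Const b)
    then show ?case using id by (simp add: subst_Const ideal_class_iff)
  next
    case (Var i)
    then show ?case using a by (simp add: subst_Var)
  next
    case (add f g)
    have "(f - Const (poly (?\<phi> f) 0)) + (g - Const (poly (?\<phi> g) 0)) \<in> M" by (rule \<open>\<And>f g. f \<in> M \<Longrightarrow> g \<in> M \<Longrightarrow> f + g \<in> M\<close>[OF add])
    then show ?case by (simp add: subst_add Const_simps algebra_simps)
  next
    case (mult f g)
    have "(f - Const (poly (?\<phi> f) 0)) * g + Const (poly (?\<phi> f) 0) * (g - Const (poly (?\<phi> g) 0)) \<in> M"
      by (intro add \<open>\<And>f g. g \<in> M \<Longrightarrow> f * g \<in> M\<close> \<open>\<And>f g. g \<in> M \<Longrightarrow> g * f \<in> M\<close> mult)
    then show ?case by (simp add: subst_mult Const_simps algebra_simps)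
  qed
  have "poly (?\<phi> f) 0 = 0" if f: "f \<in> M" for f
  proof (rule ccontr)
    let ?b = "poly (?\<phi> f) 0"
    assume nz: "?b \<noteq> 0"
    have "f - (f - Const ?b) \<in> M" by (rule ideal_class_diff[OF id f *])
    then have "Const (inverse ?b) * Const ?b \<in> M" using mult(1) by simp
    then show False using nz one by (simp add: Const_simps(2,4)[symmetric])
  qed
  then show thesis by (rule that)
qed

section \<open>Fat points\<close>

text \<open>The descending chain of ideals x^n R + I stabilizes, so x^n (x r - 1) lies in
  \<open>I\<close> for some \<open>r\<close>; since \<open>x\<close> is outside the prime
  \<open>P\<close>, the factor x r - 1 lies in \<open>P\<close>.\<close>

lemma (in cring) artinian_prime_inverse:
  assumes I: "ideal I R" and art: "artinian (R Quot I)"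
    and P: "primeideal P R" "I \<subseteq> P" and x: "x \<in> carrier R" "x \<notin> P"
  shows "\<exists>y\<in>carrier R. x \<otimes> y \<ominus> \<one> \<in> P"
proof -
  interpret q: surjective_hom R "R Quot I" "(+>) I" by (rule surjective_hom_quotient[OF is_cring I])
  interpret I: ideal I R by fact
  interpret P: primeideal P R by fact
  have ker: "q.ker = I" by (rule ker_quotient[OF is_cring I])
  define K where "K n = {x [^] n \<otimes> r \<oplus> i | r i. r \<in> carrier R \<and> i \<in> I}" for n :: nat
  have K_I: "x [^] n \<otimes> r \<oplus> i \<in> K n" if "r \<in> carrier R" "i \<in> I" for n r i
    using that unfolding K_def by blast
  have K_E: "\<exists>r i. y = x [^] n \<otimes> r \<oplus> i \<and> r \<in> carrier R \<and> i \<in> I" if "y \<in> K n" for n y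
    using that unfolding K_def by blast
  have xn: "x [^] n \<in> carrier R" for n :: nat using x by simp
  have idK: "ideal (K n) R" for n
    unfolding ideal_iff
  proof (intro conjI ballI)
    show "K n \<subseteq> carrier R" using K_E xn by fastforce
    have "x [^] n \<otimes> \<zero> \<oplus> \<zero> = \<zero>" using xn by simp
    then show "\<zero> \<in> K n" using K_I[OF zero_closed I.zero_closed] by metis
    fix y z assume z: "z \<in> K n"
    obtain s j where s: "z = x [^] n \<otimes> s \<oplus> j" "s \<in> carrier R" "j \<in> I" using K_E[OF z] by blast
    have jc: "j \<in> carrier R" using s(3) by simp
    {
      assume y: "y \<in> K n"
      obtain r i where r: "y = x [^] n \<otimes> r \<oplus> i" "r \<in> carrier R" "i \<in> I" using K_E[OF y] by blast
      have ic: "i \<in> carrier R" using r(3) by simp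
      have "y \<oplus> z = x [^] n \<otimes> (r \<oplus> s) \<oplus> (i \<oplus> j)"
        unfolding r(1) s(1) using xn r(2) s(2) ic jc by (simp add: r_distr a_ac)
      then show "y \<oplus> z \<in> K n" using K_I[of "r \<oplus> s" "i \<oplus> j" n] r s by simp
    }
    {
      assume y: "y \<in> carrier R"
      have "y \<otimes> z = x [^] n \<otimes> (y \<otimes> s) \<oplus> y \<otimes> j"
        unfolding s(1) using xn y s(2) jc by (simp add: r_distr m_lcomm)
      then show "y \<otimes> z \<in> K n" using K_I[of "y \<otimes> s" "y \<otimes> j" n] y s I.I_l_closed by simp
    }
  qed
  have IK: "I \<subseteq> K n" for n
  proof
    fix i assume i: "i \<in> I"
    have "i \<in> carrier R" using i by simp
    then have "x [^] n \<otimes> \<zero> \<oplus> i = i" using xn by simp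
    then show "i \<in> K n" using K_I[OF zero_closed i, of n] by simp
  qed
  have dec: "K (Suc n) \<subseteq> K n" for n
  proof
    fix y assume y: "y \<in> K (Suc n)"
    obtain r i where r: "y = x [^] Suc n \<otimes> r \<oplus> i" "r \<in> carrier R" "i \<in> I" using K_E[OF y] by blast
    have "y = x [^] n \<otimes> (x \<otimes> r) \<oplus> i"
      unfolding r(1) using x(1) r(2) by (simp add: m_assoc)
    then show "y \<in> K n" using K_I[of "x \<otimes> r" i n] x(1) r by simp
  qed
  have "\<And>J. (\<forall>n. ideal (J n) (R Quot I) \<and> J (Suc n) \<subseteq> J n) \<Longrightarrow> \<exists>n. \<forall>m\<ge>n. J m = J n"
    using art unfolding artinian_def by blast
  \<comment> \<open>The artinian condition speaks about the quotient. All \<open>K n\<close> contain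
    \<open>I\<close>, so equality of their images gives equality of the ideals themselves.\<close>
  then have "\<exists>n. \<forall>m\<ge>n. (+>) I ` K m = (+>) I ` K n"
    using q.ideal_image[OF idK] image_mono[OF dec] by meson
  then obtain n where "\<forall>m\<ge>n. (+>) I ` K m = (+>) I ` K n" by blast
  then have "(+>) I ` K (Suc n) = (+>) I ` K n" by (meson le_SucI order_refl)
  then have eq: "K (Suc n) = K n"
    using q.vim_image[OF idK, of n] q.vim_image[OF idK, of "Suc n"] IK ker by metis
  have "x [^] n \<otimes> \<one> \<oplus> \<zero> \<in> K n" by (rule K_I[OF one_closed I.zero_closed])
  then have "x [^] n \<in> K (Suc n)" unfolding eq using xn by simp
  from K_E[OF this] obtain r i where r: "x [^] n = x [^] Suc n \<otimes> r \<oplus> i"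
    "r \<in> carrier R" "i \<in> I" by blast
  have ic: "i \<in> carrier R" using r(3) by simp
  have "x [^] n \<otimes> (x \<otimes> r \<ominus> \<one>) = x [^] Suc n \<otimes> r \<ominus> x [^] n"
    using x(1) xn r(2) by (simp add: minus_eq r_distr r_minus m_assoc)
  also have "\<dots> = x [^] Suc n \<otimes> r \<ominus> (x [^] Suc n \<otimes> r \<oplus> i)"
    using r(1) by simp
  also have "\<dots> = \<ominus> i"
    using xn[of "Suc n"] r(2) ic by (simp add: minus_eq minus_add r_neg2 del: nat_pow_Suc)
  also have "\<dots> \<in> P" using r(3) P(2) by (intro P.a_inv_closed) auto
  finally have prod: "x [^] n \<otimes> (x \<otimes> r \<ominus> \<one>) \<in> P" .
  have "x [^] k \<notin> P" for k :: nat
  proof (induction k)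
    case 0
    then show ?case using P(1) primeideal_iff[of P] by simp
  next
    case (Suc k)
    then show ?case using P.I_prime[of "x [^] k" x] x by auto
  qed
  then show ?thesis using P.I_prime[OF xn _ prod] x(1) r(2) by auto
qed

text \<open>The artinian condition makes residues modulo a prime above \<open>I\<close> invertible.
  Such primes therefore have maximal image in the local quotient, where there is only one maximal
  ideal.\<close>

lemma fat_point_prime_unique:
  assumes I: "fat_point I" and P: "primeideal P poly_ring" "I \<subseteq> P" and Q: "primeideal Q poly_ring" "I \<subseteq> Q"
  shows "P = Q"
proof -
  have idI: "ideal I poly_ring" and loc: "is_local (poly_ring Quot I)" and art: "artinian (poly_ring Quot I)"
    using I unfolding fat_point_def by blast+
  interpret q: surjective_hom "poly_ring" "poly_ring Quot I" "(+>\<^bsub>poly_ring\<^esub>) I"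
    by (rule surjective_hom_quotient[OF cring_class idI])
  have ker: "q.ker = I" by (rule ker_quotient[OF cring_class idI])
  have max: "maximalideal ((+>\<^bsub>poly_ring\<^esub>) I ` P) (poly_ring Quot I)"
    if P: "primeideal P poly_ring" "I \<subseteq> P" for P
  proof (rule maximalidealI)
    have pr: "primeideal ((+>\<^bsub>poly_ring\<^esub>) I ` P) (poly_ring Quot I)"
      by (rule q.primeideal_image[OF P(1)]) (simp add: ker P(2))
    have idP: "ideal P poly_ring" using P(1) by (rule primeideal.axioms(1))
    show "ideal ((+>\<^bsub>poly_ring\<^esub>) I ` P) (poly_ring Quot I)" by (rule q.ideal_image[OF idP])
    show "carrier (poly_ring Quot I) \<noteq> (+>\<^bsub>poly_ring\<^esub>) I ` P" using primeideal.I_notcarr[OF pr] .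
    fix J assume J: "ideal J (poly_ring Quot I)" "(+>\<^bsub>poly_ring\<^esub>) I ` P \<subseteq> J"
    have vJ: "ideal (q.vim J) poly_ring" by (rule q.ideal_vim[OF J(1)])
    have PJ: "P \<subseteq> q.vim J" using J(2) carrier_class by (auto simp: q.vim_def)
    show "J = (+>\<^bsub>poly_ring\<^esub>) I ` P \<or> J = carrier (poly_ring Quot I)"
    proof (cases "q.vim J \<subseteq> P")
      case True
      have "J \<subseteq> (+>\<^bsub>poly_ring\<^esub>) I ` P"
        using q.vim_strict_mono[OF J(1) q.ideal_image[OF idP]] q.vim_image[OF idP] ker P(2) True by simp
      then show ?thesis using J(2) by blast
    next
      case False
      then obtain x where x: "x \<in> q.vim J" "x \<notin> P" by blast
      then obtain y where y: "x \<otimes>\<^bsub>poly_ring\<^esub> y \<ominus>\<^bsub>poly_ring\<^esub> \<one>\<^bsub>poly_ring\<^esub> \<in> P"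
        using cring.artinian_prime_inverse[OF cring_class idI art P carrier_class] by blast
      then have "x * y - 1 \<in> q.vim J" using PJ by (auto simp: class_simps)
      moreover have "x * y \<in> q.vim J"
        using x(1) vJ unfolding ideal_class_iff by (metis mult.commute)
      ultimately have "x * y - (x * y - 1) \<in> q.vim J" using ideal_class_diff[OF vJ] by blast
      then have "\<one>\<^bsub>poly_ring\<^esub> \<in> q.vim J" by (simp add: class_simps)
      then have "\<one>\<^bsub>poly_ring Quot I\<^esub> \<in> J" unfolding q.vim_def by simp
      then show ?thesis using ideal.one_imp_carrier[OF J(1)] by simp
    qed
  qed
  have "(+>\<^bsub>poly_ring\<^esub>) I ` P = (+>\<^bsub>poly_ring\<^esub>) I ` Q"
    using loc max[OF P] max[OF Q] unfolding is_local_def by blast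
  moreover have "q.vim ((+>\<^bsub>poly_ring\<^esub>) I ` P) = P" "q.vim ((+>\<^bsub>poly_ring\<^esub>) I ` Q) = Q"
    using P Q q.vim_image primeideal.axioms(1) ker by metis+
  ultimately show ?thesis by metis
qed

lemma fat_point_prime_exists:
  assumes I: "fat_point I"
  obtains M where "primeideal M poly_ring" "I \<subseteq> M" "\<forall>f. f \<notin> M \<longrightarrow> (\<exists>g. f * g - 1 \<in> M)"
proof -
  have idI: "ideal I poly_ring" and loc: "is_local (poly_ring Quot I)" and art: "artinian (poly_ring Quot I)"
    using I unfolding fat_point_def by blast+
  interpret q: surjective_hom "poly_ring" "poly_ring Quot I" "(+>\<^bsub>poly_ring\<^esub>) I"
    by (rule surjective_hom_quotient[OF cring_class idI])
  have ker: "q.ker = I" by (rule ker_quotient[OF cring_class idI])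
  obtain m where m: "maximalideal m (poly_ring Quot I)" using loc unfolding is_local_def by blast
  have pm: "primeideal m (poly_ring Quot I)" by (rule q.S.maximalideal_prime[OF m])
  have M: "primeideal (q.vim m) poly_ring" by (rule q.primeideal_vim[OF pm])
  have sub: "I \<subseteq> q.vim m" using q.ker_subset_vim[OF primeideal.axioms(1)[OF pm]] ker by simp
  have "\<exists>g. f * g - 1 \<in> q.vim m" if "f \<notin> q.vim m" for f
    using cring.artinian_prime_inverse[OF cring_class idI art M sub carrier_class that]
    by (auto simp: class_simps)
  then show thesis using that M sub by blast
qed

text \<open>Restricting polynomials to a line through the point of \<open>I\<close> yields a ring homomorphism
  \<open>\<phi>\<close> into polynomials in one variable; the order of vanishing at \<open>0\<close> is the valuation that
  separates the degree one part of the associated graded ring from its nilpotents.\<close>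

lemma fat_point_line:
  fixes I :: "'n::finite cpoly set"
  assumes I: "fat_point I"
  obtains \<phi> :: "'n cpoly \<Rightarrow> complex poly"
  where "\<forall>f g. \<phi> (f + g) = \<phi> f + \<phi> g" "\<forall>f g. \<phi> (f * g) = \<phi> f * \<phi> g" "\<phi> 1 = 1"
    "\<forall>f\<in>I. poly (\<phi> f) 0 = 0" "\<exists>f\<in>I. \<phi> f \<noteq> 0"
proof -
  obtain M where M: "primeideal M poly_ring" "I \<subseteq> M" "\<forall>f. f \<notin> M \<longrightarrow> (\<exists>g. f * g - 1 \<in> M)"
    by (rule fat_point_prime_exists[OF I])
  obtain a where a: "\<And>f. f \<in> M \<Longrightarrow> poly (subst (\<lambda>i. [:a i, 1:]) f) 0 = 0"
    using maximal_ideal_point[OF M(1) M(3)[rule_format]] by metis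
  define \<phi> where "\<phi> = subst (\<lambda>i :: 'n. [:a i, 1:])"
  have add: "\<phi> (f + g) = \<phi> f + \<phi> g" and mult: "\<phi> (f * g) = \<phi> f * \<phi> g" for f g
    unfolding \<phi>_def by (rule subst_add subst_mult)+
  have one: "\<phi> 1 = 1"
    using subst_Const[of "\<lambda>i. [:a i, 1:]" 1] by (simp add: \<phi>_def Const_simps one_pCons)
  have zero: "\<phi> 0 = 0" by (simp add: \<phi>_def subst_0)
  have "\<exists>f\<in>I. \<phi> f \<noteq> 0"
  proof (rule ccontr)
    assume no: "\<not> ?thesis"
    \<comment> \<open>If \<phi> vanished on \<open>I\<close>, its kernel and the ideal of the point
      would both be primes above \<open>I\<close>, hence equal; they are separated by any coordinate
      centred at the point.\<close>
    let ?N0 = "{f. \<phi> f = 0}" and ?N1 = "{f. poly (\<phi> f) 0 = 0}"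
    have "primeideal ?N0 poly_ring" "primeideal ?N1 poly_ring"
      unfolding primeideal_class_iff ideal_class_iff by (auto simp: add mult one zero)
    moreover have "I \<subseteq> ?N0" using no by auto
    moreover have "I \<subseteq> ?N1" using a M(2) unfolding \<phi>_def by blast
    ultimately have "?N0 = ?N1" using fat_point_prime_unique[OF I] by blast
    \<comment> \<open>\<open>undefined\<close> serves as an arbitrary variable; there is one because
      types are nonempty.\<close>
    moreover have "\<phi> (Var undefined - Const (a undefined)) = [:0, 1:]"
      unfolding \<phi>_def by (simp add: subst_diff subst_Var subst_Const)
    ultimately show False by (metis (mono_tags) mem_Collect_eq pCons_eq_0_iff poly_0_coeff_0
      coeff_pCons_0 one_neq_zero)
  qed
  then show thesis using that[of \<phi>] add mult one a M(2) unfolding \<phi>_def by blast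
qed

lemma monom_1_dvd_iff: "monom 1 (Suc 0) dvd p \<longleftrightarrow> poly p 0 = 0" for p :: "complex poly"
  by (simp add: poly_eq_0_iff_dvd monom_Suc monom_0)

text \<open>The number \<open>e\<close> is the least order of vanishing on \<open>I\<close> along
  the line. It exists because the degree of a nonzero restriction bounds it, and it is positive
  because all restrictions vanish at the point.\<close>

lemma fat_point_order:
  fixes I :: "'n::finite cpoly set"
  assumes I: "fat_point I"
  obtains \<phi> :: "'n cpoly \<Rightarrow> complex poly" and e
  where "\<forall>f g. \<phi> (f + g) = \<phi> f + \<phi> g" "\<forall>f g. \<phi> (f * g) = \<phi> f * \<phi> g" "\<phi> 1 = 1" "e \<ge> 1"
    "\<forall>f\<in>I. monom 1 e dvd \<phi> f" "\<exists>f\<in>I. \<not> monom 1 (Suc e) dvd \<phi> f"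
proof -
  obtain \<phi> :: "'n cpoly \<Rightarrow> complex poly" where \<phi>: "\<forall>f g. \<phi> (f + g) = \<phi> f + \<phi> g" "\<forall>f g. \<phi> (f * g) = \<phi> f * \<phi> g" "\<phi> 1 = 1"
    "\<forall>f\<in>I. poly (\<phi> f) 0 = 0" "\<exists>f\<in>I. \<phi> f \<noteq> 0"
    by (rule fat_point_line[OF I])
  let ?all = "\<lambda>e. \<forall>f\<in>I. monom 1 e dvd \<phi> f"
  obtain f where f: "f \<in> I" "\<phi> f \<noteq> 0" using \<phi>(5) by blast
  have "\<not> ?all (Suc (degree (\<phi> f)))"
    using f dvd_imp_degree_le[of "monom 1 (Suc (degree (\<phi> f)))" "\<phi> f"] by (auto simp: degree_monom_eq)
  moreover have "?all 0" by (simp add: monom_0 one_pCons[symmetric])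
  ultimately obtain e where e: "?all e" "\<not> ?all (Suc e)"
    using ex_last_before[of ?all] by blast
  have "?all 1"
    using \<phi>(4) by (simp add: monom_1_dvd_iff)
  then have "e \<noteq> 0" using e(2) by (cases e) auto
  then show thesis using that[OF \<phi>(1,2,3), of e] e by simp
qed

text \<open>\<open>Q\<close> is the ideal of the elements whose order exceeds the minimal order in each degree.\<close>

lemma fat_point_minimal_prime_proj_point:
  fixes I :: "'n::finite cpoly set"
  assumes I: "fat_point I"
    and p: "minimal_prime (assoc_graded poly_ring I) p"
  shows "p \<in> proj_points (assoc_graded poly_ring I) (assoc_graded_piece poly_ring I)"
proof (rule ccontr)
  interpret class_ideal I
    by (rule class_ideal.intro) (use I in \<open>simp add: fat_point_def\<close>)
  assume "p \<notin> proj_points Gr (assoc_graded_piece R I)"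
  moreover have pp: "primeideal p Gr" using p by (simp add: minimal_prime_def)
  \<comment> \<open>A minimal prime is homogeneous, so it fails to be a point of \<open>Proj\<close>
    only by containing every piece of positive degree.\<close>
  ultimately have irr: "assoc_graded_piece R I d \<subseteq> p" if "d \<ge> 1" for d
    using gr.S.minimal_prime_hom_ideal[OF p] that by (simp add: gr.S.proj_points_iff)
  obtain \<phi> :: "'n cpoly \<Rightarrow> complex poly" and e
    where \<phi>: "\<forall>f g. \<phi> (f + g) = \<phi> f + \<phi> g" "\<forall>f g. \<phi> (f * g) = \<phi> f * \<phi> g"
    and one: "\<phi> 1 = 1" and e: "e \<ge> 1" and e_dvd: "\<forall>f\<in>I. monom 1 e dvd \<phi> f"
    and f0: "\<exists>f\<in>I. \<not> monom 1 (Suc e) dvd \<phi> f"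
    by (rule fat_point_order[OF I])
  note add = \<phi>(1)[rule_format] and mult = \<phi>(2)[rule_format]
  have zero: "\<phi> 0 = 0" using add[of 0 0] by simp
  have Pow_dvd: "monom 1 (d * e) dvd \<phi> f" if "f \<in> Pow d" for d f
    using that
  proof (induction d arbitrary: f)
    case 0
    then show ?case by (simp add: monom_0 one_pCons[symmetric])
  next
    case (Suc d)
    from Suc.prems show ?case
    proof (induction f rule: Pow_Suc_induct)
      case (prod i j)
      have "monom 1 e * monom 1 (d * e) dvd \<phi> i * \<phi> j"
        using prod Suc.IH by (intro mult_dvd_mono e_dvd[rule_format])
      then show ?case by (simp add: mult mult_monom)
    next
      case (sum x y)
      then show ?case by (simp add: add)
    qed
  qed
  let ?Q = "{f \<in> carrier Rees. \<forall>d. monom 1 (Suc (d * e)) dvd \<phi> (f d)}"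
  have dvd_sum: "x dvd \<phi> (sum h F)" if "\<And>i. i \<in> F \<Longrightarrow> x dvd \<phi> (h i)" for x h and F :: "nat set"
    using that by (induction F rule: infinite_finite_induct) (simp_all add: zero add)
  have dvd_mult: "monom 1 (Suc ((d + k) * e)) dvd \<phi> (x * y)"
    if "x \<in> Pow d" "monom 1 (Suc (k * e)) dvd \<phi> y" for x y d k
  proof -
    have "monom 1 (d * e) * monom 1 (Suc (k * e)) dvd \<phi> x * \<phi> y"
      using that Pow_dvd by (intro mult_dvd_mono)
    then show ?thesis by (simp add: mult mult_monom add_mult_distrib)
  qed
  have Q: "gr.R.hom_ideal ?Q"
    unfolding gr.R.hom_ideal_def
  proof
    show "ideal ?Q Rees"
      unfolding gr.R.ideal_iff
    proof (intro conjI ballI)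
      show "?Q \<subseteq> carrier Rees" by auto
      show "\<zero>\<^bsub>Rees\<^esub> \<in> ?Q" using gr.R.zero_closed by (simp add: Rees_simps zero)
      show "f \<oplus>\<^bsub>Rees\<^esub> g \<in> ?Q" if "f \<in> ?Q" "g \<in> ?Q" for f g
        using that gr.R.a_closed[of f g] by (simp add: Rees_simps add)
      show "f \<otimes>\<^bsub>Rees\<^esub> g \<in> ?Q" if f: "f \<in> carrier Rees" and g: "g \<in> ?Q" for f g
      proof -
        have "monom 1 (Suc (d * e)) dvd \<phi> (\<Sum>i\<le>d. f i * g (d - i))" for d
        proof (rule dvd_sum)
          fix i assume "i \<in> {..d}"
          then show "monom 1 (Suc (d * e)) dvd \<phi> (f i * g (d - i))"
            using dvd_mult[of "f i" i "d - i" "g (d - i)"] f g by (simp add: Rees_carrier)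
        qed
        then show ?thesis using f g gr.R.m_closed[of f g] by (simp add: Rees_simps)
      qed
    qed
    show "\<forall>f\<in>?Q. \<forall>d. rees_component d f \<in> ?Q"
    proof (intro ballI allI)
      fix f d assume f: "f \<in> ?Q"
      then have "rees_component d f \<in> carrier Rees" by simp
      then show "rees_component d f \<in> ?Q" using f by (simp add: rees_component_def zero)
    qed
  qed
  \<comment> \<open>Dividing the restriction of an element of degree d by t^(d e) and evaluating at
    0 gives a leading coefficient, multiplicative in homogeneous elements. Membership in
    \<open>?Q\<close> means that it vanishes, and a product of complex numbers vanishes only with
    one of its factors.\<close>
  have primeQ: "primeideal ?Q Rees"
  proof (rule gr.R.primeideal_homogeneousI[OF Q])
    have "\<not> monom 1 (Suc (0 * e)) dvd \<phi> (\<one>\<^bsub>Rees\<^esub> 0)"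
      by (simp add: Rees_simps one monom_Suc monom_0 is_unit_iff_degree)
    then show "\<one>\<^bsub>Rees\<^esub> \<notin> ?Q" by blast
    fix d k f g assume f: "f \<in> rees_piece R I d" and g: "g \<in> rees_piece R I k"
      and fg: "f \<otimes>\<^bsub>Rees\<^esub> g \<in> ?Q"
    have fc: "f \<in> carrier Rees" "g \<in> carrier Rees" using f g by simp_all
    obtain u where u: "\<phi> (f d) = monom 1 (d * e) * u"
      using Pow_dvd[of "f d" d] f by (auto simp: rees_piece_iff dvd_def)
    obtain w where w: "\<phi> (g k) = monom 1 (k * e) * w"
      using Pow_dvd[of "g k" k] g by (auto simp: rees_piece_iff dvd_def)
    have "f \<otimes>\<^bsub>Rees\<^esub> g = mono (d + k) (f d * g k)"
      using rees_piece_mono[OF f] rees_piece_mono[OF g] mono_mult by metis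
    then have "(f \<otimes>\<^bsub>Rees\<^esub> g) (d + k) = f d * g k" by (simp add: mono_def)
    then have "monom 1 (Suc ((d + k) * e)) dvd \<phi> (f d * g k)" using fg by (metis (mono_tags, lifting) mem_Collect_eq)
    then have "monom 1 ((d + k) * e) * monom 1 1 dvd monom 1 ((d + k) * e) * (u * w)"
    proof -
      have "\<phi> (f d * g k) = (monom 1 (d * e) * monom 1 (k * e)) * (u * w)"
        unfolding mult u w by (simp only: ac_simps)
      then have "\<phi> (f d * g k) = monom 1 ((d + k) * e) * (u * w)"
        by (simp add: mult_monom add_mult_distrib)
      moreover have "monom 1 (Suc ((d + k) * e)) = monom 1 ((d + k) * e) * monom (1 :: complex) 1"
        by (simp add: mult_monom)
      ultimately show ?thesis using \<open>monom 1 (Suc ((d + k) * e)) dvd \<phi> (f d * g k)\<close> by metis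
    qed
    then have "monom 1 1 dvd u * w" by (subst (asm) dvd_times_left_cancel_iff) auto
    then have "poly (u * w) 0 = 0"
      by (simp add: monom_1_dvd_iff)
    then consider "monom 1 1 dvd u" | "monom 1 1 dvd w"
      by (auto simp: monom_1_dvd_iff)
    then have "monom 1 (Suc (d * e)) dvd \<phi> (f d) \<or> monom 1 (Suc (k * e)) dvd \<phi> (g k)"
    proof cases
      case 1
      then have "monom 1 (d * e) * monom 1 1 dvd \<phi> (f d)" unfolding u by (rule mult_dvd_mono[OF dvd_refl])
      then show ?thesis by (simp add: mult_monom)
    next
      case 2
      then have "monom 1 (k * e) * monom 1 1 dvd \<phi> (g k)" unfolding w by (rule mult_dvd_mono[OF dvd_refl])
      then show ?thesis by (simp add: mult_monom)
    qed
    then show "f \<in> ?Q \<or> g \<in> ?Q"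
    proof
      assume *: "monom 1 (Suc (d * e)) dvd \<phi> (f d)"
      have "monom 1 (Suc (m * e)) dvd \<phi> (f m)" for m
        using * f zero by (cases "m = d") (simp_all add: rees_piece_iff)
      then show ?thesis using fc by simp
    next
      assume *: "monom 1 (Suc (k * e)) dvd \<phi> (g k)"
      have "monom 1 (Suc (m * e)) dvd \<phi> (g m)" for m
        using * g zero by (cases "m = k") (simp_all add: rees_piece_iff)
      then show ?thesis using fc by simp
    qed
  qed
  \<comment> \<open>The degree d part of the kernel is I^(d+1), of order at least d e + e; this
    exceeds d e because e is at least one.\<close>
  have kerQ: "gr.ker \<subseteq> ?Q"
  proof
    fix f assume f: "f \<in> gr.ker"
    have "monom 1 (Suc (d * e)) dvd \<phi> (f d)" for d
    proof -
      have "f d \<in> Pow (Suc d)" using f ker_\<pi> by blast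
      then have "monom 1 (Suc d * e) dvd \<phi> (f d)" by (rule Pow_dvd)
      moreover have "monom (1::complex) (Suc d * e) = monom 1 (Suc (d * e)) * monom 1 (e - 1)"
        using e by (simp add: mult_monom add.commute)
      ultimately show ?thesis using dvd_mult_left by metis
    qed
    then show "f \<in> ?Q" using f ker_\<pi> by blast
  qed
  \<comment> \<open>The degree zero part of \<open>p\<close> and the ideal of the point are both
    primes above \<open>I\<close>, so they coincide. This handles the inclusion of \<open>?Q\<close>
    in degree zero; in positive degrees \<open>p\<close> contains everything.\<close>
  let ?P0 = "{a. mono 0 a \<in> gr.vim p}" and ?N1 = "{f. poly (\<phi> f) 0 = 0}"
  have pv: "primeideal (gr.vim p) Rees" by (rule gr.primeideal_vim[OF pp])
  then have idv: "ideal (gr.vim p) Rees" and onev: "\<one>\<^bsub>Rees\<^esub> \<notin> gr.vim p"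
    using gr.R.primeideal_iff by blast+
  have m0c: "mono 0 a \<in> carrier Rees" for a using mono_carrier[of a 0] Pow_0 by simp
  have "?P0 = ?N1"
  proof (rule fat_point_prime_unique[OF I])
    show "primeideal ?P0 R"
      unfolding primeideal_class_iff ideal_class_iff
    proof (intro conjI ballI allI impI)
      have "mono 0 0 = \<zero>\<^bsub>Rees\<^esub>" by (simp add: mono_def Rees_simps)
      then show "0 \<in> ?P0" using idv by (simp add: gr.R.ideal_iff)
      show "x + y \<in> ?P0" if "x \<in> ?P0" "y \<in> ?P0" for x y
        using that idv by (simp add: mono_add[symmetric] gr.R.ideal_iff)
      show "r * x \<in> ?P0" if "x \<in> ?P0" for r x
        using that idv m0c mono_mult[of 0 r 0 x] by (metis (no_types, lifting) add_0 gr.R.ideal_iff mem_Collect_eq)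
      have "mono 0 1 = \<one>\<^bsub>Rees\<^esub>" by (simp add: mono_def Rees_simps)
      then show "1 \<notin> ?P0" using onev by simp
      show "x \<in> ?P0 \<or> y \<in> ?P0" if "x * y \<in> ?P0" for x y
        using that primeideal.I_prime[OF pv m0c m0c, of x y] mono_mult[of 0 x 0 y] by simp
    qed
    show "I \<subseteq> ?P0"
      using rees_const_subset_iff[OF idv] gr.ker_subset_vim[OF primeideal.axioms(1)[OF pp]]
      by (auto simp: rees_const_mono)
    show "primeideal ?N1 R"
      unfolding primeideal_class_iff ideal_class_iff by (auto simp: add mult one zero)
    show "I \<subseteq> ?N1"
    proof
      fix f assume "f \<in> I"
      then have "monom 1 (Suc (e - 1)) dvd \<phi> f" using e_dvd e by simp
      then show "f \<in> ?N1" by (auto simp: monom_Suc dvd_def)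
    qed
  qed
  have "?Q \<subseteq> gr.vim p"
  proof
    fix f assume f: "f \<in> ?Q"
    show "f \<in> gr.vim p"
    proof (rule gr.R.ideal_components[OF idv])
      show fc: "f \<in> carrier Rees" using f by simp
      fix d
      show "rees_component d f \<in> gr.vim p"
      proof (cases "d = 0")
        case True
        have "monom 1 (Suc (0 * e)) dvd \<phi> (f 0)" using f by blast
        then have "f 0 \<in> ?N1" by (auto simp: monom_Suc monom_0 dvd_def)
        then show ?thesis using \<open>?P0 = ?N1\<close> True rees_component_mono[of 0 f] by auto
      next
        case False
        have "rees_component d f \<in> rees_piece R I d" using gr.R.c_G[OF fc] .
        then have "\<pi> (rees_component d f) \<in> p" using irr[of d] False \<pi>_piece[of d] by auto
        then show ?thesis using fc by (simp add: gr.vim_def)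
      qed
    qed
  qed
  then have "\<pi> ` ?Q \<subseteq> p" by (auto simp: gr.vim_def)
  moreover have "primeideal (\<pi> ` ?Q) Gr" by (rule gr.primeideal_image[OF primeQ kerQ])
  \<comment> \<open>Minimality forces \<open>p\<close> to be the image of \<open>?Q\<close>. But
    \<open>p\<close> contains the whole degree one piece, while an element of \<open>I\<close> of
    order exactly \<open>e\<close>, placed in degree one, is missing from \<open>?Q\<close>.\<close>
  ultimately have "\<pi> ` ?Q = p" using p by (simp add: minimal_prime_def)
  then have "gr.vim p = ?Q"
    using gr.vim_image[OF primeideal.axioms(1)[OF primeQ] kerQ] by simp
  obtain f where f: "f \<in> I" "\<not> monom 1 (Suc e) dvd \<phi> f" using f0 by blast
  have m1: "mono 1 f \<in> rees_piece R I 1" using mono_mem[of f 1] I_Pow_1[OF f(1)] by simp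
  then have "\<pi> (mono 1 f) \<in> p" using irr[of 1] \<pi>_piece[of 1] by auto
  then have "mono 1 f \<in> gr.vim p" using m1 by (simp add: gr.vim_def)
  then have "monom 1 (Suc (1 * e)) dvd \<phi> (mono 1 f 1)" unfolding \<open>gr.vim p = ?Q\<close> by blast
  then show False using f(2) by (simp add: mono_def)
qed

section \<open>Components of the cones\<close>

text \<open>Separates the comparison of the cones from the geometry of fat points, which enters by
  establishing \<open>minimal_proj\<close>.\<close>

locale cone_without_irrelevant_components = class_ideal I for I :: "'a::comm_ring_1 set" +
  assumes minimal_proj: "minimal_prime Gr p \<Longrightarrow> p \<in> proj_points Gr (assoc_graded_piece R I)"
begin

abbreviation PC where "PC \<equiv> proj_points Gr (assoc_graded_piece R I)"
abbreviation PR where "PR \<equiv> {q \<in> proj_points Rees (rees_piece R I). gr.ker \<subseteq> q}"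

text \<open>The nested comprehension repeats the shape of the lemmas on spaces of primes, with
  \<open>X\<close> the set of all primes; \<open>VP\<close> does the same for the points of
  \<open>Proj\<close>.\<close>

definition V :: "(nat \<Rightarrow> 'a set) set \<Rightarrow> (nat \<Rightarrow> 'a set) set set"
  where "V p = {q \<in> {q. primeideal q Gr}. p \<subseteq> q}"

definition VP :: "(nat \<Rightarrow> 'a set) set \<Rightarrow> (nat \<Rightarrow> 'a set) set set"
  where "VP p = {q \<in> PC. p \<subseteq> q}"

lemma PC_prime: "PC \<subseteq> {q. primeideal q Gr}"
  by (auto simp: gr.S.proj_points_iff)

lemma PR_prime: "PR \<subseteq> {q. primeideal q Rees}"
  by (auto simp: gr.R.proj_points_iff)

text \<open>A prime below a point of \<open>Proj\<close> may be replaced by its homogeneous part,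
  which still misses an element of positive degree. Hence minimality among points of
  \<open>Proj\<close> implies minimality among all primes; the converse rests on
  \<open>minimal_proj\<close>.\<close>

lemma minimal_PC: "{p \<in> PC. \<forall>q\<in>PC. q \<subseteq> p \<longrightarrow> q = p} = Collect (minimal_prime Gr)"
proof (intro equalityI subsetI)
  fix p assume "p \<in> {p \<in> PC. \<forall>q\<in>PC. q \<subseteq> p \<longrightarrow> q = p}"
  then have p: "p \<in> PC" "\<And>q. q \<in> PC \<Longrightarrow> q \<subseteq> p \<Longrightarrow> q = p" by auto
  have "q = p" if q: "primeideal q Gr" "q \<subseteq> p" for q
  proof -
    have sub: "gr.S.hom_part q \<subseteq> q"
      by (rule gr.S.hom_part_subset[OF primeideal.axioms(1)[OF q(1)]])
    moreover have "gr.S.hom_part q \<in> PC"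
      using gr.S.primeideal_hom_part[OF q(1)] gr.S.hom_part_hom_ideal[OF primeideal.axioms(1)[OF q(1)]]
        p(1) sub q(2) unfolding gr.S.proj_points_iff by blast
    ultimately show ?thesis using p(2) q(2) by blast
  qed
  then show "p \<in> Collect (minimal_prime Gr)"
    using p(1) by (simp add: minimal_prime_def gr.S.proj_points_iff)
next
  fix p assume "p \<in> Collect (minimal_prime Gr)"
  then show "p \<in> {p \<in> PC. \<forall>q\<in>PC. q \<subseteq> p \<longrightarrow> q = p}"
    using minimal_proj[of p] PC_prime by (auto simp: minimal_prime_def)
qed

lemma top_space_normal_cone:
  "top_space (normal_cone R I) = subtopology (spec_topology Gr) {q. primeideal q Gr}"
  by (simp add: normal_cone_def Spec_def gr.S.topspace_spec[symmetric])

lemma top_space_projective_cone: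
  "top_space (projective_cone R I) = subtopology (spec_topology Gr) PC"
  by (simp add: projective_cone_def Proj_def)

text \<open>Lying over V(I) means containing \<open>I\<close> in degree zero, and the ideal
  generated by that part is the kernel of \<pi>.\<close>

lemma top_space_exceptional_divisor:
  "top_space (exceptional_divisor R I) = subtopology (spec_topology Rees) PR"
proof -
  have "I \<subseteq> blowdown R q \<longleftrightarrow> gr.ker \<subseteq> q" if "q \<in> proj_points Rees (rees_piece R I)" for q
  proof -
    have "ideal q Rees" using that by (simp add: gr.R.proj_points_iff gr.R.primeideal_iff)
    then have "gr.ker \<subseteq> q \<longleftrightarrow> rees_const R ` I \<subseteq> q" by (simp add: rees_const_subset_iff)
    then show ?thesis by (auto simp: blowdown_def carrier_class)
  qed
  then have "proj_points Rees (rees_piece R I) \<inter> {q. I \<subseteq> blowdown R q} = PR" by blast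
  then show ?thesis
    by (simp add: exceptional_divisor_def blowup_def Proj_def subtopology_subtopology)
qed

lemma components_normal_cone:
  "irred_components (normal_cone R I) = V ` Collect (minimal_prime Gr)"
proof -
  have "{p \<in> {q. primeideal q Gr}. \<forall>q\<in>{q. primeideal q Gr}. q \<subseteq> p \<longrightarrow> q = p} =
      Collect (minimal_prime Gr)"
    by (auto simp: minimal_prime_def)
  then show ?thesis
    using gr.S.irred_components_primes[OF subset_refl _ top_space_normal_cone]
    unfolding V_def[abs_def] by simp
qed

lemma components_projective_cone:
  "irred_components (projective_cone R I) = VP ` Collect (minimal_prime Gr)"
  using gr.S.irred_components_primes[OF PC_prime gr.S.Inter_proj_points top_space_projective_cone]
  unfolding minimal_PC VP_def[abs_def] by simp

lemma projectivization_V: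
  assumes "primeideal p Gr"
  shows "projectivization R I (V p) = VP p"
proof -
  have "\<Inter>(V p) = p" using assms by (auto simp: V_def)
  then show ?thesis by (simp add: projectivization_def VP_def)
qed

text \<open>Injectivity holds because the generic point survives: \<open>p\<close> belongs to
  \<open>VP p\<close> and is its least element.\<close>

lemma bij_betw_projectivization:
  "bij_betw (projectivization R I) (irred_components (normal_cone R I))
     (irred_components (projective_cone R I))"
proof -
  have proj: "projectivization R I (V p) = VP p" if "minimal_prime Gr p" for p
    using that projectivization_V by (simp add: minimal_prime_def)
  have inj: "p = q" if "minimal_prime Gr p" "minimal_prime Gr q" "VP p = VP q" for p q
  proof -
    have "p \<in> VP p" "q \<in> VP q" using that(1,2) minimal_proj by (auto simp: VP_def)
    then have "p \<in> VP q" "q \<in> VP p" using that(3) by simp_all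
    then show ?thesis by (auto simp: VP_def)
  qed
  show ?thesis
    unfolding components_normal_cone components_projective_cone
  proof (rule bij_betw_imageI)
    show "inj_on (projectivization R I) (V ` Collect (minimal_prime Gr))"
      using proj inj by (auto simp: inj_on_def)
    have "projectivization R I ` V ` Collect (minimal_prime Gr) =
        (\<lambda>p. projectivization R I (V p)) ` Collect (minimal_prime Gr)"
      by (simp add: image_image)
    also have "\<dots> = VP ` Collect (minimal_prime Gr)"
      by (rule image_cong) (simp_all add: proj)
    finally show "projectivization R I ` V ` Collect (minimal_prime Gr) = VP ` Collect (minimal_prime Gr)" .
  qed
qed

lemma multiplicity_normal_cone:
  "primeideal p Gr \<Longrightarrow>
    multiplicity_along (V p) (normal_cone R I) = ring_length (localization Gr (carrier Gr - p))"
  using gr.S.generic_point_primes[OF subset_refl top_space_normal_cone, of p]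
  by (simp add: multiplicity_along_def V_def normal_cone_def Spec_def)

lemma multiplicity_projective_cone:
  "p \<in> PC \<Longrightarrow> multiplicity_along (VP p) (projective_cone R I) =
    ring_length (homogeneous_localization Gr (assoc_graded_piece R I) p)"
  using gr.S.generic_point_primes[OF PC_prime top_space_projective_cone, of p]
  by (simp add: multiplicity_along_def VP_def projective_cone_def Proj_def)

lemma cone_to_exceptional_vim: "cone_to_exceptional R I = gr.vim"
  by (simp add: fun_eq_iff cone_to_exceptional_def gr.vim_def)

lemma cone_to_exceptional_VP:
  assumes "p \<in> PC"
  shows "cone_to_exceptional R I ` VP p = {q \<in> PR. gr.vim p \<subseteq> q}"
proof -
  have "ideal p Gr" using assms by (simp add: gr.S.proj_points_iff gr.S.primeideal_iff)
  then show ?thesis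
    unfolding cone_to_exceptional_vim VP_def by (simp add: gr.vim_image_proj_points conj_assoc)
qed

text \<open>Contraction along \<pi> preserves and reflects inclusion and reaches every point of
  \<open>PR\<close>, so a minimal prime contracts to a minimal point of the exceptional
  divisor.\<close>

lemma component_exceptional_divisor:
  assumes p: "minimal_prime Gr p"
  shows "cone_to_exceptional R I ` VP p \<in> irred_components (exceptional_divisor R I)"
proof -
  have PC: "p \<in> PC" by (rule minimal_proj[OF p])
  have ideal: "ideal q Gr" if "q \<in> PC" for q
    using that by (simp add: gr.S.proj_points_iff gr.S.primeideal_iff)
  have Inter: "\<Inter>W \<in> PR" if "W \<subseteq> PR" "W \<noteq> {}" "primeideal (\<Inter>W) Rees" for W
  proof -
    have "\<Inter>W \<in> proj_points Rees (rees_piece R I)"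
      using that by (intro gr.R.Inter_proj_points) auto
    then show ?thesis using that(1) by blast
  qed
  have "gr.vim p \<in> PR" using gr.vim_proj_points[OF PC] by simp
  moreover have "q = gr.vim p" if q: "q \<in> PR" "q \<subseteq> gr.vim p" for q
  proof -
    have q': "q \<in> proj_points Rees (rees_piece R I)" "gr.ker \<subseteq> q" using q(1) by auto
    note im = gr.image_proj_points[OF q']
    have "\<pi> ` q \<subseteq> p"
      using gr.vim_strict_mono[OF ideal[OF im(1)] ideal[OF PC]] im(2) q(2) by simp
    then have "\<pi> ` q = p" using p im(1) by (simp add: minimal_prime_def gr.S.proj_points_iff)
    then show ?thesis using im(2) by simp
  qed
  ultimately have "gr.vim p \<in> {p \<in> PR. \<forall>q\<in>PR. q \<subseteq> p \<longrightarrow> q = p}" by blast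
  moreover have "irred_components (exceptional_divisor R I) =
      (\<lambda>p. {q \<in> PR. p \<subseteq> q}) ` {p \<in> PR. \<forall>q\<in>PR. q \<subseteq> p \<longrightarrow> q = p}"
    by (rule gr.R.irred_components_primes[OF PR_prime _ top_space_exceptional_divisor]) (rule Inter)
  ultimately show ?thesis
    unfolding cone_to_exceptional_VP[OF PC] by blast
qed

text \<open>The stalk is a homogeneous local ring of the Rees algebra modulo the fractions a/1 with
  a in \<open>I\<close>; this is the quotient compared earlier, with \<open>A0\<close> the elements
  of \<open>I\<close> placed in degree zero.\<close>

lemma multiplicity_exceptional_divisor:
  assumes p: "p \<in> PC"
  shows "multiplicity_along (cone_to_exceptional R I ` VP p) (exceptional_divisor R I) =
    ring_length (homogeneous_localization Gr (assoc_graded_piece R I) p)"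
proof -
  obtain t where t: "t \<in> assoc_graded_piece R I 1" "t \<notin> p"
    by (rule proj_points_degree_one[OF p])
  let ?T = "(\<Union>d. rees_piece R I d) - gr.vim p"
  have "gr.vim p \<in> PR" using gr.vim_proj_points[OF p] by simp
  then have gen: "generic_point (exceptional_divisor R I) (cone_to_exceptional R I ` VP p) = gr.vim p"
    unfolding cone_to_exceptional_VP[OF p]
    by (rule gr.R.generic_point_primes[OF PR_prime top_space_exceptional_divisor])
  have "{fraction Rees ?T (rees_const R a) \<one>\<^bsub>Rees\<^esub> | a. a \<in> I} =
      (\<lambda>f. fraction Rees ?T f \<one>\<^bsub>Rees\<^esub>) ` (rees_const R ` I)"
    by auto
  then have stalk: "stalk (exceptional_divisor R I) (gr.vim p) =
      homogeneous_localization Rees (rees_piece R I) (gr.vim p) Quot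
        (Idl\<^bsub>homogeneous_localization Rees (rees_piece R I) (gr.vim p)\<^esub>
          ((\<lambda>f. fraction Rees ?T f \<one>\<^bsub>Rees\<^esub>) ` (rees_const R ` I)))"
    by (simp add: exceptional_divisor_def blowup_def Proj_def Let_def)
  have const: "rees_const R ` I \<subseteq> rees_piece R I 0"
    using mono_mem[of _ 0] Pow_0 by (auto simp: rees_const_mono)
  show ?thesis
    unfolding multiplicity_along_def gen stalk
    by (rule gr.ring_length_homogeneous_localization_quotient[OF p t const rees_const_subset_iff])
qed

lemma multiplicities:
  assumes p: "minimal_prime Gr p"
  shows "multiplicity_along (projectivization R I (V p)) (projective_cone R I) =
      multiplicity_along (V p) (normal_cone R I)"
    and "multiplicity_along (cone_to_exceptional R I ` projectivization R I (V p))
        (exceptional_divisor R I) = multiplicity_along (V p) (normal_cone R I)"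
proof -
  have PC: "p \<in> PC" by (rule minimal_proj[OF p])
  have pp: "primeideal p Gr" using p by (simp add: minimal_prime_def)
  obtain t where t: "t \<in> assoc_graded_piece R I 1" "t \<notin> p"
    by (rule proj_points_degree_one[OF PC])
  note len = gr.S.ring_length_homogeneous_localization[OF p t]
  show "multiplicity_along (projectivization R I (V p)) (projective_cone R I) =
      multiplicity_along (V p) (normal_cone R I)"
    unfolding projectivization_V[OF pp] multiplicity_projective_cone[OF PC]
      multiplicity_normal_cone[OF pp] by (rule len)
  show "multiplicity_along (cone_to_exceptional R I ` projectivization R I (V p))
        (exceptional_divisor R I) = multiplicity_along (V p) (normal_cone R I)"
    unfolding projectivization_V[OF pp] multiplicity_exceptional_divisor[OF PC]
      multiplicity_normal_cone[OF pp] by (rule len)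
qed

end

theorem lemma3p1:
  fixes I :: "'n::finite cpoly set"
  assumes "fat_point I"
  shows
    "bij_betw (projectivization poly_ring I)
       (irred_components (normal_cone poly_ring I))
       (irred_components (projective_cone poly_ring I))
     \<and> behrend_number I =
       (\<Sum>D\<in>irred_components (normal_cone poly_ring I).
          multiplicity_along (projectivization poly_ring I D) (projective_cone poly_ring I))
     \<and> (\<forall>D\<in>irred_components (normal_cone poly_ring I).
          cone_to_exceptional poly_ring I ` projectivization poly_ring I D
            \<in> irred_components (exceptional_divisor poly_ring I))
     \<and> behrend_number I =
       (\<Sum>D\<in>irred_components (normal_cone poly_ring I).
          multiplicity_along
            (cone_to_exceptional poly_ring I ` projectivization poly_ring I D)
            (exceptional_divisor poly_ring I))"
proof -
  interpret cone_without_irrelevant_components I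
  proof (intro cone_without_irrelevant_components.intro
      cone_without_irrelevant_components_axioms.intro class_ideal.intro)
    show "ideal I poly_ring" using assms by (simp add: fat_point_def)
  qed (rule fat_point_minimal_prime_proj_point[OF assms])
  have comp: "\<exists>p. minimal_prime Gr p \<and> D = V p" if "D \<in> irred_components (normal_cone poly_ring I)" for D
    using that unfolding components_normal_cone by blast
  show ?thesis
  proof (intro conjI ballI)
    show "bij_betw (projectivization poly_ring I) (irred_components (normal_cone poly_ring I))
        (irred_components (projective_cone poly_ring I))"
      by (rule bij_betw_projectivization)
    show "behrend_number I = (\<Sum>D\<in>irred_components (normal_cone poly_ring I).
        multiplicity_along (projectivization poly_ring I D) (projective_cone poly_ring I))"
      unfolding behrend_number_def using comp multiplicities(1) by (intro sum.cong) force+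
    show "behrend_number I = (\<Sum>D\<in>irred_components (normal_cone poly_ring I).
        multiplicity_along (cone_to_exceptional poly_ring I ` projectivization poly_ring I D)
          (exceptional_divisor poly_ring I))"
      unfolding behrend_number_def using comp multiplicities(2) by (intro sum.cong) force+
    fix D assume "D \<in> irred_components (normal_cone poly_ring I)"
    then obtain p where p: "minimal_prime Gr p" "D = V p" using comp by blast
    then have "projectivization poly_ring I D = VP p"
      using projectivization_V by (simp add: minimal_prime_def)
    then show "cone_to_exceptional poly_ring I ` projectivization poly_ring I D
        \<in> irred_components (exceptional_divisor poly_ring I)"
      using component_exceptional_divisor[OF p(1)] by simp
  qed
qed

end
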